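(* Let $c>0$ and $\gamma\in\mathbb R\setminus\{0\}$. Let $n\to\infty$ with $k=k(n)\to\infty$, $\frac kn\to c$, and let $q=q(n)=e^{-\gamma/n}$. For each $n$ let $\lambda$ be a random Young diagram in the $n\times k$ rectangle distributed according to one of the two probability measures (A) $\displaystyle \mu_{n,k}(\lambda|q)=\frac{s_\lambda(1,q,\dots,q^{n-1})\,s_{\bar\lambda'}(1,q,\dots,q^{k-1})}{\prod_{i=1}^n\prod_{j=1}^k(q^{i-1}+q^{j-1})}$, (B) $\displaystyle \mu_{n,k}(\lambda|q,q^{-1})=\frac{s_\lambda(1,q,\dots,q^{n-1})\,s_{\bar\lambda'}(1,q^{-1},\dots,q^{1-k})}{\prod_{i=1}^n\prod_{j=1}^k(q^{i-1}+q^{1-j})}$, and consider the random point process $\{x_i=\frac{a_i}{n}\}_{i=1}^n$ with $a_i=\lambda_i+n-i$. Define real numbers $a>0$ and $b$ in case (A) by $$a=\tfrac14\sqrt{(e^\gamma-1)(e^\gamma+1)(e^{c\gamma}-1)(e^{c\gamma}+1)},\qquad b=\frac{1+e^{\gamma(c+1)}}{2},$$ and in case (B) by $$a=\frac{e^{c\gamma}}{(1+e^{c\gamma})^2}\sqrt{2(e^\gamma-1)(e^{c\gamma}-1)(1+e^{\gamma(c+1)})},\qquad b=\frac{3e^{\gamma(2c+1)}-e^{\gamma(c+1)}+3e^{c\gamma}-e^{2c\gamma}}{(1+e^{c\gamma})^2}.$$ Then for every linear statistic $$X^{(n)}_f=\sum_{i=1}^n f(e^{\gamma x_i}),$$ where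 $f\in C^1([b-2a,b+2a])$ is real-valued and extended to a $C^1$ function on $\mathbb R$, one has $$X_f^{(n)}-\mathbb E X_f^{(n)}\longrightarrow\mathcal N\left(0,\sum_{l\ge1}l\,|\widehat f_l|^2\right)$$ in distribution as $n,k\to\infty$, where $$\widehat f_l=\frac1{2\pi}\int_0^{2\pi}f(2a\cos\theta+b)\,e^{-il\theta}\,d\theta .$$
   Context: $s_\mu$ denotes the Schur polynomial. For $\lambda$ with at most $n$ rows and at most $k$ columns, $\bar\lambda$ is the complement in the $n\times k$ rectangle, $\bar\lambda_i=k-\lambda_{n+1-i}$, and $\bar\lambda'$ is its conjugate (transposed) diagram. The interval $[b-2a,b+2a]$ is the support of the limit density of the points $x_i$ expressed in the variable $e^{\gamma t}$, where the limit density is $$\rho(t)=\frac1\pi\arccos\left(\mathrm{sgn}(-\gamma)\frac{e^{\gamma-\frac{\gamma t}2}}{2}\frac{1-e^{\gamma(c-1)}}{\sqrt{(1-e^{\gamma t})(1-e^{\gamma(c+1-t)})}}\right)$$ in case (A), and $$\rho(t)=\frac1\pi\arccos\left(\mathrm{sgn}(-\gamma)\frac{e^{\frac\gamma2(t-c)}}{2}\frac{1-e^{\gamma c}-e^{\gamma(c-t)}+e^{\gamma(c+1-t)}}{\sqrt{(1-e^{\gamma t})(1-e^{\gamma(c+1-t)})}}\right)$$ in case (B); here "support" means the set of $e^{\gamma t}$, $0<t<c+1$, for which the argument of $\arccos$ lies in $[-1,1]$. $\mathcal N(0,\sigma^2)$ is the centered normal distribution with variance $\sigma^2$. *)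

theory Defs
  imports "HOL-Probability.Probability" "Jordan_Normal_Form.Determinant"
begin

(* Rows and columns are numbered from 0.  A Young diagram is the weakly decreasing
   function giving its row lengths, with row length 0 beyond the last row. *)

definition diagrams :: "nat \<Rightarrow> nat \<Rightarrow> (nat \<Rightarrow> nat) set" where
  "diagrams n k = {\<mu>. antimono \<mu> \<and> (\<forall>i. \<mu> i \<le> k) \<and> (\<forall>i\<ge>n. \<mu> i = 0)}"

definition complement_diagram :: "nat \<Rightarrow> nat \<Rightarrow> (nat \<Rightarrow> nat) \<Rightarrow> nat \<Rightarrow> nat" where
  "complement_diagram n k \<mu> i = (if i < n then k - \<mu> (n - 1 - i) else 0)"

definition conjugate_diagram :: "(nat \<Rightarrow> nat) \<Rightarrow> nat \<Rightarrow> nat" where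
  "conjugate_diagram \<mu> j = card {i. j < \<mu> i}"

definition alternant :: "nat \<Rightarrow> (nat \<Rightarrow> nat) \<Rightarrow> (nat \<Rightarrow> real) \<Rightarrow> real" where
  "alternant n e x = Determinant.det (Matrix.mat n n (\<lambda>(i, j). x i ^ e j))"

(* The value of the Schur polynomial s_mu(x 0, ..., x (n-1)) as the quotient of alternants
   det (x_i ^ (mu_j + n - j)) / det (x_i ^ (n - j)), the denominator being the Vandermonde
   determinant.  This presupposes that mu has at most n rows and that x 0, ..., x (n-1)
   are pairwise distinct; at coincident points the quotient is 0/0. *)
definition schur :: "nat \<Rightarrow> (nat \<Rightarrow> nat) \<Rightarrow> (nat \<Rightarrow> real) \<Rightarrow> real" where
  "schur n \<mu> x = alternant n (\<lambda>j. \<mu> j + (n - 1 - j)) x / alternant n (\<lambda>j. n - 1 - j) x"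

definition skew_howe_weight :: "nat \<Rightarrow> nat \<Rightarrow> real \<Rightarrow> real \<Rightarrow> (nat \<Rightarrow> nat) \<Rightarrow> real" where
  "skew_howe_weight n k q r \<mu> =
     schur n \<mu> (\<lambda>i. q ^ i) * schur k (conjugate_diagram (complement_diagram n k \<mu>)) (\<lambda>j. r ^ j)
     / (\<Prod>i<n. \<Prod>j<k. q ^ i + r ^ j)"

(* mu_{n,k}(. | q) is the case r = q, and mu_{n,k}(. | q, 1/q) is the case r = 1/q. *)
definition skew_howe_measure :: "nat \<Rightarrow> nat \<Rightarrow> real \<Rightarrow> real \<Rightarrow> (nat \<Rightarrow> nat) measure" where
  "skew_howe_measure n k q r =
     point_measure (diagrams n k) (\<lambda>\<mu>. ennreal (skew_howe_weight n k q r \<mu>))"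

definition particle :: "nat \<Rightarrow> (nat \<Rightarrow> nat) \<Rightarrow> nat \<Rightarrow> real" where
  "particle n \<mu> i = real (\<mu> i + (n - 1 - i)) / real n"

definition linear_statistic :: "real \<Rightarrow> (real \<Rightarrow> real) \<Rightarrow> nat \<Rightarrow> (nat \<Rightarrow> nat) \<Rightarrow> real" where
  "linear_statistic \<gamma> f n \<mu> = (\<Sum>i<n. f (exp (\<gamma> * particle n \<mu> i)))"

definition fourier_coeff :: "(real \<Rightarrow> real) \<Rightarrow> real \<Rightarrow> real \<Rightarrow> nat \<Rightarrow> complex" where
  "fourier_coeff f a b l =
     complex_of_real (1 / (2 * pi)) *
     integral {0..2 * pi}
       (\<lambda>\<theta>. complex_of_real (f (2 * a * cos \<theta> + b)) * exp (- \<i> * of_nat l * complex_of_real \<theta>))"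

(* normal_density 0 0 is identically 0, so the degenerate law, which occurs for instance
   for constant f, is given separately. *)
definition centered_normal :: "real \<Rightarrow> real measure" where
  "centered_normal v =
     (if v = 0 then return borel 0
      else density lborel (\<lambda>x. ennreal (normal_density 0 (sqrt v) x)))"

end

theory Submission
  imports Defs
begin

text \<open>
  Put \<open>t = exp (\<gamma> / n) = 1 / q\<close> and \<open>M = n + k\<close>. A diagram in the rectangle occupies the \<open>n\<close> sites
  \<open>\<lambda>\<^sub>i + n - i\<close> of \<open>{0..<M}\<close>, and the sites left empty are exactly those occupied by the conjugate of the
  complementary diagram. At geometric progressions the Schur polynomials are therefore, up to constants,
  Vandermonde products, one over the particles and one over the holes, and the product over the holes is
  a constant times the one over the particles divided by one-particle factors
  (\<open>abs_vdm_complement\<close>). Hence the weight of \<open>\<lambda>\<close> is the squared Vandermonde product of the nodes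
  \<open>t\<^sup>x\<close> times a one-particle weight (\<open>weight_eq_vdm\<close>), and the dual Cauchy identity
  (\<open>abs_dual_cauchy\<close>) gives it total mass one. The one-particle weight is the one of the
  \<open>q\<close>-Krawtchouk polynomials, with a parameter that moves with \<open>n\<close> and differs in the two cases. So the
  particles form the ensemble whose probabilities are squared Slater determinants of the first \<open>n\<close>
  orthonormal functions, and multiplication by the node is, in these functions, a tridiagonal matrix with
  explicit entries. Around the index \<open>n\<close> these converge to constants, \<open>b\<close> on the diagonal and \<open>a\<close> next to
  it (\<open>ensemble_sequence\<close>).
  
  The Gaussian limit is a commutator computation in the spirit of free fermions. Multiplying a Slater
  determinant by \<open>\<Sum>\<^sub>i g(x\<^sub>i)\<close> replaces its columns, one at a time, by their products with \<open>g\<close>; so the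
  moments of the linear statistic are the values at the filled levels \<open>0, \<dots>, n - 1\<close> of powers of a
  hopping operator built from the matrix \<open>G\<close> of multiplication by \<open>g\<close> (\<open>moments_eq_hop_centered\<close>). Split
  \<open>G\<close> into its strictly lowering part and the rest. The rest acts on the pairing with the filled levels by
  the scalar \<open>\<Sum>\<^sub>j\<^sub><\<^sub>n G\<^sub>j\<^sub>j\<close>, which is the mean; and nothing can be lowered from the filled levels. Hence the
  centred moments are generated by commuting the lowering part through the powers of \<open>G\<close>. For
  polynomial \<open>g\<close> the matrix is banded and looks like a Toeplitz matrix near the level \<open>n\<close>, its entries
  being the cosine coefficients of \<open>\<theta> \<mapsto> g (2 a cos \<theta> + b)\<close> (\<open>poly_mult_mat_limit\<close>). Toeplitz matrices
  commute, so the commutator only contributes its trace over the filled levels, which tends to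
  \<open>\<sigma>\<^sup>2 = \<Sum> l g\<^sub>l\<^sup>2\<close>. The result is the recursion \<open>m\<^sub>r\<^sub>+\<^sub>1 = r \<sigma>\<^sup>2 m\<^sub>r\<^sub>-\<^sub>1\<close> of the Gaussian moments
  (\<open>wick_moments\<close>).
  
  For a continuously differentiable function, the variance is
  \<open>1/2 \<Sum>\<^sub>x\<^sub>,\<^sub>y (g x - g y)\<^sup>2 K(x,y)\<^sup>2\<close> with the projection kernel \<open>K\<close> (\<open>offdiag_eq_kernel\<close>), hence at most the
  squared Lipschitz constant times the variance for the identity, which converges. Polynomials that
  approximate the function together with its derivative thus approximate the characteristic functions
  uniformly in all large \<open>n\<close>. The same inequality, passed to the limit for polynomials, shows that the series
  of the variance converges and depends continuously on the function. Levy's theorem concludes.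
\<close>

section \<open>Hopping operators on functionals of index tuples\<close>

text \<open>
  An index tuple \<open>s\<close> stands for the product of basis functions number \<open>s 0, \<dots>, s (n - 1)\<close>, one in each
  variable, and a functional \<open>F\<close> of tuples is thought of as extended multilinearly. The operator applies
  the one-particle matrix \<open>B\<close> to one variable at a time and sums over the variables.
\<close>

definition hop :: "nat \<Rightarrow> nat \<Rightarrow> (nat \<Rightarrow> nat \<Rightarrow> real) \<Rightarrow> ((nat \<Rightarrow> nat) \<Rightarrow> real) \<Rightarrow> (nat \<Rightarrow> nat) \<Rightarrow> real" where
  "hop M n B F s = (\<Sum>j<n. \<Sum>i<M. B i (s j) * F (s(j := i)))"

definition vacuum_trace :: "nat \<Rightarrow> (nat \<Rightarrow> nat \<Rightarrow> real) \<Rightarrow> real" where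
  "vacuum_trace n B = (\<Sum>j<n. B j j)"

definition hop_centered :: "nat \<Rightarrow> nat \<Rightarrow> (nat \<Rightarrow> nat \<Rightarrow> real) \<Rightarrow> ((nat \<Rightarrow> nat) \<Rightarrow> real) \<Rightarrow> (nat \<Rightarrow> nat) \<Rightarrow> real" where
  "hop_centered M n B F s = hop M n B F s - vacuum_trace n B * F s"

definition alternating :: "nat \<Rightarrow> ((nat \<Rightarrow> nat) \<Rightarrow> real) \<Rightarrow> bool" where
  "alternating n F \<longleftrightarrow> (\<forall>s i j. i < n \<longrightarrow> j < n \<longrightarrow> i \<noteq> j \<longrightarrow> F (s \<circ> Transposition.transpose i j) = - F s)"

text \<open>
  The pairing with the Slater determinant of the filled levels \<open>0, \<dots>, n - 1\<close>, reduced to the properties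
  from which the moments are computed.
\<close>

definition vacuum :: "nat \<Rightarrow> ((nat \<Rightarrow> nat) \<Rightarrow> real) \<Rightarrow> bool" where
  "vacuum n \<epsilon> \<longleftrightarrow> alternating n \<epsilon> \<and> (\<forall>s j. j < n \<longrightarrow> n \<le> s j \<longrightarrow> \<epsilon> s = 0) \<and> \<epsilon> id = 1 \<and> (\<forall>s. \<bar>\<epsilon> s\<bar> \<le> 1)"

definition mat_prod :: "nat \<Rightarrow> (nat \<Rightarrow> nat \<Rightarrow> real) \<Rightarrow> (nat \<Rightarrow> nat \<Rightarrow> real) \<Rightarrow> nat \<Rightarrow> nat \<Rightarrow> real" where
  "mat_prod M B C i j = (\<Sum>l<M. B i l * C l j)"

lemma alternating_dup:
  assumes "alternating n F" "i < n" "j < n" "i \<noteq> j" "s i = s j"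
  shows "F s = 0"
proof -
  have "s \<circ> Transposition.transpose i j = s"
    using assms(5) by (auto simp: fun_eq_iff Transposition.transpose_def)
  then have "F s = - F s"
    using assms(1)[unfolded alternating_def, rule_format, OF assms(2-4), of s] by simp
  then show ?thesis by simp
qed

text \<open>
  Exchanging two entries of a tuple permutes the \<open>n\<close> summands of the operator.
\<close>

lemma alternating_hop:
  assumes "alternating n F"
  shows "alternating n (hop M n B F)"
  unfolding alternating_def
proof (intro allI impI)
  fix s :: "nat \<Rightarrow> nat" and i j assume ij: "i < n" "j < n" "i \<noteq> j"
  let ?t = "Transposition.transpose i j"
  have upd: "(s \<circ> ?t)(l := v) = s(?t l := v) \<circ> ?t" for l and v :: nat
    by (auto simp: fun_eq_iff Transposition.transpose_def)
  have neg: "F (u \<circ> ?t) = - F u" for u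
    using assms ij unfolding alternating_def by blast
  have bij: "bij_betw ?t {..<n} {..<n}"
    using ij by (intro permutes_imp_bij permutes_swap_id) auto
  have "hop M n B F (s \<circ> ?t) = (\<Sum>l<n. \<Sum>v<M. B v (s (?t l)) * F (s(?t l := v) \<circ> ?t))"
    by (simp add: hop_def upd)
  also have "\<dots> = (\<Sum>l<n. \<Sum>v<M. B v (s (?t l)) * - F (s(?t l := v)))"
    using neg by simp
  also have "\<dots> = (\<Sum>l<n. \<Sum>v<M. B v (s l) * - F (s(l := v)))"
    by (rule sum.reindex_bij_betw[OF bij])
  also have "\<dots> = - hop M n B F s"
    by (simp add: hop_def sum_negf)
  finally show "hop M n B F (s \<circ> ?t) = - hop M n B F s" .
qed

lemma alternating_hop_centered:
  assumes "alternating n F"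
  shows "alternating n (hop_centered M n B F)"
  using alternating_hop[OF assms, of M B] assms
  unfolding alternating_def hop_centered_def by (simp add: algebra_simps)

text \<open>
  Hops of two different entries commute; only the terms in which both matrices act on the same entry
  survive, and they compose there as matrices.
\<close>

lemma hop_commutator:
  "hop M n B (hop M n C F) s - hop M n C (hop M n B F) s
     = hop M n (\<lambda>i j. mat_prod M C B i j - mat_prod M B C i j) F s"
proof -
  define R where "R B C = (\<Sum>j<n. \<Sum>j'<n. if j = j' then 0 else
      \<Sum>i<M. \<Sum>i'<M. B i (s j) * (C i' (s j') * F (s(j := i, j' := i'))))" for B C :: "nat \<Rightarrow> nat \<Rightarrow> real"
  have exp: "hop M n B (hop M n C F) s = hop M n (mat_prod M C B) F s + R B C" for B C
  proof -
    have inner: "(\<Sum>i<M. B i (s j) * hop M n C F (s(j := i)))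
        = (\<Sum>i'<M. mat_prod M C B i' (s j) * F (s(j := i')))
          + (\<Sum>j'<n. if j = j' then 0 else
              \<Sum>i<M. \<Sum>i'<M. B i (s j) * (C i' (s j') * F (s(j := i, j' := i'))))" (is "_ = ?a + ?b")
      if j: "j < n" for j
    proof -
      have "(\<Sum>i<M. B i (s j) * hop M n C F (s(j := i)))
         = (\<Sum>i<M. \<Sum>j'<n. \<Sum>i'<M. B i (s j) * (C i' ((s(j := i)) j') * F (s(j := i, j' := i'))))"
        by (simp add: hop_def sum_distrib_left)
      also have "\<dots> = (\<Sum>j'<n. \<Sum>i<M. \<Sum>i'<M. B i (s j) * (C i' ((s(j := i)) j') * F (s(j := i, j' := i'))))"
        by (rule sum.swap)
      also have "\<dots> = (\<Sum>j'<n. (if j' = j then \<Sum>i<M. \<Sum>i'<M. B i (s j) * (C i' i * F (s(j := i'))) else 0)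
          + (if j = j' then 0 else
              \<Sum>i<M. \<Sum>i'<M. B i (s j) * (C i' (s j') * F (s(j := i, j' := i')))))"
        by (intro sum.cong refl) auto
      also have "\<dots> = (\<Sum>i<M. \<Sum>i'<M. B i (s j) * (C i' i * F (s(j := i')))) + ?b"
        using j by (simp add: sum.distrib)
      also have "(\<Sum>i<M. \<Sum>i'<M. B i (s j) * (C i' i * F (s(j := i')))) = ?a"
        by (subst sum.swap) (simp add: mat_prod_def sum_distrib_left sum_distrib_right mult_ac)
      finally show ?thesis .
    qed
    have "hop M n B (hop M n C F) s = (\<Sum>j<n. \<Sum>i<M. B i (s j) * hop M n C F (s(j := i)))"
      by (simp add: hop_def[of M n B])
    also have "\<dots> = hop M n (mat_prod M C B) F s + R B C"
      unfolding R_def hop_def[of M n "mat_prod M C B"] sum.distrib[symmetric]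
      by (intro sum.cong refl inner) auto
    finally show ?thesis .
  qed
  have "R B C = R C B"
  proof -
    have "R B C = (\<Sum>j'<n. \<Sum>j<n. if j = j' then 0 else
      \<Sum>i'<M. \<Sum>i<M. B i (s j) * (C i' (s j') * F (s(j := i, j' := i'))))"
      unfolding R_def by (subst sum.swap, intro sum.cong refl if_cong sum.swap)
    also have "\<dots> = R C B"
      unfolding R_def by (intro sum.cong refl) (auto simp: fun_upd_twist mult_ac)
    finally show ?thesis .
  qed
  then show ?thesis
    unfolding exp by (simp add: hop_def sum_subtractf left_diff_distrib)
qed

text \<open>
  The Pauli principle: below an occupied level of the filled tuple there is no free level.
\<close>

lemma hop_lowering_id:
  assumes "alternating n F" "\<And>i j. j \<le> i \<Longrightarrow> B i j = 0"
  shows "hop M n B F id = 0"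
proof -
  have "B i (id j) * F (id(j := i)) = 0" if "j < n" for i j
  proof (cases "i < j")
    case True
    then have "F (id(j := i)) = 0"
      using that by (intro alternating_dup[OF assms(1), of i j]) auto
    then show ?thesis by simp
  qed (use assms(2) in auto)
  then show ?thesis unfolding hop_def by (intro sum.neutral ballI) auto
qed

text \<open>
  A raised entry leaves behind a hole among the levels below \<open>n\<close>, which the vacuum does not see; so only
  the diagonal of a raising matrix acts, and it acts by the number \<open>vacuum_trace\<close>. On tuples with a
  repeated entry both sides vanish by antisymmetry.
\<close>

lemma hop_centered_raising_vacuum:
  assumes v: "vacuum n \<epsilon>" and B: "\<And>i j. i < j \<Longrightarrow> B i j = 0" and n: "n \<le> M"
  shows "hop_centered M n B \<epsilon> s = 0"
proof -
  have alt: "alternating n \<epsilon>" and hi: "\<And>s j. j < n \<Longrightarrow> n \<le> s j \<Longrightarrow> \<epsilon> s = 0"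
    using v by (auto simp: vacuum_def)
  show ?thesis
  proof (cases "inj_on s {..<n}")
    case False
    then obtain i j where "i < n" "j < n" "i \<noteq> j" "s i = s j"
      by (auto simp: inj_on_def)
    then show ?thesis
      by (intro alternating_dup[OF alternating_hop_centered[OF alt]])
  next
    case inj: True
    show ?thesis
    proof (cases "\<exists>j<n. n \<le> s j")
      case True
      then obtain j0 where j0: "j0 < n" "n \<le> s j0" by auto
      have "B i (s j) * \<epsilon> (s(j := i)) = 0" if "j < n" for i j
      proof (cases "j = j0")
        case True
        show ?thesis
        proof (cases "i < s j")
          case False
          then have "\<epsilon> (s(j := i)) = 0" using j0 True by (intro hi[of j]) auto
          then show ?thesis by simp
        qed (use B in auto)
      next
        case False
        then have "\<epsilon> (s(j := i)) = 0" using j0 by (intro hi[of j0]) auto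
        then show ?thesis by simp
      qed
      then have "hop M n B \<epsilon> s = 0" unfolding hop_def by (intro sum.neutral ballI) auto
      then show ?thesis using hi[of j0 s] j0 by (simp add: hop_centered_def)
    next
      case False
      then have sn: "s ` {..<n} \<subseteq> {..<n}" by (auto simp: not_le)
      have surj: "s ` {..<n} = {..<n}"
        by (rule card_subset_eq) (use sn inj in \<open>auto simp: card_image\<close>)
      have "B i (s j) * \<epsilon> (s(j := i)) = (if i = s j then B (s j) (s j) * \<epsilon> s else 0)" if j: "j < n" for i j
      proof (cases "s j < i")
        case True
        have "\<epsilon> (s(j := i)) = 0"
        proof (cases "i < n")
          case False then show ?thesis using j by (intro hi[of j]) auto
        next
          case in': True
          then obtain l where l: "l < n" "s l = i" using surj by (metis imageE lessThan_iff)
          have "l \<noteq> j" using l True by auto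
          then show ?thesis using l j
            by (intro alternating_dup[OF alt, of l j]) auto
        qed
        then show ?thesis using True by simp
      next
        case False
        then show ?thesis using B[of i "s j"] by (cases "i = s j") auto
      qed
      then have "hop M n B \<epsilon> s = (\<Sum>j<n. \<Sum>i<M. if i = s j then B (s j) (s j) * \<epsilon> s else 0)"
        by (simp add: hop_def)
      also have "\<dots> = (\<Sum>j<n. B (s j) (s j) * \<epsilon> s)"
        using sn n by (intro sum.cong refl) (auto simp: sum.delta)
      also have "\<dots> = (\<Sum>j<n. B j j * \<epsilon> s)"
        using sum.reindex_bij_betw[of s "{..<n}" "{..<n}" "\<lambda>j. B j j * \<epsilon> s"] inj surj
        by (simp add: bij_betw_def)
      finally show ?thesis by (simp add: hop_centered_def vacuum_trace_def sum_distrib_right)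
    qed
  qed
qed

lemma hop_add: "hop M n (\<lambda>i j. B i j + C i j) F s = hop M n B F s + hop M n C F s"
  by (simp add: hop_def distrib_right sum.distrib)

lemma hop_linear:
  "hop M n B (\<lambda>s. x * F s + y * G s) s = x * hop M n B F s + y * hop M n B G s"
  by (simp add: hop_def distrib_left sum.distrib sum_distrib_left mult_ac)

lemma hop_centered_linear:
  "hop_centered M n B (\<lambda>s. x * F s + y * G s) s = x * hop_centered M n B F s + y * hop_centered M n B G s"
  by (simp add: hop_centered_def hop_linear algebra_simps)


lemma hop_centered_sum:
  "hop_centered M n B (\<lambda>s. \<Sum>i\<in>I. F i s) s = (\<Sum>i\<in>I. hop_centered M n B (F i) s)"
proof -
  have "hop M n B (\<lambda>s. \<Sum>i\<in>I. F i s) s = (\<Sum>j<n. \<Sum>i\<in>I. \<Sum>v<M. B v (s j) * F i (s(j := v)))"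
    unfolding hop_def sum_distrib_left by (intro sum.cong refl sum.swap)
  also have "\<dots> = (\<Sum>i\<in>I. hop M n B (F i) s)"
    unfolding hop_def by (rule sum.swap)
  finally show ?thesis
    by (simp add: hop_centered_def sum_subtractf sum_distrib_left)
qed

text \<open>
  Tuples that agree with the filled one at distance more than \<open>R\<close> below the Fermi level \<open>n\<close>, and whose
  other entries lie within distance \<open>R\<close> of it. The inequalities avoid truncated subtraction.
\<close>

definition window :: "nat \<Rightarrow> nat \<Rightarrow> (nat \<Rightarrow> nat) set" where
  "window n R = {s. \<forall>j<n. (j + R < n \<longrightarrow> s j = j) \<and> (n \<le> j + R \<longrightarrow> n \<le> s j + R \<and> s j < n + R)}"

definition banded :: "nat \<Rightarrow> (nat \<Rightarrow> nat \<Rightarrow> real) \<Rightarrow> bool" where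
  "banded d B \<longleftrightarrow> (\<forall>i j. B i j \<noteq> 0 \<longrightarrow> i \<le> j + d \<and> j \<le> i + d)"

lemma id_in_window: "0 < R \<Longrightarrow> id \<in> window n R"
  by (auto simp: window_def)

lemma window_mono: "R \<le> R' \<Longrightarrow> window n R \<subseteq> window n R'"
  by (fastforce simp: window_def not_less not_le)

text \<open>
  Locality: deep below the Fermi level every target within the band is already occupied, so only the
  diagonal of \<open>B\<close> acts there, and centring removes it. What is left involves boundedly many entries of
  \<open>B\<close>, all near the Fermi level.
\<close>

lemma hop_centered_window_bound:
  assumes alt: "alternating n F" and band: "banded d B" and n: "R + d \<le> n" "n \<le> M"
    and s: "s \<in> window n R"
    and W: "W = R + 2 * d"
    and B: "\<And>i j. n \<le> i + W \<Longrightarrow> i < n + W \<Longrightarrow> n \<le> j + W \<Longrightarrow> j < n + W \<Longrightarrow> \<bar>B i j\<bar> \<le> \<beta>"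
    and F: "\<And>s. s \<in> window n W \<Longrightarrow> \<bar>F s\<bar> \<le> K" and K: "0 \<le> K" and \<beta>: "0 \<le> \<beta>"
  shows "\<bar>hop_centered M n B F s\<bar> \<le> real ((R + d) * (2 * W + 1)) * (\<beta> * K)"
proof -
  define h where "h j = (\<Sum>i<M. B i (s j) * F (s(j := i))) - B j j * F s" for j
  let ?J = "{n - (R + d)..<n}" and ?I = "{n - W..<n + W}"
  have hop_centered: "hop_centered M n B F s = (\<Sum>j<n. h j)"
    by (simp add: hop_centered_def hop_def vacuum_trace_def h_def sum_subtractf sum_distrib_right)
  have far: "h j = 0" if j: "j + R + d < n" for j
  proof -
    have sj: "s j = j" using s j by (auto simp: window_def)
    have "B i (s j) * F (s(j := i)) = (if i = j then B j j * F s else 0)" for i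
    proof (cases "i = j \<or> B i j = 0")
      case False
      then have "i + R < n" using band j by (force simp: banded_def)
      then have "s i = i" using s by (auto simp: window_def)
      then have "F (s(j := i)) = 0"
        using False j \<open>i + R < n\<close> by (intro alternating_dup[OF alt, of i j]) auto
      then show ?thesis using False by simp
    qed (use sj fun_upd_triv[of s j] in auto)
    then show ?thesis using j n by (simp add: h_def)
  qed
  have near: "\<bar>h j\<bar> \<le> real (2 * W + 1) * (\<beta> * K)" if j: "j < n" "n \<le> j + R + d" for j
  proof -
    have sj: "n \<le> s j + R + d" "s j < n + R"
      using s j unfolding window_def by (cases "j + R < n"; auto)+
    have tm: "\<bar>B i (s j) * F (s(j := i))\<bar> \<le> (if i \<in> ?I then \<beta> * K else 0)" for i
    proof (cases "B i (s j) = 0")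
      case False
      then have i: "n \<le> i + W" "i < n + R + d"
        using band sj W by (force simp: banded_def)+
      have "s(j := i) \<in> window n W"
        using s i W j unfolding window_def by auto
      then have "\<bar>F (s(j := i))\<bar> \<le> K" by (rule F)
      moreover have "\<bar>B i (s j)\<bar> \<le> \<beta>" using i sj W by (intro B) auto
      ultimately show ?thesis using i W \<beta> by (auto simp: abs_mult intro!: mult_mono)
    qed (use K \<beta> in auto)
    have "\<bar>\<Sum>i<M. B i (s j) * F (s(j := i))\<bar> \<le> (\<Sum>i<M. if i \<in> ?I then \<beta> * K else 0)"
      by (intro order.trans[OF sum_abs] sum_mono tm)
    also have "\<dots> = (\<Sum>i\<in>{..<M} \<inter> ?I. \<beta> * K)" by (rule sum.inter_restrict[symmetric]) simp
    also have "\<dots> \<le> (\<Sum>i\<in>?I. \<beta> * K)" using K \<beta> by (intro sum_mono2) auto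
    also have "\<dots> \<le> real (2 * W) * (\<beta> * K)"
      using K \<beta> by (auto intro!: mult_right_mono)
    finally have 1: "\<bar>\<Sum>i<M. B i (s j) * F (s(j := i))\<bar> \<le> real (2 * W) * (\<beta> * K)" .
    have "s \<in> window n W" using window_mono[of R W n] s W by auto
    then have "\<bar>F s\<bar> \<le> K" by (rule F)
    moreover have "\<bar>B j j\<bar> \<le> \<beta>" using j W by (intro B) auto
    ultimately have 2: "\<bar>B j j * F s\<bar> \<le> \<beta> * K" using \<beta> by (auto simp: abs_mult intro!: mult_mono)
    show ?thesis using 1 2 unfolding h_def by (simp add: algebra_simps)
  qed
  have "hop_centered M n B F s = (\<Sum>j\<in>?J. h j)"
    unfolding hop_centered by (rule sum.mono_neutral_right) (auto intro!: far)
  also have "\<bar>\<dots>\<bar> \<le> (\<Sum>j\<in>?J. real (2 * W + 1) * (\<beta> * K))"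
    using n by (intro order.trans[OF sum_abs] sum_mono near) auto
  also have "\<dots> \<le> real (R + d) * (real (2 * W + 1) * (\<beta> * K))"
    using n by simp
  finally show ?thesis by (simp only: of_nat_mult mult.assoc)
qed

text \<open>
  Convergence of the matrix entries at fixed offsets from the Fermi level \<open>n\<close>.
\<close>

definition window_lim :: "(nat \<Rightarrow> nat \<Rightarrow> nat \<Rightarrow> real) \<Rightarrow> (int \<Rightarrow> int \<Rightarrow> real) \<Rightarrow> bool" where
  "window_lim B L \<longleftrightarrow> (\<forall>i j. (\<lambda>n. B n (nat (int n + i)) (nat (int n + j))) \<longlonglongrightarrow> L i j)"

definition locally_bounded :: "(nat \<Rightarrow> (nat \<Rightarrow> nat) \<Rightarrow> real) \<Rightarrow> bool" where
  "locally_bounded F \<longleftrightarrow> (\<forall>R. \<exists>K\<ge>0. \<forall>\<^sub>F n in sequentially. \<forall>s\<in>window n R. \<bar>F n s\<bar> \<le> K)"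

definition locally_null :: "(nat \<Rightarrow> (nat \<Rightarrow> nat) \<Rightarrow> real) \<Rightarrow> bool" where
  "locally_null F \<longleftrightarrow> (\<forall>R. \<forall>e>0. \<forall>\<^sub>F n in sequentially. \<forall>s\<in>window n R. \<bar>F n s\<bar> \<le> e)"

lemma window_lim_eventually_le:
  assumes "window_lim B L" and "\<And>i j. \<bar>L i j\<bar> < \<beta> i j"
  shows "\<forall>\<^sub>F n in sequentially. \<forall>i j. n \<le> i + W \<longrightarrow> i < n + W \<longrightarrow> n \<le> j + W \<longrightarrow> j < n + W
     \<longrightarrow> \<bar>B n i j\<bar> \<le> \<beta> (int i - int n) (int j - int n)"
proof -
  let ?S = "{- int W..<int W}"
  have "\<forall>\<^sub>F n in sequentially. \<forall>i\<in>?S. \<forall>j\<in>?S. \<bar>B n (nat (int n + i)) (nat (int n + j))\<bar> < \<beta> i j"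
    using assms unfolding window_lim_def
    by (intro eventually_ball_finite ballI order_tendstoD(2)[OF tendsto_rabs]) auto
  then show ?thesis
  proof eventually_elim
    case (elim n)
    show ?case
    proof (intro allI impI)
      fix i j assume "n \<le> i + W" "i < n + W" "n \<le> j + W" "j < n + W"
      then have "int i - int n \<in> ?S" "int j - int n \<in> ?S" by auto
      from elim[rule_format, OF this] show "\<bar>B n i j\<bar> \<le> \<beta> (int i - int n) (int j - int n)" by simp
    qed
  qed
qed

lemma window_lim_eventually_bounded:
  assumes "window_lim B L"
  obtains \<beta> where "0 \<le> \<beta>"
    "\<forall>\<^sub>F n in sequentially. \<forall>i j. n \<le> i + W \<longrightarrow> i < n + W \<longrightarrow> n \<le> j + W \<longrightarrow> j < n + W \<longrightarrow> \<bar>B n i j\<bar> \<le> \<beta>"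
proof
  let ?S = "{- int W..<int W}"
  define \<beta> where "\<beta> = (\<Sum>p\<in>?S \<times> ?S. \<bar>L (fst p) (snd p)\<bar> + 1)"
  show "0 \<le> \<beta>" by (auto simp: \<beta>_def intro: sum_nonneg)
  have le: "\<bar>L i j\<bar> + 1 \<le> \<beta>" if "i \<in> ?S" "j \<in> ?S" for i j
    using member_le_sum[of "(i, j)" "?S \<times> ?S" "\<lambda>p. \<bar>L (fst p) (snd p)\<bar> + 1"] that
    by (auto simp: \<beta>_def)
  have lt: "\<bar>L i j\<bar> < \<bar>L i j\<bar> + 1" for i j by simp
  show "\<forall>\<^sub>F n in sequentially. \<forall>i j. n \<le> i + W \<longrightarrow> i < n + W \<longrightarrow> n \<le> j + W \<longrightarrow> j < n + W \<longrightarrow> \<bar>B n i j\<bar> \<le> \<beta>"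
    using window_lim_eventually_le[OF assms lt, of W]
  proof eventually_elim
    case (elim n)
    show ?case
    proof (intro allI impI)
      fix i j assume a: "n \<le> i + W" "i < n + W" "n \<le> j + W" "j < n + W"
      then have "int i - int n \<in> ?S" "int j - int n \<in> ?S" by auto
      from le[OF this] elim a show "\<bar>B n i j\<bar> \<le> \<beta>" by force
    qed
  qed
qed

lemma window_lim_zero_eventually_small:
  assumes "window_lim B (\<lambda>_ _. 0)" "0 < e"
  shows "\<forall>\<^sub>F n in sequentially. \<forall>i j. n \<le> i + W \<longrightarrow> i < n + W \<longrightarrow> n \<le> j + W \<longrightarrow> j < n + W \<longrightarrow> \<bar>B n i j\<bar> \<le> e"
  using window_lim_eventually_le[OF assms(1), of "\<lambda>_ _. e" W] assms(2) by auto

lemma hop_centered_locally_bounded: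
  assumes alt: "\<And>n. alternating n (F n)" and band: "\<And>n. banded d (B n)" and M: "\<And>n. n \<le> M n"
    and B: "window_lim B L" and F: "locally_bounded F"
  shows "locally_bounded (\<lambda>n. hop_centered (M n) n (B n) (F n))"
  unfolding locally_bounded_def
proof
  fix R
  define W where "W = R + 2 * d"
  obtain \<beta> where \<beta>: "0 \<le> \<beta>" "\<forall>\<^sub>F n in sequentially. \<forall>i j. n \<le> i + W \<longrightarrow> i < n + W \<longrightarrow> n \<le> j + W \<longrightarrow> j < n + W \<longrightarrow> \<bar>B n i j\<bar> \<le> \<beta>"
    by (rule window_lim_eventually_bounded[OF B, of W])
  obtain K where K: "0 \<le> K" "\<forall>\<^sub>F n in sequentially. \<forall>s\<in>window n W. \<bar>F n s\<bar> \<le> K"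
    using F unfolding locally_bounded_def by blast
  have "\<forall>\<^sub>F n in sequentially. \<forall>s\<in>window n R. \<bar>hop_centered (M n) n (B n) (F n) s\<bar> \<le> real ((R + d) * (2 * W + 1)) * (\<beta> * K)"
    using \<beta>(2) K(2) eventually_ge_at_top[of "R + d"]
  proof eventually_elim
    case (elim n)
    have "\<bar>hop_centered (M n) n (B n) (F n) s\<bar> \<le> real ((R + d) * (2 * W + 1)) * (\<beta> * K)" if s: "s \<in> window n R" for s
    proof (rule hop_centered_window_bound[OF alt band elim(3) M s W_def])
      show "\<bar>B n i j\<bar> \<le> \<beta>" if "n \<le> i + W" "i < n + W" "n \<le> j + W" "j < n + W" for i j
        using elim(1) that by blast
      show "\<bar>F n s\<bar> \<le> K" if "s \<in> window n W" for s
        using elim(2) that by blast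
    qed (use K(1) \<beta>(1) in auto)
    then show ?case by blast
  qed
  then show "\<exists>K\<ge>0. \<forall>\<^sub>F n in sequentially. \<forall>s\<in>window n R. \<bar>hop_centered (M n) n (B n) (F n) s\<bar> \<le> K"
    using \<beta> K by (intro exI[of _ "real ((R + d) * (2 * W + 1)) * (\<beta> * K)"]) auto
qed

text \<open>
  Serves to make the bound of \<open>hop_centered_window_bound\<close> smaller than a given number.
\<close>

lemma small_factor:
  fixes c K e :: real assumes "0 \<le> c" "0 \<le> K" "0 < e"
  obtains \<delta> where "0 < \<delta>" "c * (\<delta> * K) \<le> e"
proof
  show "0 < e / (c * K + 1)" using assms by (auto intro!: divide_pos_pos add_nonneg_pos)
  have "c * (e / (c * K + 1) * K) = e * (c * K / (c * K + 1))" by simp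
  also have "\<dots> \<le> e * 1"
    using assms by (intro mult_left_mono) (auto simp: divide_le_eq_1 add_nonneg_pos)
  finally show "c * (e / (c * K + 1) * K) \<le> e" by simp
qed

lemma hop_centered_locally_null_if_locally_null:
  assumes alt: "\<And>n. alternating n (F n)" and band: "\<And>n. banded d (B n)" and M: "\<And>n. n \<le> M n"
    and B: "window_lim B L" and F: "locally_null F"
  shows "locally_null (\<lambda>n. hop_centered (M n) n (B n) (F n))"
  unfolding locally_null_def
proof (intro allI impI)
  fix R and e :: real assume e: "0 < e"
  define W where "W = R + 2 * d"
  obtain \<beta> where \<beta>: "0 \<le> \<beta>" "\<forall>\<^sub>F n in sequentially. \<forall>i j. n \<le> i + W \<longrightarrow> i < n + W \<longrightarrow> n \<le> j + W \<longrightarrow> j < n + W \<longrightarrow> \<bar>B n i j\<bar> \<le> \<beta>"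
    by (rule window_lim_eventually_bounded[OF B, of W])
  obtain K where K: "0 < K" "real ((R + d) * (2 * W + 1)) * (K * \<beta>) \<le> e"
    using small_factor[OF _ \<beta>(1) e, of "real ((R + d) * (2 * W + 1))"] by auto
  have "\<forall>\<^sub>F n in sequentially. \<forall>s\<in>window n W. \<bar>F n s\<bar> \<le> K"
    using F K unfolding locally_null_def by blast
  then show "\<forall>\<^sub>F n in sequentially. \<forall>s\<in>window n R. \<bar>hop_centered (M n) n (B n) (F n) s\<bar> \<le> e"
    using \<beta>(2) eventually_ge_at_top[of "R + d"]
  proof eventually_elim
    case (elim n)
    have "\<bar>hop_centered (M n) n (B n) (F n) s\<bar> \<le> real ((R + d) * (2 * W + 1)) * (\<beta> * K)" if s: "s \<in> window n R" for s
    proof (rule hop_centered_window_bound[OF alt band elim(3) M s W_def])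
      show "\<bar>B n i j\<bar> \<le> \<beta>" if "n \<le> i + W" "i < n + W" "n \<le> j + W" "j < n + W" for i j
        using elim(2) that by blast
      show "\<bar>F n s\<bar> \<le> K" if "s \<in> window n W" for s
        using elim(1) that by blast
    qed (use K(1) \<beta>(1) in auto)
    then show ?case using K(2) by (fastforce simp: mult.commute[of K])
  qed
qed

lemma hop_centered_locally_null_if_window_lim_zero:
  assumes alt: "\<And>n. alternating n (F n)" and band: "\<And>n. banded d (B n)" and M: "\<And>n. n \<le> M n"
    and B: "window_lim B (\<lambda>_ _. 0)" and F: "locally_bounded F"
  shows "locally_null (\<lambda>n. hop_centered (M n) n (B n) (F n))"
  unfolding locally_null_def
proof (intro allI impI)
  fix R and e :: real assume e: "0 < e"
  define W where "W = R + 2 * d"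
  obtain K where K: "0 \<le> K" "\<forall>\<^sub>F n in sequentially. \<forall>s\<in>window n W. \<bar>F n s\<bar> \<le> K"
    using F unfolding locally_bounded_def by blast
  obtain \<beta> where \<beta>: "0 < \<beta>" "real ((R + d) * (2 * W + 1)) * (\<beta> * K) \<le> e"
    using small_factor[OF _ K(1) e, of "real ((R + d) * (2 * W + 1))"] by auto
  show "\<forall>\<^sub>F n in sequentially. \<forall>s\<in>window n R. \<bar>hop_centered (M n) n (B n) (F n) s\<bar> \<le> e"
    using K(2) window_lim_zero_eventually_small[OF B \<beta>(1), of W] eventually_ge_at_top[of "R + d"]
  proof eventually_elim
    case (elim n)
    have "\<bar>hop_centered (M n) n (B n) (F n) s\<bar> \<le> real ((R + d) * (2 * W + 1)) * (\<beta> * K)" if s: "s \<in> window n R" for s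
    proof (rule hop_centered_window_bound[OF alt band elim(3) M s W_def])
      show "\<bar>B n i j\<bar> \<le> \<beta>" if "n \<le> i + W" "i < n + W" "n \<le> j + W" "j < n + W" for i j
        using elim(2) that by blast
      show "\<bar>F n s\<bar> \<le> K" if "s \<in> window n W" for s
        using elim(1) that by blast
    qed (use K(1) \<beta>(1) in auto)
    then show ?case using \<beta>(2) by fastforce
  qed
qed

section \<open>Gaussian moments at the Fermi level\<close>

definition lowering :: "(nat \<Rightarrow> nat \<Rightarrow> real) \<Rightarrow> nat \<Rightarrow> nat \<Rightarrow> real" where
  "lowering A i j = (if i < j then A i j else 0)"

definition lower_comm :: "nat \<Rightarrow> (nat \<Rightarrow> nat \<Rightarrow> real) \<Rightarrow> nat \<Rightarrow> nat \<Rightarrow> real" where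
  "lower_comm M A i j = mat_prod M (lowering A) A i j - mat_prod M A (lowering A) i j"

text \<open>
  Raising and diagonal parts act on the vacuum by the trace that the centring subtracts.
\<close>

lemma hop_centered_vacuum:
  assumes "vacuum n \<epsilon>" "n \<le> M"
  shows "hop_centered M n A \<epsilon> = hop M n (lowering A) \<epsilon>"
proof
  fix s
  define U where "U i j = (if i < j then 0 else A i j)" for i j
  have A: "A = (\<lambda>i j. lowering A i j + U i j)"
    by (auto simp: fun_eq_iff lowering_def U_def)
  have "hop M n A \<epsilon> s = hop M n (lowering A) \<epsilon> s + hop M n U \<epsilon> s"
    by (subst A) (rule hop_add)
  moreover have "vacuum_trace n U = vacuum_trace n A" by (simp add: vacuum_trace_def U_def)
  moreover have "hop_centered M n U \<epsilon> s = 0"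
    by (rule hop_centered_raising_vacuum[OF assms(1) _ assms(2)]) (auto simp: U_def)
  ultimately show "hop_centered M n A \<epsilon> s = hop M n (lowering A) \<epsilon> s"
    by (simp add: hop_centered_def)
qed

lemma hop_centered_hop_lowering:
  "hop_centered M n A (hop M n (lowering A) G) s = hop M n (lowering A) (hop_centered M n A G) s + hop M n (lower_comm M A) G s"
proof -
  have "hop M n (lowering A) (hop_centered M n A G) s
      = hop M n (lowering A) (hop M n A G) s - vacuum_trace n A * hop M n (lowering A) G s"
    using hop_linear[of M n "lowering A" 1 "hop M n A G" "- vacuum_trace n A" G s] by (simp add: hop_centered_def[abs_def])
  then show ?thesis
    using hop_commutator[of M n A "lowering A" G s] by (simp add: hop_centered_def lower_comm_def[abs_def])
qed

lemma alternating_hop_centered_pow: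
  "alternating n F \<Longrightarrow> alternating n ((hop_centered M n A ^^ m) F)"
  by (induction m) (auto intro: alternating_hop_centered)

lemma hop_centered_pow_linear:
  "(hop_centered M n A ^^ m) (\<lambda>s. x * F s + y * G s) s = x * (hop_centered M n A ^^ m) F s + y * (hop_centered M n A ^^ m) G s"
proof (induction m arbitrary: s)
  case (Suc m)
  then have "(hop_centered M n A ^^ m) (\<lambda>s. x * F s + y * G s) = (\<lambda>s. x * (hop_centered M n A ^^ m) F s + y * (hop_centered M n A ^^ m) G s)"
    by auto
  then show ?case by (simp add: hop_centered_linear)
qed simp

lemma hop_centered_pow_hop_lowering:
  "(hop_centered M n A ^^ m) (hop M n (lowering A) G) s
     = hop M n (lowering A) ((hop_centered M n A ^^ m) G) s
       + (\<Sum>i<m. (hop_centered M n A ^^ i) (hop M n (lower_comm M A) ((hop_centered M n A ^^ (m - 1 - i)) G)) s)"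
proof (induction m arbitrary: s)
  case (Suc m)
  let ?T = "hop_centered M n A" and ?C = "hop M n (lower_comm M A)"
  define S where "S i s = (?T ^^ i) (?C ((?T ^^ (m - 1 - i)) G)) s" for i s
  have "(?T ^^ m) (hop M n (lowering A) G) = (\<lambda>s. hop M n (lowering A) ((?T ^^ m) G) s + (\<Sum>i<m. S i s))"
    using Suc by (auto simp: S_def)
  then have "(?T ^^ Suc m) (hop M n (lowering A) G) s
      = ?T (\<lambda>s. hop M n (lowering A) ((?T ^^ m) G) s + (\<Sum>i<m. S i s)) s"
    by simp
  also have "\<dots> = ?T (hop M n (lowering A) ((?T ^^ m) G)) s + (\<Sum>i<m. ?T (S i) s)"
    using hop_centered_linear[of M n A 1 "hop M n (lowering A) ((?T ^^ m) G)" 1 "\<lambda>s. \<Sum>i<m. S i s" s]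
    by (simp add: hop_centered_sum)
  also have "?T (hop M n (lowering A) ((?T ^^ m) G)) s
      = hop M n (lowering A) ((?T ^^ Suc m) G) s + ?C ((?T ^^ m) G) s"
    by (simp add: hop_centered_hop_lowering)
  also have "(\<Sum>i<m. ?T (S i) s) = (\<Sum>i<m. (?T ^^ Suc i) (?C ((?T ^^ (Suc m - 1 - Suc i)) G)) s)"
    by (simp add: S_def[abs_def])
  finally show ?case
    by (simp add: sum.lessThan_Suc_shift del: sum.lessThan_Suc)
qed simp

text \<open>
  The innermost factor of the power acts on the vacuum through its lowering part, which is then commuted
  to the outside, where it vanishes at the filled tuple. Each of the \<open>m\<close> commutators is a scalar, its
  vacuum trace, plus a centred remainder.
\<close>

lemma moment_recursion:
  fixes A :: "nat \<Rightarrow> nat \<Rightarrow> real"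
  assumes v: "vacuum n \<epsilon>" and n: "n \<le> M"
  defines "T \<equiv> hop_centered M n A"
  shows "(T ^^ Suc m) \<epsilon> id = real m * vacuum_trace n (lower_comm M A) * (T ^^ (m - 1)) \<epsilon> id
     + (\<Sum>i<m. (T ^^ i) (hop_centered M n (lower_comm M A) ((T ^^ (m - 1 - i)) \<epsilon>)) id)"
proof -
  have alt: "alternating n \<epsilon>" using v by (simp add: vacuum_def)
  let ?\<tau> = "vacuum_trace n (lower_comm M A)"
  have "(T ^^ Suc m) \<epsilon> id = (T ^^ m) (T \<epsilon>) id"
    by (simp add: funpow_swap1)
  also have "T \<epsilon> = hop M n (lowering A) \<epsilon>"
    unfolding T_def by (rule hop_centered_vacuum[OF v n])
  also have "(T ^^ m) \<dots> id = hop M n (lowering A) ((T ^^ m) \<epsilon>) id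
      + (\<Sum>i<m. (T ^^ i) (hop M n (lower_comm M A) ((T ^^ (m - 1 - i)) \<epsilon>)) id)"
    unfolding T_def by (rule hop_centered_pow_hop_lowering)
  also have "hop M n (lowering A) ((T ^^ m) \<epsilon>) id = 0"
    unfolding T_def by (rule hop_lowering_id[OF alternating_hop_centered_pow[OF alt]]) (auto simp: lowering_def)
  also have "(\<Sum>i<m. (T ^^ i) (hop M n (lower_comm M A) ((T ^^ (m - 1 - i)) \<epsilon>)) id)
     = (\<Sum>i<m. ?\<tau> * (T ^^ (m - 1)) \<epsilon> id + (T ^^ i) (hop_centered M n (lower_comm M A) ((T ^^ (m - 1 - i)) \<epsilon>)) id)"
  proof (intro sum.cong refl)
    fix i assume i: "i \<in> {..<m}"
    let ?H = "(T ^^ (m - 1 - i)) \<epsilon>"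
    have "hop M n (lower_comm M A) ?H = (\<lambda>s. ?\<tau> * ?H s + 1 * hop_centered M n (lower_comm M A) ?H s)"
      by (auto simp: hop_centered_def)
    then have "(T ^^ i) (hop M n (lower_comm M A) ?H) id
        = ?\<tau> * (T ^^ i) ?H id + 1 * (T ^^ i) (hop_centered M n (lower_comm M A) ?H) id"
      unfolding T_def by (simp only: hop_centered_pow_linear)
    moreover have "(T ^^ i) ?H = (T ^^ (m - 1)) \<epsilon>"
    proof -
      have "(T ^^ i) ?H = (T ^^ (i + (m - 1 - i))) \<epsilon>" by (simp only: funpow_add o_apply)
      also have "i + (m - 1 - i) = m - 1" using i by auto
      finally show ?thesis .
    qed
    ultimately show "(T ^^ i) (hop M n (lower_comm M A) ?H) id
        = ?\<tau> * (T ^^ (m - 1)) \<epsilon> id + (T ^^ i) (hop_centered M n (lower_comm M A) ?H) id" by simp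
  qed
  also have "\<dots> = real m * ?\<tau> * (T ^^ (m - 1)) \<epsilon> id + (\<Sum>i<m. (T ^^ i) (hop_centered M n (lower_comm M A) ((T ^^ (m - 1 - i)) \<epsilon>)) id)"
    by (simp add: sum.distrib)
  finally show ?thesis by (simp only: add_0_left)
qed

lemma hop_centered_vacuum_id:
  assumes "vacuum n \<epsilon>" "n \<le> M"
  shows "hop_centered M n A \<epsilon> id = 0"
  unfolding hop_centered_vacuum[OF assms]
  using assms by (intro hop_lowering_id) (auto simp: lowering_def vacuum_def)

text \<open>
  Inside the block of filled levels the two orders of multiplication have the same trace; only paths
  that leave the block contribute.
\<close>

lemma vacuum_trace_lower_comm:
  assumes "n \<le> M"
  shows "vacuum_trace n (lower_comm M A) = (\<Sum>j<n. \<Sum>i\<in>{n..<M}. A j i * A i j)"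
proof -
  let ?g = "\<lambda>j i. lowering A j i * A i j - A j i * lowering A i j"
  have split: "{..<M} = {..<n} \<union> {n..<M}" using assms by auto
  have "vacuum_trace n (lower_comm M A) = (\<Sum>j<n. \<Sum>i<M. ?g j i)"
    by (simp add: vacuum_trace_def lower_comm_def mat_prod_def sum_subtractf)
  also have "\<dots> = (\<Sum>j<n. \<Sum>i<n. ?g j i) + (\<Sum>j<n. \<Sum>i\<in>{n..<M}. ?g j i)"
    unfolding split by (subst sum.union_disjoint) (auto simp: sum.distrib)
  also have "(\<Sum>j<n. \<Sum>i<n. ?g j i) = (\<Sum>j<n. \<Sum>i<n. lowering A j i * A i j) - (\<Sum>j<n. \<Sum>i<n. A j i * lowering A i j)"
    by (simp add: sum_subtractf)
  also have "(\<Sum>j<n. \<Sum>i<n. A j i * lowering A i j) = (\<Sum>j<n. \<Sum>i<n. lowering A j i * A i j)"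
    by (subst sum.swap) (simp add: mult.commute)
  also have "(\<Sum>j<n. \<Sum>i\<in>{n..<M}. ?g j i) = (\<Sum>j<n. \<Sum>i\<in>{n..<M}. A j i * A i j)"
    by (intro sum.cong refl) (auto simp: lowering_def)
  finally show ?thesis by simp
qed

text \<open>
  A commutator contributes to the value of the vacuum at the filled tuple by its trace alone, so that the
  recursion has no remainder here.
\<close>

lemma second_moment:
  assumes v: "vacuum n \<epsilon>" and n: "n \<le> M"
  shows "(hop_centered M n A ^^ 2) \<epsilon> id = (\<Sum>j<n. \<Sum>i\<in>{n..<M}. A j i * A i j)"
proof -
  have "(hop_centered M n A ^^ Suc 1) \<epsilon> id = vacuum_trace n (lower_comm M A)"
    unfolding moment_recursion[OF v n]
    using v by (simp add: hop_centered_vacuum_id[OF v n] vacuum_def)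
  then show ?thesis by (simp add: vacuum_trace_lower_comm[OF n] numeral_2_eq_2)
qed

lemma banded_lowering: "banded d A \<Longrightarrow> banded d (lowering A)"
  by (auto simp: banded_def lowering_def)

lemma banded_mat_prod: "banded d A \<Longrightarrow> banded d' B \<Longrightarrow> banded (d + d') (mat_prod M A B)"
  unfolding banded_def mat_prod_def
proof (intro allI impI)
  fix i j assume A: "\<forall>i j. A i j \<noteq> 0 \<longrightarrow> i \<le> j + d \<and> j \<le> i + d"
    and B: "\<forall>i j. B i j \<noteq> 0 \<longrightarrow> i \<le> j + d' \<and> j \<le> i + d'"
    and "(\<Sum>l<M. A i l * B l j) \<noteq> 0"
  then obtain l where "A i l * B l j \<noteq> 0" by (meson sum.neutral)
  then have "i \<le> l + d \<and> l \<le> i + d" "l \<le> j + d' \<and> j \<le> l + d'" using A B by auto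
  then show "i \<le> j + (d + d') \<and> j \<le> i + (d + d')" by auto
qed

lemma banded_diff: "banded d A \<Longrightarrow> banded d B \<Longrightarrow> banded d (\<lambda>i j. A i j - B i j)"
  by (auto simp: banded_def) (metis diff_0_right eq_iff_diff_eq_0)+

lemma banded_lower_comm: "banded d A \<Longrightarrow> banded (d + d) (lower_comm M A)"
  unfolding lower_comm_def[abs_def]
  by (intro banded_diff banded_mat_prod banded_lowering)

lemma window_lim_lowering:
  assumes "window_lim A L"
  shows "window_lim (\<lambda>n. lowering (A n)) (\<lambda>i j. if i < j then L i j else 0)"
  unfolding window_lim_def
proof (intro allI)
  fix i j :: int
  have "\<forall>\<^sub>F n in sequentially. (if i < j then A n (nat (int n + i)) (nat (int n + j)) else 0)
      = lowering (A n) (nat (int n + i)) (nat (int n + j))"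
    using eventually_ge_at_top[of "nat (\<bar>i\<bar> + \<bar>j\<bar>)"]
    by eventually_elim (auto simp: lowering_def)
  moreover have "(\<lambda>n. if i < j then A n (nat (int n + i)) (nat (int n + j)) else 0)
      \<longlonglongrightarrow> (if i < j then L i j else 0)"
    using assms by (auto simp: window_lim_def)
  ultimately show "(\<lambda>n. lowering (A n) (nat (int n + i)) (nat (int n + j))) \<longlonglongrightarrow> (if i < j then L i j else 0)"
    by (rule Lim_transform_eventually[rotated])
qed

lemma window_lim_diff: "window_lim A L \<Longrightarrow> window_lim B L' \<Longrightarrow> window_lim (\<lambda>n i j. A n i j - B n i j) (\<lambda>i j. L i j - L' i j)"
  by (auto simp: window_lim_def intro: tendsto_diff)

lemma window_lim_mat_prod:
  assumes A: "window_lim A L" and B: "window_lim B L'" and band: "\<And>n. banded d (A n)"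
    and M: "filterlim (\<lambda>n. M n - n) at_top sequentially"
  shows "window_lim (\<lambda>n. mat_prod (M n) (A n) (B n)) (\<lambda>i j. \<Sum>m\<in>{i - int d..i + int d}. L i m * L' m j)"
  unfolding window_lim_def
proof (intro allI)
  fix i j :: int
  let ?D = "{i - int d..i + int d}"
  have "\<forall>\<^sub>F n in sequentially. nat (\<bar>i\<bar> + int d + 1) \<le> M n - n"
    using M by (simp add: filterlim_at_top)
  then have "\<forall>\<^sub>F n in sequentially.
      (\<Sum>m\<in>?D. A n (nat (int n + i)) (nat (int n + m)) * B n (nat (int n + m)) (nat (int n + j)))
      = mat_prod (M n) (A n) (B n) (nat (int n + i)) (nat (int n + j))"
    using eventually_ge_at_top[of "nat (\<bar>i\<bar> + int d)"]
  proof eventually_elim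
    case (elim n)
    let ?h = "\<lambda>m. nat (int n + m)"
    have inj: "inj_on ?h ?D" using elim by (auto simp: inj_on_def)
    have sub: "?h ` ?D \<subseteq> {..<M n}" using elim by auto
    have zero: "A n (nat (int n + i)) l * B n l (nat (int n + j)) = 0" if "l \<notin> ?h ` ?D" for l
    proof -
      have "A n (nat (int n + i)) l = 0"
      proof (rule ccontr)
        assume "A n (nat (int n + i)) l \<noteq> 0"
        then have "nat (int n + i) \<le> l + d \<and> l \<le> nat (int n + i) + d"
          using band[of n] by (auto simp: banded_def)
        then have "int l - int n \<in> ?D" "l = ?h (int l - int n)" using elim by auto
        then show False using that by blast
      qed
      then show ?thesis by simp
    qed
    have "mat_prod (M n) (A n) (B n) (nat (int n + i)) (nat (int n + j))
        = (\<Sum>l\<in>?h ` ?D. A n (nat (int n + i)) l * B n l (nat (int n + j)))"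
      unfolding mat_prod_def using sub zero by (intro sum.mono_neutral_right) auto
    then show ?case by (simp add: sum.reindex[OF inj])
  qed
  moreover have "(\<lambda>n. \<Sum>m\<in>?D. A n (nat (int n + i)) (nat (int n + m)) * B n (nat (int n + m)) (nat (int n + j)))
      \<longlonglongrightarrow> (\<Sum>m\<in>?D. L i m * L' m j)"
    using A B by (intro tendsto_sum tendsto_mult) (auto simp: window_lim_def)
  ultimately show "(\<lambda>n. mat_prod (M n) (A n) (B n) (nat (int n + i)) (nat (int n + j))) \<longlonglongrightarrow> (\<Sum>m\<in>?D. L i m * L' m j)"
    by (rule Lim_transform_eventually[rotated])
qed

lemma window_lim_banded_zero:
  assumes L: "window_lim A L" and band: "\<And>n. banded d (A n)" and ij: "int d < \<bar>i - j\<bar>"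
  shows "L i j = 0"
proof -
  have "\<forall>\<^sub>F n in sequentially. A n (nat (int n + i)) (nat (int n + j)) = 0"
    using eventually_ge_at_top[of "nat (\<bar>i\<bar> + \<bar>j\<bar>)"]
  proof eventually_elim
    case (elim n)
    then have "\<not> (nat (int n + i) \<le> nat (int n + j) + d \<and> nat (int n + j) \<le> nat (int n + i) + d)"
      using ij by auto
    then show ?case using band[of n] unfolding banded_def by blast
  qed
  then have "(\<lambda>n. A n (nat (int n + i)) (nat (int n + j))) \<longlonglongrightarrow> 0"
    by (rule tendsto_eventually)
  then show ?thesis using L LIMSEQ_unique unfolding window_lim_def by blast
qed

text \<open>
  The lowering part of a Toeplitz matrix is Toeplitz, and two Toeplitz matrices commute: reflecting the
  summation index exchanges the two factors.
\<close>

lemma toeplitz_lower_comm_zero: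
  fixes T :: "int \<Rightarrow> real"
  assumes T: "\<And>l. int d < \<bar>l\<bar> \<Longrightarrow> T l = 0"
  shows "(\<Sum>m\<in>{i - int d..i + int d}. (if i < m then T (i - m) else 0) * T (m - j))
       = (\<Sum>m\<in>{i - int d..i + int d}. T (i - m) * (if m < j then T (m - j) else 0))"
proof -
  let ?g = "\<lambda>m. (if i < m then T (i - m) else 0) * T (m - j)"
  have "(\<Sum>m\<in>{i - int d..i + int d}. T (i - m) * (if m < j then T (m - j) else 0))
      = (\<Sum>m\<in>{j - int d..j + int d}. ?g m)"
    by (rule sum.reindex_bij_witness[of _ "\<lambda>m. i + j - m" "\<lambda>m. i + j - m"]) (auto simp: mult.commute)
  also have "\<dots> = (\<Sum>m\<in>{j - int d..j + int d} \<inter> {i - int d..i + int d}. ?g m)"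
    by (rule sum.mono_neutral_right) (auto intro!: T)
  also have "\<dots> = (\<Sum>m\<in>{i - int d..i + int d}. ?g m)"
    by (rule sum.mono_neutral_left) (auto intro!: T)
  finally show ?thesis by simp
qed

text \<open>
  The factor \<open>l\<close> in the limiting variance counts the pairs of levels at distance \<open>l\<close> that straddle the
  Fermi level.
\<close>

lemma sum_antidiagonals:
  fixes g :: "nat \<Rightarrow> real"
  assumes "\<And>l. d < l \<Longrightarrow> g l = 0"
  shows "(\<Sum>x<d. \<Sum>y<d. g (x + y + 1)) = (\<Sum>l\<in>{1..d}. real l * g l)"
proof -
  have "(\<Sum>x<d. \<Sum>y<d. g (x + y + 1)) = (\<Sum>p\<in>{..<d} \<times> {..<d}. g (fst p + snd p + 1))"
    by (simp add: sum.cartesian_product split_def)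
  also have "\<dots> = (\<Sum>p\<in>{(x, y). x + y < d}. g (fst p + snd p + 1))"
    by (rule sum.mono_neutral_right) (auto intro!: assms)
  also have "\<dots> = (\<Sum>k<d. \<Sum>i\<le>k. g (k + 1))"
    using sum.triangle_reindex[of "\<lambda>x y. g (x + y + 1)" d] by (simp add: split_def)
  also have "\<dots> = (\<Sum>k<d. real (k + 1) * g (k + 1))" by simp
  also have "\<dots> = (\<Sum>l\<in>{1..d}. real l * g l)"
    by (rule sum.reindex_bij_witness[of _ "\<lambda>l. l - 1" Suc]) auto
  finally show ?thesis .
qed

lemma vacuum_trace_lower_comm_tendsto:
  assumes L: "window_lim A (\<lambda>i j. T (i - j))" and band: "\<And>n. banded d (A n)"
    and M: "filterlim (\<lambda>n. M n - n) at_top sequentially" and nM: "\<And>n. n \<le> M n"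
  shows "(\<lambda>n. vacuum_trace n (lower_comm (M n) (A n))) \<longlonglongrightarrow> (\<Sum>l\<in>{1..d}. real l * (T (int l) * T (- int l)))"
proof -
  have T: "T l = 0" if "int d < \<bar>l\<bar>" for l
    using window_lim_banded_zero[OF L band, of l 0] that by simp
  have "\<forall>\<^sub>F n in sequentially. d \<le> M n - n"
    using M by (simp add: filterlim_at_top)
  then have "\<forall>\<^sub>F n in sequentially.
      (\<Sum>x<d. \<Sum>y<d. A n (nat (int n + (- 1 - int x))) (nat (int n + int y)) * A n (nat (int n + int y)) (nat (int n + (- 1 - int x))))
      = vacuum_trace n (lower_comm (M n) (A n))"
    using eventually_ge_at_top[of d]
  proof eventually_elim
    case (elim n)
    let ?f = "\<lambda>j i. A n j i * A n i j"
    have z: "?f j i = 0" if "\<not> (n < j + 1 + d \<and> i < n + d)" "j < n" "n \<le> i" for i j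
    proof -
      have "\<not> (j \<le> i + d \<and> i \<le> j + d)" using that by auto
      then have "A n j i = 0" using band[of n] unfolding banded_def by blast
      then show ?thesis by simp
    qed
    have "vacuum_trace n (lower_comm (M n) (A n)) = (\<Sum>j<n. \<Sum>i\<in>{n..<M n}. ?f j i)"
      by (rule vacuum_trace_lower_comm[OF nM])
    also have "\<dots> = (\<Sum>j\<in>{n - d..<n}. \<Sum>i\<in>{n..<n + d}. ?f j i)"
    proof (rule sum.mono_neutral_cong_right)
      show "\<forall>j\<in>{..<n} - {n - d..<n}. (\<Sum>i\<in>{n..<M n}. ?f j i) = 0"
        using elim by (intro ballI sum.neutral z) auto
      show "(\<Sum>i\<in>{n..<M n}. ?f j i) = (\<Sum>i\<in>{n..<n + d}. ?f j i)" if "j \<in> {n - d..<n}" for j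
        using elim that by (intro sum.mono_neutral_right ballI z) auto
    qed auto
    also have "\<dots> = (\<Sum>x<d. \<Sum>y<d. ?f (n - 1 - x) (n + y))"
    proof -
      have "(\<Sum>i\<in>{n..<n + d}. ?f j i) = (\<Sum>y<d. ?f j (n + y))" for j
        by (rule sum.reindex_bij_witness[of _ "\<lambda>y. n + y" "\<lambda>i. i - n"]) auto
      moreover have "(\<Sum>j\<in>{n - d..<n}. g j) = (\<Sum>x<d. g (n - 1 - x))" for g :: "nat \<Rightarrow> real"
        by (rule sum.reindex_bij_witness[of _ "\<lambda>x. n - 1 - x" "\<lambda>j. n - 1 - j"]) (use elim in auto)
      ultimately show ?thesis by simp
    qed
    also have "\<dots> = (\<Sum>x<d. \<Sum>y<d. ?f (nat (int n + (- 1 - int x))) (nat (int n + int y)))"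
    proof (intro sum.cong refl)
      fix x y assume "x \<in> {..<d}" "y \<in> {..<d}"
      then have "nat (int n + (- 1 - int x)) = n - 1 - x" "nat (int n + int y) = n + y"
        using elim by auto
      then show "?f (n - 1 - x) (n + y) = ?f (nat (int n + (- 1 - int x))) (nat (int n + int y))" by simp
    qed
    finally show ?case by simp
  qed
  moreover have "(\<lambda>n. \<Sum>x<d. \<Sum>y<d. A n (nat (int n + (- 1 - int x))) (nat (int n + int y)) * A n (nat (int n + int y)) (nat (int n + (- 1 - int x))))
     \<longlonglongrightarrow> (\<Sum>x<d. \<Sum>y<d. T (- 1 - int x - int y) * T (int y - (- 1 - int x)))"
    using L[unfolded window_lim_def, rule_format] by (intro tendsto_sum tendsto_mult)
  moreover have "(\<Sum>x<d. \<Sum>y<d. T (- 1 - int x - int y) * T (int y - (- 1 - int x)))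
     = (\<Sum>l\<in>{1..d}. real l * (T (int l) * T (- int l)))"
  proof -
    have "T (- 1 - int x - int y) * T (int y - (- 1 - int x)) = T (int (x + y + 1)) * T (- int (x + y + 1))" for x y
      by (simp add: algebra_simps)
    then show ?thesis using sum_antidiagonals[of d "\<lambda>l. T (int l) * T (- int l)"] T by simp
  qed
  ultimately show ?thesis using Lim_transform_eventually by fastforce
qed

fun gauss_moment :: "real \<Rightarrow> nat \<Rightarrow> real" where
  "gauss_moment v 0 = 1"
| "gauss_moment v (Suc 0) = 0"
| "gauss_moment v (Suc (Suc m)) = real (Suc m) * v * gauss_moment v m"

lemma hop_centered_pow_locally_bounded:
  assumes alt: "\<And>n. alternating n (F n)" and band: "\<And>n. banded d (A n)" and M: "\<And>n. n \<le> M n"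
    and A: "window_lim A L" and F: "locally_bounded F"
  shows "locally_bounded (\<lambda>n. (hop_centered (M n) n (A n) ^^ m) (F n))"
proof (induction m)
  case (Suc m)
  have "locally_bounded (\<lambda>n. hop_centered (M n) n (A n) ((hop_centered (M n) n (A n) ^^ m) (F n)))"
    by (rule hop_centered_locally_bounded[OF alternating_hop_centered_pow[OF alt] band M A Suc])
  then show ?case by simp
qed (use F in simp)

lemma hop_centered_pow_locally_null:
  assumes alt: "\<And>n. alternating n (F n)" and band: "\<And>n. banded d (A n)" and M: "\<And>n. n \<le> M n"
    and A: "window_lim A L" and F: "locally_null F"
  shows "locally_null (\<lambda>n. (hop_centered (M n) n (A n) ^^ m) (F n))"
proof (induction m)
  case (Suc m)
  have "locally_null (\<lambda>n. hop_centered (M n) n (A n) ((hop_centered (M n) n (A n) ^^ m) (F n)))"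
    by (rule hop_centered_locally_null_if_locally_null[OF alternating_hop_centered_pow[OF alt] band M A Suc])
  then show ?case by simp
qed (use F in simp)

lemma locally_null_tendsto:
  assumes "locally_null F"
  shows "(\<lambda>n. F n id) \<longlonglongrightarrow> 0"
proof (rule tendstoI)
  fix e :: real assume "0 < e"
  then have "\<forall>\<^sub>F n in sequentially. \<forall>s\<in>window n 1. \<bar>F n s\<bar> \<le> e / 2"
    using assms[unfolded locally_null_def, rule_format, of "e / 2" 1] by simp
  then show "\<forall>\<^sub>F n in sequentially. dist (F n id) 0 < e"
  proof eventually_elim
    case (elim n)
    then have "\<bar>F n id\<bar> \<le> e / 2" using bspec[OF elim id_in_window] by simp
    then show ?case using \<open>0 < e\<close> by simp
  qed
qed

text \<open>
  In \<open>moment_recursion\<close> the commutator tends to zero near the Fermi level, so its centred remainder is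
  negligible by locality, while its trace converges. What remains in the limit is the recursion of the
  Gaussian moments.
\<close>

theorem wick_moments:
  assumes v: "\<And>n. vacuum n (\<epsilon> n)" and band: "\<And>n. banded d (A n)"
    and A: "window_lim A (\<lambda>i j. T (i - j))"
    and M: "filterlim (\<lambda>n. M n - n) at_top sequentially" and nM: "\<And>n. n \<le> M n"
  shows "(\<lambda>n. (hop_centered (M n) n (A n) ^^ m) (\<epsilon> n) id)
           \<longlonglongrightarrow> gauss_moment (\<Sum>l\<in>{1..d}. real l * (T (int l) * T (- int l))) m"
proof -
  let ?v = "\<Sum>l\<in>{1..d}. real l * (T (int l) * T (- int l))"
  let ?C = "\<lambda>n. lower_comm (M n) (A n)"
  have alt: "alternating n (\<epsilon> n)" for n using v by (simp add: vacuum_def)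
  have bdd: "locally_bounded \<epsilon>" using v by (auto simp: locally_bounded_def vacuum_def intro!: exI[of _ 1])
  have T: "T l = 0" if "int d < \<bar>l\<bar>" for l
    using window_lim_banded_zero[OF A band, of l 0] that by simp
  have C: "window_lim ?C (\<lambda>_ _. 0)"
  proof -
    have "window_lim (\<lambda>n i j. mat_prod (M n) (lowering (A n)) (A n) i j - mat_prod (M n) (A n) (lowering (A n)) i j)
       (\<lambda>i j. (\<Sum>m\<in>{i - int d..i + int d}. (if i < m then T (i - m) else 0) * T (m - j))
            - (\<Sum>m\<in>{i - int d..i + int d}. T (i - m) * (if m < j then T (m - j) else 0)))"
      by (rule window_lim_diff[OF window_lim_mat_prod[OF window_lim_lowering[OF A] A banded_lowering[OF band] M]
            window_lim_mat_prod[OF A window_lim_lowering[OF A] band M]])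
    moreover have "(\<Sum>m\<in>{i - int d..i + int d}. (if i < m then T (i - m) else 0) * T (m - j))
            - (\<Sum>m\<in>{i - int d..i + int d}. T (i - m) * (if m < j then T (m - j) else 0)) = 0" for i j
      using toeplitz_lower_comm_zero[where T = T and d = d and i = i and j = j] T by (simp only: diff_self)
    ultimately show ?thesis
      unfolding lower_comm_def[abs_def] by (simp only:)
  qed
  have bandC: "banded (d + d) (?C n)" for n by (rule banded_lower_comm[OF band])
  show ?thesis
  proof (induction m rule: less_induct)
    case (less m)
    consider "m = 0" | "m = 1" | k where "m = Suc (Suc k)" by (metis One_nat_def nat.exhaust)
    then show ?case
    proof cases
      case 1
      have e: "\<epsilon> n id = 1" for n using v by (simp add: vacuum_def)
      show ?thesis unfolding 1 funpow_0 gauss_moment.simps e by (rule tendsto_const)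
    next
      case 2
      have e: "(hop_centered (M n) n (A n) ^^ 1) (\<epsilon> n) id = 0" for n
        by (simp only: One_nat_def funpow.simps o_apply id_apply hop_centered_vacuum_id[OF v nM])
      show ?thesis unfolding 2 e by simp
    next
      case 3
      have "(\<lambda>n. (hop_centered (M n) n (A n) ^^ i) (hop_centered (M n) n (?C n) ((hop_centered (M n) n (A n) ^^ (Suc k - 1 - i)) (\<epsilon> n))) id) \<longlonglongrightarrow> 0" for i
        by (intro locally_null_tendsto hop_centered_pow_locally_null[OF _ band nM A] alternating_hop_centered alternating_hop_centered_pow alt
            hop_centered_locally_null_if_window_lim_zero[OF _ bandC nM C] hop_centered_pow_locally_bounded[OF alt band nM A bdd])
      note N = this
      have IH: "(\<lambda>n. (hop_centered (M n) n (A n) ^^ k) (\<epsilon> n) id) \<longlonglongrightarrow> gauss_moment ?v k"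
        by (rule less) (simp add: 3)
      have "(\<lambda>n. real (Suc k) * vacuum_trace n (?C n) * (hop_centered (M n) n (A n) ^^ k) (\<epsilon> n) id
          + (\<Sum>i<Suc k. (hop_centered (M n) n (A n) ^^ i) (hop_centered (M n) n (?C n) ((hop_centered (M n) n (A n) ^^ (Suc k - 1 - i)) (\<epsilon> n))) id))
          \<longlonglongrightarrow> real (Suc k) * ?v * gauss_moment ?v k + (\<Sum>i<Suc k. 0)"
        by (intro tendsto_add tendsto_mult tendsto_const tendsto_sum IH N vacuum_trace_lower_comm_tendsto[OF A band M nM])
      moreover have "(\<lambda>n. (hop_centered (M n) n (A n) ^^ m) (\<epsilon> n) id)
         = (\<lambda>n. real (Suc k) * vacuum_trace n (?C n) * (hop_centered (M n) n (A n) ^^ k) (\<epsilon> n) id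
          + (\<Sum>i<Suc k. (hop_centered (M n) n (A n) ^^ i) (hop_centered (M n) n (?C n) ((hop_centered (M n) n (A n) ^^ (Suc k - 1 - i)) (\<epsilon> n))) id))"
        unfolding 3 using moment_recursion[OF v nM, where m = "Suc k"] by (intro ext) simp
      ultimately have "(\<lambda>n. (hop_centered (M n) n (A n) ^^ m) (\<epsilon> n) id)
          \<longlonglongrightarrow> real (Suc k) * ?v * gauss_moment ?v k + (\<Sum>i<Suc k. 0)"
        by (simp only:)
      moreover have "real (Suc k) * ?v * gauss_moment ?v k + (\<Sum>i<Suc k. 0) = gauss_moment ?v m"
        by (simp add: 3)
      ultimately show ?thesis by (simp only:)
    qed
  qed
qed

section \<open>Orthonormal systems and their determinantal ensembles\<close>

text \<open>
  Functions on the sites \<open>{0..<M}\<close> that form an orthonormal basis, of which the first \<open>n\<close> are filled.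
  Setting \<open>P i = 0\<close> for the remaining indices \<open>i\<close> makes the expansions below valid for all index tuples.
\<close>

locale orthonormal_system =
  fixes M n :: nat and P :: "nat \<Rightarrow> nat \<Rightarrow> real"
  assumes n_le_M: "n \<le> M"
    and orthonormal: "\<And>i j. i < M \<Longrightarrow> j < M \<Longrightarrow> (\<Sum>x<M. P i x * P j x) = (if i = j then 1 else 0)"
    and P_zero: "\<And>i x. M \<le> i \<Longrightarrow> P i x = 0"
begin

text \<open>
  Orthonormality says that a square matrix times its transpose is the identity; the factors can be
  exchanged.
\<close>

lemma complete:
  assumes "x < M" "y < M"
  shows "(\<Sum>i<M. P i x * P i y) = (if x = y then 1 else 0)"
proof -
  define A where "A = Matrix.mat M M (\<lambda>(i, x). P i x)"
  have c: "A \<in> carrier_mat M M" "transpose_mat A \<in> carrier_mat M M" by (auto simp: A_def)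
  have "A * transpose_mat A = 1\<^sub>m M"
    by (rule eq_matI) (auto simp: A_def scalar_prod_def orthonormal atLeast0LessThan)
  then have "transpose_mat A * A = 1\<^sub>m M"
    by (rule mat_mult_left_right_inverse[OF c])
  then have "(transpose_mat A * A) $$ (x, y) = 1\<^sub>m M $$ (x, y)" by simp
  then show ?thesis using assms by (simp add: A_def scalar_prod_def atLeast0LessThan)
qed

text \<open>
  The matrix of multiplication by \<open>g\<close> in the basis \<open>P\<close>.
\<close>

definition mult_mat :: "(nat \<Rightarrow> real) \<Rightarrow> nat \<Rightarrow> nat \<Rightarrow> real" where
  "mult_mat g i j = (\<Sum>x<M. g x * P i x * P j x)"

definition slater :: "(nat \<Rightarrow> nat) \<Rightarrow> real" where
  "slater x = (\<Sum>p | p permutes {..<n}. of_int (sign p) * (\<Prod>j<n. P (p j) (x j)))"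

text \<open>
  One of the two Slater determinants of the density is replaced by a single product, which is allowed up
  to the factor \<open>n!\<close> because the other one is antisymmetric; this makes the expression multilinear in the
  functions number \<open>s 0, \<dots>, s (n - 1)\<close>.
\<close>

definition pairing :: "((nat \<Rightarrow> nat) \<Rightarrow> real) \<Rightarrow> (nat \<Rightarrow> nat) \<Rightarrow> real" where
  "pairing \<Psi> s = (\<Sum>x\<in>{..<n} \<rightarrow>\<^sub>E {..<M}. \<Psi> x * (\<Prod>j<n. P (s j) (x j)) * slater x)"

lemma mult_mat_expand:
  assumes "x < M"
  shows "(\<Sum>i<M. mult_mat g i k * P i x) = g x * P k x"
proof -
  have "(\<Sum>i<M. mult_mat g i k * P i x) = (\<Sum>y<M. g y * P k y * (\<Sum>i<M. P i y * P i x))"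
    unfolding mult_mat_def sum_distrib_right sum_distrib_left
    by (subst sum.swap) (simp add: mult_ac)
  also have "\<dots> = (\<Sum>y<M. if y = x then g y * P k y else 0)"
    using assms by (intro sum.cong refl) (simp add: complete)
  finally show ?thesis using assms by simp
qed

text \<open>
  Multiplication by \<open>g\<close> in one variable replaces the factor of that variable by its expansion in the
  basis.
\<close>

lemma pairing_hop:
  "pairing (\<lambda>x. (\<Sum>j<n. g (x j)) * \<Psi> x) s = hop M n (mult_mat g) (pairing \<Psi>) s"
proof -
  let ?T = "{..<n} \<rightarrow>\<^sub>E {..<M}"
  have *: "g (x j) * (\<Prod>l<n. P (s l) (x l)) = (\<Sum>i<M. mult_mat g i (s j) * (\<Prod>l<n. P ((s(j := i)) l) (x l)))"
    if "x \<in> ?T" "j < n" for x j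
  proof -
    have split: "(\<Prod>l<n. P ((s(j := i)) l) (x l)) = P i (x j) * (\<Prod>l\<in>{..<n} - {j}. P (s l) (x l))" for i
      using that by (subst prod.remove[of _ j]) auto
    have "(\<Prod>l<n. P (s l) (x l)) = P (s j) (x j) * (\<Prod>l\<in>{..<n} - {j}. P (s l) (x l))"
      using that by (subst prod.remove[of _ j]) auto
    moreover have "(\<Sum>i<M. mult_mat g i (s j) * P i (x j)) = g (x j) * P (s j) (x j)"
      using that by (intro mult_mat_expand) auto
    ultimately show ?thesis
      unfolding split by (simp add: mult.assoc[symmetric] sum_distrib_right[symmetric])
  qed
  have "pairing (\<lambda>x. (\<Sum>j<n. g (x j)) * \<Psi> x) s
      = (\<Sum>x\<in>?T. \<Sum>j<n. g (x j) * (\<Prod>l<n. P (s l) (x l)) * (\<Psi> x * slater x))"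
    unfolding pairing_def sum_distrib_right sum_distrib_left
    by (intro sum.cong refl) (simp add: mult_ac)
  also have "\<dots> = (\<Sum>x\<in>?T. \<Sum>j<n. \<Sum>i<M. mult_mat g i (s j) * ((\<Psi> x * (\<Prod>l<n. P ((s(j := i)) l) (x l))) * slater x))"
    by (intro sum.cong refl) (simp add: * sum_distrib_right sum_distrib_left mult_ac del: fun_upd_apply)
  also have "\<dots> = (\<Sum>j<n. \<Sum>x\<in>?T. \<Sum>i<M. mult_mat g i (s j) * ((\<Psi> x * (\<Prod>l<n. P ((s(j := i)) l) (x l))) * slater x))"
    by (rule sum.swap)
  also have "\<dots> = (\<Sum>j<n. \<Sum>i<M. \<Sum>x\<in>?T. mult_mat g i (s j) * ((\<Psi> x * (\<Prod>l<n. P ((s(j := i)) l) (x l))) * slater x))"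
    by (intro sum.cong refl sum.swap)
  also have "\<dots> = hop M n (mult_mat g) (pairing \<Psi>) s"
    by (simp only: hop_def pairing_def sum_distrib_left)
  finally show ?thesis .
qed

lemma pairing_hop_centered_pow:
  "pairing (\<lambda>x. ((\<Sum>j<n. g (x j)) - vacuum_trace n (mult_mat g)) ^ m) = (hop_centered M n (mult_mat g) ^^ m) (pairing (\<lambda>_. 1))"
proof (induction m)
  case (Suc m)
  let ?Y = "\<lambda>x. (\<Sum>j<n. g (x j)) - vacuum_trace n (mult_mat g)"
  have "pairing (\<lambda>x. ?Y x ^ Suc m) s = hop_centered M n (mult_mat g) (pairing (\<lambda>x. ?Y x ^ m)) s" for s
  proof -
    have "pairing (\<lambda>x. ?Y x ^ Suc m) s
        = pairing (\<lambda>x. (\<Sum>j<n. g (x j)) * ?Y x ^ m) s - vacuum_trace n (mult_mat g) * pairing (\<lambda>x. ?Y x ^ m) s"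
      unfolding pairing_def sum_distrib_left sum_subtractf[symmetric]
      by (intro sum.cong refl) (simp add: algebra_simps)
    then show ?thesis
      using pairing_hop[of g "\<lambda>x. ?Y x ^ m" s] by (simp only: hop_centered_def)
  qed
  then show ?case using Suc by (auto simp del: power_Suc)
qed simp

text \<open>
  By Fubini and orthonormality only the terms survive in which the tuple is a permutation of the filled
  levels.
\<close>

lemma pairing_one:
  "pairing (\<lambda>_. 1) s = (\<Sum>p | p permutes {..<n}. of_int (sign p) * (if \<forall>j<n. s j = p j then 1 else 0))"
proof -
  have ortho': "(\<Sum>x<M. P i x * P j x) = (if i = j then 1 else 0)" if "j < n" for i j
  proof (cases "i < M")
    case False
    then show ?thesis using that n_le_M by (simp add: P_zero)
  qed (use that n_le_M in \<open>simp add: orthonormal\<close>)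
  have "pairing (\<lambda>_. 1) s = (\<Sum>x\<in>{..<n} \<rightarrow>\<^sub>E {..<M}. \<Sum>p | p permutes {..<n}.
      of_int (sign p) * (\<Prod>j<n. P (s j) (x j) * P (p j) (x j)))"
    by (simp add: pairing_def slater_def sum_distrib_left prod.distrib mult_ac)
  also have "\<dots> = (\<Sum>p | p permutes {..<n}. \<Sum>x\<in>{..<n} \<rightarrow>\<^sub>E {..<M}.
      of_int (sign p) * (\<Prod>j<n. P (s j) (x j) * P (p j) (x j)))"
    by (rule sum.swap)
  also have "\<dots> = (\<Sum>p | p permutes {..<n}. of_int (sign p) * (\<Prod>j<n. \<Sum>x<M. P (s j) x * P (p j) x))"
    by (subst prod_sum_PiE) (auto simp: sum_distrib_left)
  also have "\<dots> = (\<Sum>p | p permutes {..<n}. of_int (sign p) * (\<Prod>j<n. if s j = p j then 1 else 0))"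
  proof (intro sum.cong refl arg_cong2[where f = "(*)"] prod.cong)
    fix p j assume "p \<in> {p. p permutes {..<n}}" "j \<in> {..<n}"
    then have "p j < n" using permutes_in_image by fastforce
    then show "(\<Sum>x<M. P (s j) x * P (p j) x) = (if s j = p j then 1 else 0)" by (rule ortho')
  qed
  also have "\<dots> = (\<Sum>p | p permutes {..<n}. of_int (sign p) * (if \<forall>j<n. s j = p j then 1 else 0))"
    by (intro sum.cong refl arg_cong2[where f = "(*)"]) (auto simp: prod_zero_iff)
  finally show ?thesis .
qed

lemma vacuum_pairing: "vacuum n (pairing (\<lambda>_. 1))"
  unfolding vacuum_def
proof (intro conjI allI impI)
  have fin: "finite {p. p permutes {..<n}}" by (rule finite_permutations) simp
  have single: "pairing (\<lambda>_. 1) s = of_int (sign p)" if p: "p permutes {..<n}" and s: "\<And>j. j < n \<Longrightarrow> s j = p j" for s p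
  proof -
    have "(\<forall>j<n. s j = p' j) \<longleftrightarrow> p' = p" if "p' permutes {..<n}" for p'
    proof
      assume "\<forall>j<n. s j = p' j"
      then show "p' = p" using p that s by (intro ext) (metis lessThan_iff permutes_not_in)
    qed (use s in auto)
    then have "pairing (\<lambda>_. 1) s = (\<Sum>p' | p' permutes {..<n}. if p' = p then of_int (sign p) else 0)"
      unfolding pairing_one by (intro sum.cong refl) auto
    then show ?thesis using p fin by simp
  qed
  have none: "pairing (\<lambda>_. 1) s = 0" if "\<And>p. p permutes {..<n} \<Longrightarrow> \<exists>j<n. s j \<noteq> p j" for s
    unfolding pairing_one using that by (intro sum.neutral) auto
  show "pairing (\<lambda>_. 1) s = 0" if "j < n" "n \<le> s j" for s j
  proof (rule none)
    fix p assume "p permutes {..<n}"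
    then have "p j < n" using that permutes_in_image by fastforce
    then show "\<exists>j<n. s j \<noteq> p j" using that by (intro exI[of _ j]) auto
  qed
  show "pairing (\<lambda>_. 1) id = 1"
    using single[of id id] by (simp add: permutes_id)
  show "\<bar>pairing (\<lambda>_. 1) s\<bar> \<le> 1" for s
  proof (cases "\<exists>p. p permutes {..<n} \<and> (\<forall>j<n. s j = p j)")
    case True
    then obtain p where "p permutes {..<n}" "\<And>j. j < n \<Longrightarrow> s j = p j" by auto
    then show ?thesis using single[of p s] by (cases p rule: sign_cases) auto
  next
    case False
    have "pairing (\<lambda>_. 1) s = 0"
    proof (rule none)
      fix p assume p: "p permutes {..<n}"
      show "\<exists>j<n. s j \<noteq> p j"
      proof (rule ccontr)
        assume "\<not> ?thesis"
        then have "\<forall>j<n. s j = p j" by simp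
        with p have "\<exists>p. p permutes {..<n} \<and> (\<forall>j<n. s j = p j)" by (intro exI[of _ p] conjI)
        with False show False by (rule notE)
      qed
    qed
    then show ?thesis by simp
  qed
  show "alternating n (pairing (\<lambda>_. 1))"
    unfolding alternating_def
  proof (intro allI impI)
    fix s :: "nat \<Rightarrow> nat" and i j assume ij: "i < n" "j < n" "i \<noteq> j"
    let ?t = "Transposition.transpose i j"
    have t: "?t permutes {..<n}" using ij by (intro permutes_swap_id) auto
    have iff: "(\<forall>l<n. (s \<circ> ?t) l = (p \<circ> ?t) l) \<longleftrightarrow> (\<forall>l<n. s l = p l)" for p :: "nat \<Rightarrow> nat"
    proof -
      have "?t l < n \<longleftrightarrow> l < n" for l using permutes_in_image[OF t, of l] by simp
      moreover have "?t (?t l) = l" for l by simp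
      ultimately show ?thesis unfolding o_apply by metis
    qed
    have sgn: "sign (p \<circ> ?t) = - sign p" if "p permutes {..<n}" for p
    proof -
      have "permutation p" using that by (metis finite_lessThan permutation_permutes)
      then have "sign (p \<circ> ?t) = sign p * sign ?t"
        by (intro sign_compose) (simp_all add: permutation_swap_id)
      then show ?thesis using ij by (simp add: sign_swap_id)
    qed
    have "pairing (\<lambda>_. 1) (s \<circ> ?t) = (\<Sum>p | p permutes {..<n}. of_int (sign (p \<circ> ?t)) * (if \<forall>l<n. (s \<circ> ?t) l = (p \<circ> ?t) l then 1 else 0))"
      unfolding pairing_one by (rule sum_permutations_compose_right[OF t])
    also have "\<dots> = (\<Sum>p | p permutes {..<n}. - (of_int (sign p) * (if \<forall>l<n. s l = p l then 1 else 0)))"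
      unfolding iff by (intro sum.cong refl) (simp add: sgn)
    finally show "pairing (\<lambda>_. 1) (s \<circ> ?t) = - pairing (\<lambda>_. 1) s"
      by (simp add: pairing_one sum_negf)
  qed
qed

lemma slater_permute:
  assumes p: "p permutes {..<n}" and z: "\<And>j. j < n \<Longrightarrow> z j = y (p j)"
  shows "slater z = of_int (sign p) * slater y"
proof -
  have perm: "permutation p" using p by (metis finite_lessThan permutation_permutes)
  have "slater z = (\<Sum>q | q permutes {..<n}. of_int (sign (q \<circ> p)) * (\<Prod>j<n. P ((q \<circ> p) j) (z j)))"
    unfolding slater_def by (rule sum_permutations_compose_right[OF p])
  also have "\<dots> = (\<Sum>q | q permutes {..<n}. of_int (sign p) * (of_int (sign q) * (\<Prod>j<n. P (q j) (y j))))"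
  proof (intro sum.cong refl)
    fix q assume "q \<in> {q. q permutes {..<n}}"
    then have q: "q permutes {..<n}" by simp
    then have "permutation q" by (metis finite_lessThan permutation_permutes)
    then have "sign (q \<circ> p) = sign q * sign p" using perm by (rule sign_compose)
    moreover have "(\<Prod>j<n. P ((q \<circ> p) j) (z j)) = (\<Prod>j<n. P (q (p j)) (y (p j)))"
      using z by simp
    moreover have "\<dots> = (\<Prod>j<n. P (q j) (y j))"
      by (rule prod.reindex_bij_betw[OF permutes_imp_bij[OF p]])
    ultimately show "of_int (sign (q \<circ> p)) * (\<Prod>j<n. P ((q \<circ> p) j) (z j))
        = of_int (sign p) * (of_int (sign q) * (\<Prod>j<n. P (q j) (y j)))" by simp
  qed
  finally show ?thesis by (simp add: slater_def sum_distrib_left)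
qed

lemma slater_dup:
  assumes "i < n" "j < n" "i \<noteq> j" "x i = x j"
  shows "slater x = 0"
proof -
  let ?t = "Transposition.transpose i j"
  have "slater x = of_int (sign ?t) * slater x"
    using assms by (intro slater_permute permutes_swap_id) (auto simp: Transposition.transpose_def)
  then show ?thesis using assms by (simp add: sign_swap_id)
qed

text \<open>
  Tuples with a repeated site do not contribute; the others are the rearrangements of the chosen
  representatives \<open>y d\<close>, and summing the single product over all rearrangements, with signs, restores
  the second Slater determinant.
\<close>

lemma pairing_id_eq_sum:
  fixes y :: "'d \<Rightarrow> nat \<Rightarrow> nat"
  assumes bij: "bij_betw (\<lambda>(d, p). restrict (y d \<circ> p) {..<n}) (Y \<times> {p. p permutes {..<n}})
      {x \<in> {..<n} \<rightarrow>\<^sub>E {..<M}. inj_on x {..<n}}"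
    and sym: "\<And>d p. d \<in> Y \<Longrightarrow> p permutes {..<n} \<Longrightarrow> \<Psi> (restrict (y d \<circ> p) {..<n}) = \<Psi>' d"
  shows "pairing \<Psi> id = (\<Sum>d\<in>Y. \<Psi>' d * (slater (y d))\<^sup>2)"
proof -
  let ?T = "{..<n} \<rightarrow>\<^sub>E {..<M}" and ?S = "{p. p permutes {..<n}}"
  let ?f = "\<lambda>x. \<Psi> x * (\<Prod>j<n. P j (x j)) * slater x"
  have "pairing \<Psi> id = (\<Sum>x\<in>?T. ?f x)" by (simp add: pairing_def)
  also have "\<dots> = (\<Sum>x\<in>{x \<in> ?T. inj_on x {..<n}}. ?f x)"
  proof (rule sum.mono_neutral_right)
    show "finite ?T" by (intro finite_PiE) auto
    show "\<forall>x\<in>?T - {x \<in> ?T. inj_on x {..<n}}. ?f x = 0"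
      using slater_dup by (auto simp: inj_on_def)
  qed auto
  also have "\<dots> = (\<Sum>(d, p)\<in>Y \<times> ?S. ?f (restrict (y d \<circ> p) {..<n}))"
    using sum.reindex_bij_betw[OF bij, of ?f] by (simp add: split_def)
  also have "\<dots> = (\<Sum>d\<in>Y. \<Sum>p\<in>?S. ?f (restrict (y d \<circ> p) {..<n}))"
    by (rule sum.cartesian_product[symmetric])
  also have "\<dots> = (\<Sum>d\<in>Y. \<Psi>' d * (slater (y d))\<^sup>2)"
  proof (intro sum.cong refl)
    fix d assume y: "d \<in> Y"
    have "(\<Sum>p\<in>?S. ?f (restrict (y d \<circ> p) {..<n}))
        = (\<Sum>p\<in>?S. \<Psi>' d * slater (y d) * (of_int (sign p) * (\<Prod>j<n. P j (y d (p j)))))"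
    proof (intro sum.cong refl)
      fix p assume "p \<in> ?S"
      then have p: "p permutes {..<n}" by simp
      have "slater (restrict (y d \<circ> p) {..<n}) = of_int (sign p) * slater (y d)"
        by (rule slater_permute[OF p]) simp
      then show "?f (restrict (y d \<circ> p) {..<n}) = \<Psi>' d * slater (y d) * (of_int (sign p) * (\<Prod>j<n. P j (y d (p j))))"
        using sym[OF y p] by (simp add: mult_ac)
    qed
    also have "\<dots> = \<Psi>' d * slater (y d) * (\<Sum>p\<in>?S. of_int (sign p) * (\<Prod>j<n. P j (y d (p j))))"
      by (simp add: sum_distrib_left)
    also have "(\<Sum>p\<in>?S. of_int (sign p) * (\<Prod>j<n. P j (y d (p j)))) = slater (y d)"
    proof -
      have "(\<Sum>p\<in>?S. of_int (sign p) * (\<Prod>j<n. P j (y d (p j)))) = (\<Sum>p\<in>?S. of_int (sign (Hilbert_Choice.inv p)) * (\<Prod>j<n. P j (y d (Hilbert_Choice.inv p j))))"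
        by (rule sum_permutations_inverse)
      also have "\<dots> = slater (y d)"
        unfolding slater_def
      proof (intro sum.cong refl)
        fix p assume "p \<in> ?S"
        then have p: "p permutes {..<n}" by simp
        have "permutation p" using p by (metis finite_lessThan permutation_permutes)
        then have "sign (Hilbert_Choice.inv p) = sign p" by (rule sign_inverse)
        moreover have "(\<Prod>j<n. P j (y d (Hilbert_Choice.inv p j))) = (\<Prod>j<n. P (p j) (y d (Hilbert_Choice.inv p (p j))))"
          by (rule prod.reindex_bij_betw[OF permutes_imp_bij[OF p], symmetric])
        ultimately show "of_int (sign (Hilbert_Choice.inv p)) * (\<Prod>j<n. P j (y d (Hilbert_Choice.inv p j))) = of_int (sign p) * (\<Prod>j<n. P (p j) (y d j))"
          by (simp add: permutes_inverses[OF p])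
      qed
      finally show ?thesis .
    qed
    finally show "(\<Sum>p\<in>?S. ?f (restrict (y d \<circ> p) {..<n})) = \<Psi>' d * (slater (y d))\<^sup>2"
      by (simp only: power2_eq_square mult.assoc)
  qed
  finally show ?thesis .
qed

text \<open>
  The kernel of the orthogonal projection onto the filled functions.
\<close>

definition kern :: "nat \<Rightarrow> nat \<Rightarrow> real" where
  "kern x y = (\<Sum>j<n. P j x * P j y)"

text \<open>
  The left hand side is the sum of \<open>g x g y K(x,y) (\<delta>(x,y) - K(x,y))\<close> with the projection kernel \<open>K\<close>. The
  row sums of \<open>K (\<delta> - K)\<close>, taken entrywise, vanish by orthogonality of filled and empty functions, so
  \<open>g x g y\<close> may be replaced by \<open>- (g x - g y)\<^sup>2 / 2\<close>; this kills the diagonal and leaves \<open>- K\<^sup>2\<close>.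
\<close>

lemma offdiag_eq_kernel:
  "(\<Sum>j<n. \<Sum>i\<in>{n..<M}. mult_mat g j i * mult_mat g i j) = (\<Sum>x<M. \<Sum>y<M. (g x - g y)\<^sup>2 * (kern x y)\<^sup>2) / 2"
proof -
  define co where "co x y = (\<Sum>i\<in>{n..<M}. P i x * P i y)" for x y
  have sum1: "kern x y + co x y = (if x = y then 1 else 0)" if "x < M" "y < M" for x y
  proof -
    have "{..<M} = {..<n} \<union> {n..<M}" using n_le_M by auto
    then have "(\<Sum>i<M. P i x * P i y) = (\<Sum>i\<in>{..<n} \<union> {n..<M}. P i x * P i y)" by (rule arg_cong)
    also have "\<dots> = kern x y + co x y"
      unfolding kern_def co_def by (rule sum.union_disjoint) auto
    finally show ?thesis using complete[OF that] by simp
  qed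
  have prod: "kern x y * co x y = (\<Sum>j<n. \<Sum>i\<in>{n..<M}. P j x * P i x * (P j y * P i y))" for x y
    unfolding kern_def co_def sum_product by (intro sum.cong refl) (simp add: mult_ac)
  have row: "(\<Sum>y<M. kern x y * co x y) = 0" for x
  proof -
    have "(\<Sum>y<M. kern x y * co x y) = (\<Sum>j<n. \<Sum>y<M. \<Sum>i\<in>{n..<M}. P j x * P i x * (P j y * P i y))"
      unfolding prod by (rule sum.swap)
    also have "\<dots> = (\<Sum>j<n. \<Sum>i\<in>{n..<M}. \<Sum>y<M. P j x * P i x * (P j y * P i y))"
      by (intro sum.cong refl sum.swap)
    also have "\<dots> = (\<Sum>j<n. \<Sum>i\<in>{n..<M}. P j x * P i x * (\<Sum>y<M. P j y * P i y))"
      by (simp only: sum_distrib_left)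
    also have "\<dots> = 0" using n_le_M by (intro sum.neutral ballI) (simp add: orthonormal)
    finally show ?thesis .
  qed
  have sym': "kern x y * co x y = kern y x * co y x" for x y
    by (simp add: kern_def co_def mult_ac)
  have row': "(\<Sum>x<M. kern x y * co x y) = 0" for y
    using row[of y] by (simp only: sym'[of _ y])
  have "(\<Sum>j<n. \<Sum>i\<in>{n..<M}. mult_mat g j i * mult_mat g i j)
      = (\<Sum>j<n. \<Sum>i\<in>{n..<M}. \<Sum>x<M. \<Sum>y<M. g x * g y * (P j x * P i x * (P j y * P i y)))"
    unfolding mult_mat_def sum_product by (intro sum.cong refl) (simp add: mult_ac)
  also have "\<dots> = (\<Sum>j<n. \<Sum>x<M. \<Sum>i\<in>{n..<M}. \<Sum>y<M. g x * g y * (P j x * P i x * (P j y * P i y)))"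
    by (intro sum.cong refl sum.swap)
  also have "\<dots> = (\<Sum>x<M. \<Sum>j<n. \<Sum>y<M. \<Sum>i\<in>{n..<M}. g x * g y * (P j x * P i x * (P j y * P i y)))"
    by (subst sum.swap, intro sum.cong refl sum.swap)
  also have "\<dots> = (\<Sum>x<M. \<Sum>y<M. \<Sum>j<n. \<Sum>i\<in>{n..<M}. g x * g y * (P j x * P i x * (P j y * P i y)))"
    by (intro sum.cong refl sum.swap)
  also have "\<dots> = (\<Sum>x<M. \<Sum>y<M. g x * g y * (kern x y * co x y))"
    unfolding prod sum_distrib_left ..
  also have "\<dots> = (\<Sum>x<M. \<Sum>y<M. - ((g x - g y)\<^sup>2 * (kern x y * co x y) / 2))"
  proof -
    have 1: "(\<Sum>x<M. \<Sum>y<M. (g x)\<^sup>2 / 2 * (kern x y * co x y)) = 0"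
      unfolding sum_distrib_left[symmetric] row by simp
    have "(\<Sum>x<M. \<Sum>y<M. (g y)\<^sup>2 / 2 * (kern x y * co x y)) = (\<Sum>y<M. \<Sum>x<M. (g y)\<^sup>2 / 2 * (kern x y * co x y))"
      by (rule sum.swap)
    also have "\<dots> = 0"
      unfolding sum_distrib_left[symmetric] row' by simp
    finally have 2: "(\<Sum>x<M. \<Sum>y<M. (g y)\<^sup>2 / 2 * (kern x y * co x y)) = 0" .
    have "(\<Sum>x<M. \<Sum>y<M. - ((g x - g y)\<^sup>2 * (kern x y * co x y) / 2))
       = (\<Sum>x<M. \<Sum>y<M. g x * g y * (kern x y * co x y) - (g x)\<^sup>2 / 2 * (kern x y * co x y) - (g y)\<^sup>2 / 2 * (kern x y * co x y))"
      by (intro sum.cong refl) (simp add: power2_eq_square field_simps)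
    also have "\<dots> = (\<Sum>x<M. \<Sum>y<M. g x * g y * (kern x y * co x y))"
      unfolding sum_subtractf 1 2 by simp
    finally show ?thesis by (rule sym)
  qed
  also have "\<dots> = (\<Sum>x<M. \<Sum>y<M. (g x - g y)\<^sup>2 * (kern x y)\<^sup>2 / 2)"
  proof (intro sum.cong refl)
    fix x y assume xy: "x \<in> {..<M}" "y \<in> {..<M}"
    show "- ((g x - g y)\<^sup>2 * (kern x y * co x y) / 2) = (g x - g y)\<^sup>2 * (kern x y)\<^sup>2 / 2"
    proof (cases "x = y")
      case False
      then have "co x y = - kern x y" using sum1[of x y] xy by simp
      then show ?thesis by (simp add: power2_eq_square)
    qed simp
  qed
  finally show ?thesis by (simp add: sum_divide_distrib)
qed

lemma offdiag_mono:
  assumes "\<And>x y. x < M \<Longrightarrow> y < M \<Longrightarrow> \<bar>g x - g y\<bar> \<le> L * \<bar>h x - h y\<bar>"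
  shows "(\<Sum>j<n. \<Sum>i\<in>{n..<M}. mult_mat g j i * mult_mat g i j) \<le> L\<^sup>2 * (\<Sum>j<n. \<Sum>i\<in>{n..<M}. mult_mat h j i * mult_mat h i j)"
proof -
  have "(g x - g y)\<^sup>2 \<le> L\<^sup>2 * (h x - h y)\<^sup>2" if "x < M" "y < M" for x y
    using power_mono[OF assms[OF that], of 2] by (simp add: power_mult_distrib)
  then show ?thesis
    unfolding offdiag_eq_kernel
    by (auto simp: sum_distrib_left sum_divide_distrib mult.assoc[symmetric] intro!: sum_mono mult_right_mono divide_right_mono)
qed

end

section \<open>Toeplitz limits of multiplication matrices\<close>

definition cos_coeff :: "real \<Rightarrow> real \<Rightarrow> (real \<Rightarrow> real) \<Rightarrow> int \<Rightarrow> real" where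
  "cos_coeff a b f d = integral {0..2 * pi} (\<lambda>\<theta>. f (2 * a * cos \<theta> + b) * cos (real_of_int d * \<theta>)) / (2 * pi)"

lemma cos_coeff_integrable:
  assumes "continuous_on UNIV f"
  shows "(\<lambda>\<theta>. f (2 * a * cos \<theta> + b) * cos (r * \<theta>)) integrable_on {0..2 * pi}"
  by (intro integrable_continuous_real continuous_intros continuous_on_compose2[OF assms]) auto

lemma cos_coeff_add:
  assumes "continuous_on UNIV f" "continuous_on UNIV g"
  shows "cos_coeff a b (\<lambda>x. f x + g x) d = cos_coeff a b f d + cos_coeff a b g d"
  unfolding cos_coeff_def distrib_right
  by (subst integral_add) (auto intro!: cos_coeff_integrable assms simp: add_divide_distrib)

lemma cos_coeff_diff:
  assumes "continuous_on UNIV f" "continuous_on UNIV g"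
  shows "cos_coeff a b (\<lambda>x. f x - g x) d = cos_coeff a b f d - cos_coeff a b g d"
  unfolding cos_coeff_def left_diff_distrib
  by (subst integral_diff) (auto intro!: cos_coeff_integrable assms simp: diff_divide_distrib)

lemma cos_coeff_cong: "(\<And>x. f x = g x) \<Longrightarrow> cos_coeff a b f d = cos_coeff a b g d"
  by (simp add: cos_coeff_def)

lemma cos_coeff_uminus: "cos_coeff a b f (- d) = cos_coeff a b f d"
  by (simp add: cos_coeff_def)

lemma cos_coeff_const: "cos_coeff a b (\<lambda>_. c) d = (if d = 0 then c else 0)"
proof (cases "d = 0")
  case False
  have "((\<lambda>\<theta>. cos (real_of_int d * \<theta>)) has_integral
      (sin (real_of_int d * (2 * pi)) / d - sin (real_of_int d * 0) / d)) {0..2 * pi}"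
    using False
    by (intro fundamental_theorem_of_calculus)
       (auto intro!: derivative_eq_intros simp: has_real_derivative_iff_has_vector_derivative[symmetric])
  moreover have "sin (real_of_int d * (2 * pi)) = 0"
    by (metis mult.commute mult.left_commute of_int_mult of_int_numeral sin_int_2pin)
  ultimately have "((\<lambda>\<theta>. cos (real_of_int d * \<theta>)) has_integral 0) {0..2 * pi}"
    by simp
  then have "integral {0..2 * pi} (\<lambda>\<theta>. cos (real_of_int d * \<theta>)) = 0" by (rule integral_unique)
  then show ?thesis using False by (simp add: cos_coeff_def)
qed (simp add: cos_coeff_def)

text \<open>
  Multiplication by \<open>2 a cos \<theta> + b\<close> is the tridiagonal Toeplitz matrix with entries \<open>a\<close> and \<open>b\<close>.
\<close>

lemma cos_coeff_mult_id:
  assumes "continuous_on UNIV f"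
  shows "cos_coeff a b (\<lambda>x. x * f x) d = a * cos_coeff a b f (d - 1) + b * cos_coeff a b f d + a * cos_coeff a b f (d + 1)"
proof -
  let ?I = "\<lambda>e \<theta>. f (2 * a * cos \<theta> + b) * cos (real_of_int e * \<theta>)"
  have i: "?I e integrable_on {0..2 * pi}" for e
    using cos_coeff_integrable[OF assms, of a b "real_of_int e"] by simp
  have "integral {0..2 * pi} (\<lambda>\<theta>. (2 * a * cos \<theta> + b) * f (2 * a * cos \<theta> + b) * cos (real_of_int d * \<theta>))
      = integral {0..2 * pi} (\<lambda>\<theta>. (a * ?I (d - 1) \<theta> + b * ?I d \<theta>) + a * ?I (d + 1) \<theta>)"
  proof (rule arg_cong[where f = "integral {0..2 * pi}"], rule ext)
    fix \<theta>
    have "cos (real_of_int (d - 1) * \<theta>) + cos (real_of_int (d + 1) * \<theta>) = 2 * cos \<theta> * cos (real_of_int d * \<theta>)"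
      by (simp add: algebra_simps cos_add cos_diff)
    then have "a * f (2 * a * cos \<theta> + b) * (cos (real_of_int (d - 1) * \<theta>) + cos (real_of_int (d + 1) * \<theta>))
        = a * f (2 * a * cos \<theta> + b) * (2 * cos \<theta> * cos (real_of_int d * \<theta>))" by simp
    then show "(2 * a * cos \<theta> + b) * f (2 * a * cos \<theta> + b) * cos (real_of_int d * \<theta>)
        = (a * ?I (d - 1) \<theta> + b * ?I d \<theta>) + a * ?I (d + 1) \<theta>"
      by (simp only: distrib_left distrib_right mult_ac add_ac)
  qed
  also have "\<dots> = (a * integral {0..2 * pi} (?I (d - 1)) + b * integral {0..2 * pi} (?I d)) + a * integral {0..2 * pi} (?I (d + 1))"
    by (intro integral_unique has_integral_add has_integral_mult_right integrable_integral i)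
  finally show ?thesis unfolding cos_coeff_def by (simp add: add_divide_distrib)
qed

lemma integral_reflect_period:
  fixes g :: "real \<Rightarrow> real"
  shows "integral {0..c} (\<lambda>x. g (c - x)) = integral {0..c} g"
proof -
  have "integral {- c..- 0} (\<lambda>x. g (c - (- x))) = integral {0..c} (\<lambda>x. g (c - x))"
    by (rule Henstock_Kurzweil_Integration.integral_reflect_real)
  moreover have "integral {0 - c..c - c} (\<lambda>x. g (x + c)) = integral {0..c} g"
    by (rule integral_shift_real_ivl)
  ultimately show ?thesis by (simp add: add.commute)
qed

text \<open>
  The integrand is invariant under \<open>\<theta> \<mapsto> 2\<pi> - \<theta>\<close> up to the sign of the sine, so the sine part vanishes.
\<close>

lemma cmod_fourier_coeff:
  assumes "continuous_on UNIV f"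
  shows "cmod (fourier_coeff f a b l) = \<bar>cos_coeff a b f (int l)\<bar>"
proof -
  let ?F = "\<lambda>\<theta>. f (2 * a * cos \<theta> + b)"
  have contF: "continuous_on S ?F" for S
    by (intro continuous_intros continuous_on_compose2[OF assms]) auto
  have c: "(\<lambda>\<theta>. ?F \<theta> * cos (real l * \<theta>)) integrable_on {0..2 * pi}"
    by (rule cos_coeff_integrable[OF assms])
  have s: "(\<lambda>\<theta>. ?F \<theta> * sin (real l * \<theta>)) integrable_on {0..2 * pi}"
    by (intro integrable_continuous_real continuous_intros contF)
  have "integral {0..2 * pi} (\<lambda>\<theta>. ?F \<theta> * sin (real l * \<theta>)) = integral {0..2 * pi} (\<lambda>\<theta>. ?F (2 * pi - \<theta>) * sin (real l * (2 * pi - \<theta>)))"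
    by (rule integral_reflect_period[symmetric])
  also have "\<dots> = integral {0..2 * pi} (\<lambda>\<theta>. - (?F \<theta> * sin (real l * \<theta>)))"
  proof (rule arg_cong[where f = "integral {0..2 * pi}"], rule ext)
    fix \<theta>
    have "sin (real l * (2 * pi)) = 0" "cos (real l * (2 * pi)) = 1"
      using sin_int_2pin[of "int l"] cos_int_2pin[of "int l"] by (simp_all add: mult_ac)
    then have "sin (real l * (2 * pi - \<theta>)) = - sin (real l * \<theta>)"
      by (simp only: right_diff_distrib sin_diff; simp)
    then show "?F (2 * pi - \<theta>) * sin (real l * (2 * pi - \<theta>)) = - (?F \<theta> * sin (real l * \<theta>))" by simp
  qed
  also have "\<dots> = - integral {0..2 * pi} (\<lambda>\<theta>. ?F \<theta> * sin (real l * \<theta>))"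
    by (rule integral_neg)
  finally have sin0: "integral {0..2 * pi} (\<lambda>\<theta>. ?F \<theta> * sin (real l * \<theta>)) = 0" by simp
  have "((\<lambda>\<theta>. complex_of_real (?F \<theta> * cos (real l * \<theta>)) - \<i> * complex_of_real (?F \<theta> * sin (real l * \<theta>))) has_integral
      complex_of_real (integral {0..2 * pi} (\<lambda>\<theta>. ?F \<theta> * cos (real l * \<theta>)))
      - \<i> * complex_of_real (integral {0..2 * pi} (\<lambda>\<theta>. ?F \<theta> * sin (real l * \<theta>)))) {0..2 * pi}"
    by (intro has_integral_diff has_integral_mult_right has_integral_of_real integrable_integral c s)
  moreover have "complex_of_real (?F \<theta> * cos (real l * \<theta>)) - \<i> * complex_of_real (?F \<theta> * sin (real l * \<theta>))
     = complex_of_real (?F \<theta>) * exp (- \<i> * of_nat l * complex_of_real \<theta>)" for \<theta>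
  proof -
    have "exp (- \<i> * of_nat l * complex_of_real \<theta>) = cis (- (real l * \<theta>))"
      by (simp add: cis_conv_exp mult_ac)
    then show ?thesis by (simp add: complex_eq_iff)
  qed
  ultimately have "integral {0..2 * pi} (\<lambda>\<theta>. complex_of_real (?F \<theta>) * exp (- \<i> * of_nat l * complex_of_real \<theta>))
      = complex_of_real (integral {0..2 * pi} (\<lambda>\<theta>. ?F \<theta> * cos (real l * \<theta>)))"
    by (simp only: sin0 integral_unique) simp
  then have "fourier_coeff f a b l = complex_of_real (cos_coeff a b f (int l))"
    by (simp add: fourier_coeff_def cos_coeff_def)
  then show ?thesis by simp
qed

context orthonormal_system
begin

lemma mult_mat_mult:
  "mult_mat (\<lambda>x. g x * h x) i j = mat_prod M (mult_mat g) (mult_mat h) i j"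
proof -
  have "mat_prod M (mult_mat g) (mult_mat h) i j = (\<Sum>l<M. \<Sum>x<M. g x * P i x * (mult_mat h l j * P l x))"
    by (simp add: mat_prod_def mult_mat_def[of g] sum_distrib_right sum_distrib_left mult_ac)
  also have "\<dots> = (\<Sum>x<M. g x * P i x * (\<Sum>l<M. mult_mat h l j * P l x))"
    by (subst sum.swap) (simp add: sum_distrib_left)
  also have "\<dots> = (\<Sum>x<M. g x * P i x * (h x * P j x))"
    by (intro sum.cong refl) (simp add: mult_mat_expand)
  also have "\<dots> = mult_mat (\<lambda>x. g x * h x) i j"
    by (simp add: mult_mat_def mult_ac)
  finally show ?thesis by simp
qed

lemma mult_mat_add: "mult_mat (\<lambda>x. g x + h x) i j = mult_mat g i j + mult_mat h i j"
  by (simp add: mult_mat_def distrib_right sum.distrib)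

lemma mult_mat_const: "mult_mat (\<lambda>_. c) i j = (if i = j \<and> i < M then c else 0)"
proof -
  have "(\<Sum>x<M. P i x * P j x) = (if i = j \<and> i < M then 1 else 0)"
    by (cases "i < M"; cases "j < M") (auto simp: orthonormal P_zero)
  then show ?thesis
    by (simp add: mult_mat_def sum_distrib_left[symmetric] mult.assoc)
qed

end

lemma banded_add: "banded d A \<Longrightarrow> banded d B \<Longrightarrow> banded d (\<lambda>i j. A i j + B i j)"
  unfolding banded_def
proof (intro allI impI)
  fix i j
  assume A: "\<forall>i j. A i j \<noteq> 0 \<longrightarrow> i \<le> j + d \<and> j \<le> i + d" and B: "\<forall>i j. B i j \<noteq> 0 \<longrightarrow> i \<le> j + d \<and> j \<le> i + d"
    and "A i j + B i j \<noteq> 0"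
  then have "A i j \<noteq> 0 \<or> B i j \<noteq> 0" by auto
  then show "i \<le> j + d \<and> j \<le> i + d" using A B by blast
qed

lemma window_lim_add: "window_lim A L \<Longrightarrow> window_lim B L' \<Longrightarrow> window_lim (\<lambda>n i j. A n i j + B n i j) (\<lambda>i j. L i j + L' i j)"
  by (auto simp: window_lim_def intro: tendsto_add)

text \<open>
  Completeness turns multiplication of functions into multiplication of matrices, so a polynomial of
  the node is the same polynomial of the tridiagonal matrix; window limits are compatible with products
  by a banded matrix, and the limits obey the recursion of the cosine coefficients.
\<close>

lemma poly_mult_mat_limit:
  fixes a b :: real and g :: "real poly" and u :: "nat \<Rightarrow> nat \<Rightarrow> real"
  assumes os: "\<And>n. orthonormal_system (M n) n (P n)"
    and M: "filterlim (\<lambda>n. M n - n) at_top sequentially"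
    and band: "\<And>n. banded 1 (orthonormal_system.mult_mat (M n) (P n) (u n))"
    and J: "window_lim (\<lambda>n. orthonormal_system.mult_mat (M n) (P n) (u n))
              (\<lambda>i j. if i = j then b else if \<bar>i - j\<bar> = 1 then a else 0)"
  shows "(\<exists>d. \<forall>n. banded d (orthonormal_system.mult_mat (M n) (P n) (\<lambda>x. poly g (u n x)))) \<and>
     window_lim (\<lambda>n. orthonormal_system.mult_mat (M n) (P n) (\<lambda>x. poly g (u n x))) (\<lambda>i j. cos_coeff a b (poly g) (i - j))"
proof (induction g)
  case 0
  have z: "orthonormal_system.mult_mat (M n) (P n) (\<lambda>x. poly 0 (u n x)) = (\<lambda>_ _. 0)" for n
    by (simp add: orthonormal_system.mult_mat_def[OF os] fun_eq_iff)
  have c: "cos_coeff a b (poly 0) d = 0" for d by (simp add: cos_coeff_def)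
  show ?case unfolding z c by (simp add: banded_def window_lim_def)
next
  case (pCons c g)
  let ?G = "\<lambda>n. orthonormal_system.mult_mat (M n) (P n)"
  obtain d where d: "\<And>n. banded d (?G n (\<lambda>x. poly g (u n x)))" using pCons.IH by auto
  have G: "window_lim (\<lambda>n. ?G n (\<lambda>x. poly g (u n x))) (\<lambda>i j. cos_coeff a b (poly g) (i - j))" using pCons.IH by auto
  have eq: "?G n (\<lambda>x. poly (pCons c g) (u n x))
      = (\<lambda>i j. (if i = j \<and> i < M n then c else 0) + mat_prod (M n) (?G n (u n)) (?G n (\<lambda>x. poly g (u n x))) i j)" for n
  proof (intro ext)
    fix i j
    have "?G n (\<lambda>x. poly (pCons c g) (u n x)) i j = ?G n (\<lambda>x. c + u n x * poly g (u n x)) i j" by simp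
    also have "\<dots> = ?G n (\<lambda>_. c) i j + ?G n (\<lambda>x. u n x * poly g (u n x)) i j"
      by (rule orthonormal_system.mult_mat_add[OF os])
    finally show "?G n (\<lambda>x. poly (pCons c g) (u n x)) i j
        = (if i = j \<and> i < M n then c else 0) + mat_prod (M n) (?G n (u n)) (?G n (\<lambda>x. poly g (u n x))) i j"
      by (simp only: orthonormal_system.mult_mat_const[OF os] orthonormal_system.mult_mat_mult[OF os])
  qed
  have band': "banded (1 + d) (?G n (\<lambda>x. poly (pCons c g) (u n x)))" for n
    unfolding eq
    by (intro banded_add banded_mat_prod band d) (auto simp: banded_def)
  have const: "window_lim (\<lambda>n i j. if i = j \<and> i < M n then c else 0) (\<lambda>i j. if i = j then c else 0)"
    unfolding window_lim_def
  proof (intro allI)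
    fix i j :: int
    have "\<forall>\<^sub>F n in sequentially. nat \<bar>i\<bar> + 1 \<le> M n - n"
      using M by (simp add: filterlim_at_top)
    then have "\<forall>\<^sub>F n in sequentially. (if nat (int n + i) = nat (int n + j) \<and> nat (int n + i) < M n then c else 0)
        = (if i = j then c else 0)"
      using eventually_ge_at_top[of "nat (\<bar>i\<bar> + \<bar>j\<bar>)"] by eventually_elim auto
    then show "(\<lambda>n. if nat (int n + i) = nat (int n + j) \<and> nat (int n + i) < M n then c else 0)
        \<longlonglongrightarrow> (if i = j then c else 0)" by (rule tendsto_eventually)
  qed
  have prod: "window_lim (\<lambda>n. mat_prod (M n) (?G n (u n)) (?G n (\<lambda>x. poly g (u n x))))
     (\<lambda>i j. \<Sum>m\<in>{i - int 1..i + int 1}. (if i = m then b else if \<bar>i - m\<bar> = 1 then a else 0) * cos_coeff a b (poly g) (m - j))"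
    by (rule window_lim_mat_prod[OF J G band M])
  have lim: "(if i = j then c else 0)
      + (\<Sum>m\<in>{i - int 1..i + int 1}. (if i = m then b else if \<bar>i - m\<bar> = 1 then a else 0) * cos_coeff a b (poly g) (m - j))
      = cos_coeff a b (poly (pCons c g)) (i - j)" for i j
  proof -
    have "{i - int 1..i + int 1} = {i - 1, i, i + 1}" by auto
    then have "(\<Sum>m\<in>{i - int 1..i + int 1}. (if i = m then b else if \<bar>i - m\<bar> = 1 then a else 0) * cos_coeff a b (poly g) (m - j))
        = a * cos_coeff a b (poly g) (i - j - 1) + b * cos_coeff a b (poly g) (i - j) + a * cos_coeff a b (poly g) (i - j + 1)"
      by (simp add: algebra_simps)
    also have "\<dots> = cos_coeff a b (\<lambda>x. x * poly g x) (i - j)"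
      by (rule cos_coeff_mult_id[symmetric]) (intro continuous_intros)
    finally have "(\<Sum>m\<in>{i - int 1..i + int 1}. (if i = m then b else if \<bar>i - m\<bar> = 1 then a else 0) * cos_coeff a b (poly g) (m - j))
        = cos_coeff a b (\<lambda>x. x * poly g x) (i - j)" .
    moreover have "cos_coeff a b (poly (pCons c g)) (i - j) = cos_coeff a b (\<lambda>_. c) (i - j) + cos_coeff a b (\<lambda>x. x * poly g x) (i - j)"
      by (subst cos_coeff_add[symmetric]) (auto intro!: continuous_intros cos_coeff_cong)
    ultimately show ?thesis by (simp add: cos_coeff_const)
  qed
  have "window_lim (\<lambda>n. ?G n (\<lambda>x. poly (pCons c g) (u n x))) (\<lambda>i j. cos_coeff a b (poly (pCons c g)) (i - j))"
    unfolding eq lim[symmetric] by (rule window_lim_add[OF const prod])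
  with band' show ?case by blast
qed

section \<open>The q-Krawtchouk polynomials\<close>

lemma power_inj_base:
  fixes t :: real
  assumes "0 < t" "t \<noteq> 1" "t ^ i = t ^ j"
  shows "i = j"
proof -
  have "ln (t ^ i) = ln (t ^ j)" by (simp only: assms(3))
  then have "real i * ln t = real j * ln t" by (simp only: ln_realpow)
  moreover have "ln t \<noteq> 0" using assms(1,2) by simp
  ultimately show ?thesis by simp
qed

lemma birth_death_identity:
  fixes u z :: real
  assumes "0 < u" "0 < z"
  shows "(1 - K / u) * (z * (u * v) - u * v) - p * (1 - 1 / u) * (u * v / z - u * v)
    = (z - p / z - (1 - p)) * (u * v) + - (z - 1) * (K + p / z) * v"
  using assms by (simp add: field_simps)

text \<open>
  The weight \<open>w\<close> of the \<open>q\<close>-Krawtchouk polynomials in the base \<open>1 / t\<close>, given through the property that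
  makes their difference operator symmetric.
\<close>

locale q_krawtchouk =
  fixes t p :: real and N :: nat and w :: "nat \<Rightarrow> real"
  assumes t_pos: "0 < t" and t_ne_1: "t \<noteq> 1" and p_pos: "0 < p"
    and w_pos: "\<And>x. x \<le> N \<Longrightarrow> 0 < w x"
    and detailed_balance: "\<And>x. x < N \<Longrightarrow> w x * (1 - t ^ (N - x)) = w (Suc x) * (- p * (1 - 1 / t ^ Suc x))"
begin

definition eigval :: "nat \<Rightarrow> real" where "eigval m = t ^ m - p / t ^ m"
text \<open>
  With \<open>eigval\<close>, the two coefficients of the difference operator on monomials: it sends \<open>u\<^sup>m\<close> to
  \<open>(eigval m - eigval 0) u\<^sup>m + lower_coeff m u\<^sup>m\<^sup>-\<^sup>1\<close>. The coefficients of its monic eigenvectors follow.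
\<close>

definition lower_coeff :: "nat \<Rightarrow> real" where "lower_coeff m = - (t ^ m - 1) * (t ^ N + p / t ^ m)"
definition kr_coeff :: "nat \<Rightarrow> nat \<Rightarrow> real" where
  "kr_coeff j m = (if m \<le> j then \<Prod>s\<in>{m<..j}. lower_coeff s / (eigval j - eigval (s - 1)) else 0)"
definition kr_poly :: "nat \<Rightarrow> real poly" where "kr_poly j = (\<Sum>m\<le>j. monom (kr_coeff j m) m)"
definition ip :: "real poly \<Rightarrow> real poly \<Rightarrow> real" where
  "ip f g = (\<Sum>x\<le>N. w x * poly f (t ^ x) * poly g (t ^ x))"
definition birth :: "nat \<Rightarrow> real" where "birth x = 1 - t ^ (N - x)"
definition death :: "nat \<Rightarrow> real" where "death x = - p * (1 - 1 / t ^ x)"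
definition diff_op :: "(nat \<Rightarrow> real) \<Rightarrow> nat \<Rightarrow> real" where
  "diff_op y x = birth x * (y (Suc x) - y x) + death x * (y (x - 1) - y x)"

lemma t_ne_0: "t \<noteq> 0" using t_pos by simp

lemma eigval_diff: "eigval j - eigval i = (t ^ j - t ^ i) * (1 + p / t ^ (i + j))"
  using t_ne_0 by (simp add: eigval_def field_simps power_add)

lemma eigval_inj: "eigval j = eigval i \<longleftrightarrow> j = i"
proof
  assume "eigval j = eigval i"
  then have "(t ^ j - t ^ i) * (1 + p / t ^ (i + j)) = 0" using eigval_diff[of j i] by simp
  moreover have "0 < 1 + p / t ^ (i + j)" using t_pos p_pos by (simp add: add_pos_pos)
  ultimately have "t ^ j = t ^ i" by simp
  then show "j = i" using power_inj_base[OF t_pos t_ne_1] by simp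
qed simp

lemma kr_coeff_diag: "kr_coeff j j = 1" by (simp add: kr_coeff_def)

lemma kr_coeff_zero: "j < m \<Longrightarrow> kr_coeff j m = 0" by (simp add: kr_coeff_def)

lemma kr_coeff_step: "m < j \<Longrightarrow> kr_coeff j m * (eigval j - eigval m) = kr_coeff j (Suc m) * lower_coeff (Suc m)"
proof -
  assume m: "m < j"
  then have "{m<..j} = insert (Suc m) {Suc m<..j}" by auto
  then have "kr_coeff j m = lower_coeff (Suc m) / (eigval j - eigval m) * kr_coeff j (Suc m)" using m by (simp add: kr_coeff_def)
  then show ?thesis using m eigval_inj[of j m] by simp
qed

lemma coeff_kr_poly: "coeff (kr_poly j) m = kr_coeff j m"
  by (simp add: kr_poly_def coeff_sum kr_coeff_def)

lemma poly_kr_poly: "poly (kr_poly j) u = (\<Sum>m\<le>j. kr_coeff j m * u ^ m)"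
  by (simp add: kr_poly_def poly_sum poly_monom)

text \<open>
  At the ends of the interval the operator would look at missing sites, but there \<open>birth\<close> and \<open>death\<close>
  vanish.
\<close>

lemma diff_op_power:
  assumes "x \<le> N"
  shows "diff_op (\<lambda>x. (t ^ x) ^ m) x = (eigval m - eigval 0) * (t ^ x) ^ m + lower_coeff m * (t ^ x) ^ (m - 1)"
proof (cases "m = 0")
  case False
  then obtain l where m: "m = Suc l" by (cases m) auto
  define u where "u = t ^ x"
  have u: "0 < u" using t_pos by (simp add: u_def)
  have tm: "0 < t ^ m" using t_pos by simp
  have b: "birth x = 1 - t ^ N / u"
    using assms t_ne_0 by (simp add: birth_def u_def power_diff)
  have s: "(t ^ Suc x) ^ m = t ^ m * u ^ m" by (simp add: u_def power_mult_distrib)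
  have d: "death x * ((t ^ (x - 1)) ^ m - (t ^ x) ^ m) = - p * (1 - 1 / u) * (u ^ m / t ^ m - u ^ m)"
  proof (cases x)
    case 0 then show ?thesis by (simp add: death_def u_def)
  next
    case (Suc y)
    have e: "(t ^ (x - 1)) ^ m * t ^ m = u ^ m"
      by (simp add: Suc u_def power_mult_distrib[symmetric] mult.commute)
    from e have "(t ^ (x - 1)) ^ m = u ^ m / t ^ m" by (rule eq_divide_imp[OF less_imp_neq[OF tm, symmetric]])
    then show ?thesis by (simp add: death_def u_def)
  qed
  have "diff_op (\<lambda>x. (t ^ x) ^ m) x = (1 - t ^ N / u) * (t ^ m * u ^ m - u ^ m) - p * (1 - 1 / u) * (u ^ m / t ^ m - u ^ m)"
    unfolding diff_op_def d b s by (simp add: u_def)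
  also have "\<dots> = (eigval m - eigval 0) * u ^ m + lower_coeff m * u ^ (m - 1)"
    using birth_death_identity[OF u tm, of "t ^ N" "u ^ l" p] by (simp add: eigval_def lower_coeff_def m)
  finally show ?thesis by (simp add: u_def)
qed (simp add: diff_op_def lower_coeff_def)

lemma diff_op_sum: "diff_op (\<lambda>x. \<Sum>m\<in>S. c m * y m x) x = (\<Sum>m\<in>S. c m * diff_op (y m) x)"
  by (simp add: diff_op_def sum_subtractf[symmetric] sum_distrib_left sum.distrib[symmetric] algebra_simps)

lemma diff_op_kr_poly:
  assumes "x \<le> N"
  shows "diff_op (\<lambda>x. poly (kr_poly j) (t ^ x)) x = (eigval j - eigval 0) * poly (kr_poly j) (t ^ x)"
proof -
  define u where "u = t ^ x"
  have "diff_op (\<lambda>x. poly (kr_poly j) (t ^ x)) x = (\<Sum>m\<le>j. kr_coeff j m * ((eigval m - eigval 0) * u ^ m + lower_coeff m * u ^ (m - 1)))"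
    unfolding poly_kr_poly diff_op_sum u_def using diff_op_power[OF assms] by simp
  also have "\<dots> = (\<Sum>m\<le>j. kr_coeff j m * (eigval m - eigval 0) * u ^ m) + (\<Sum>m\<le>j. kr_coeff j m * lower_coeff m * u ^ (m - 1))"
    unfolding sum.distrib[symmetric] by (intro sum.cong refl) (simp only: distrib_left mult.assoc)
  also have "(\<Sum>m\<le>j. kr_coeff j m * lower_coeff m * u ^ (m - 1)) = (\<Sum>m<j. kr_coeff j (Suc m) * lower_coeff (Suc m) * u ^ m)"
    by (cases j) (simp_all add: lower_coeff_def lessThan_Suc_atMost[symmetric] sum.lessThan_Suc_shift del: sum.lessThan_Suc)
  also have "\<dots> = (\<Sum>m<j. kr_coeff j m * (eigval j - eigval m) * u ^ m)"
    by (intro sum.cong refl) (simp add: kr_coeff_step)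
  also have "\<dots> = (\<Sum>m\<le>j. kr_coeff j m * (eigval j - eigval m) * u ^ m)"
    by (simp add: lessThan_Suc_atMost[symmetric])
  also have "(\<Sum>m\<le>j. kr_coeff j m * (eigval m - eigval 0) * u ^ m) + \<dots> = (eigval j - eigval 0) * (\<Sum>m\<le>j. kr_coeff j m * u ^ m)"
    by (simp add: sum.distrib[symmetric] sum_distrib_left algebra_simps)
  finally show ?thesis by (simp add: poly_kr_poly u_def)
qed

text \<open>
  Detailed balance turns the form into a discrete Dirichlet form.
\<close>

lemma diff_op_symmetric: "(\<Sum>x\<le>N. w x * diff_op f x * g x) = (\<Sum>x\<le>N. w x * f x * diff_op g x)"
proof -
  have form: "(\<Sum>x\<le>N. w x * diff_op f x * g x)
      = - (\<Sum>x<N. w x * birth x * (f (Suc x) - f x) * (g (Suc x) - g x))" for f g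
  proof -
    have "(\<Sum>x\<le>N. w x * diff_op f x * g x)
        = (\<Sum>x\<le>N. w x * birth x * (f (Suc x) - f x) * g x) + (\<Sum>x\<le>N. w x * death x * (f (x - 1) - f x) * g x)"
      by (simp add: diff_op_def algebra_simps sum.distrib sum_subtractf)
    also have "(\<Sum>x\<le>N. w x * birth x * (f (Suc x) - f x) * g x) = (\<Sum>x<N. w x * birth x * (f (Suc x) - f x) * g x)"
      by (simp add: lessThan_Suc_atMost[symmetric] birth_def)
    also have "(\<Sum>x\<le>N. w x * death x * (f (x - 1) - f x) * g x)
        = (\<Sum>x<N. w (Suc x) * death (Suc x) * (f x - f (Suc x)) * g (Suc x))"
      by (cases N) (simp_all add: death_def lessThan_Suc_atMost[symmetric] sum.lessThan_Suc_shift del: sum.lessThan_Suc)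
    also have "\<dots> = (\<Sum>x<N. w x * birth x * (f x - f (Suc x)) * g (Suc x))"
      using detailed_balance by (intro sum.cong refl) (simp add: birth_def death_def)
    finally show ?thesis by (simp add: sum.distrib[symmetric] sum_negf[symmetric] algebra_simps)
  qed
  have "(\<Sum>x\<le>N. w x * f x * diff_op g x) = (\<Sum>x\<le>N. w x * diff_op g x * f x)" by (simp add: mult_ac)
  then show ?thesis
    unfolding form by (simp only: form) (simp only: mult_ac)
qed

lemma ip_commute: "ip f g = ip g f" by (simp add: ip_def mult_ac)
lemma ip_add: "ip (f + g) h = ip f h + ip g h" by (simp add: ip_def algebra_simps sum.distrib)
lemma ip_smult: "ip (Polynomial.smult c f) h = c * ip f h" by (simp add: ip_def sum_distrib_left mult_ac)
lemma ip_X: "ip (pCons 0 f) g = ip f (pCons 0 g)" by (simp add: ip_def mult_ac)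

lemma kr_poly_orthogonal:
  assumes "i \<noteq> j"
  shows "ip (kr_poly i) (kr_poly j) = 0"
proof -
  let ?v = "\<lambda>j x. poly (kr_poly j) (t ^ x)"
  have "(eigval i - eigval 0) * ip (kr_poly i) (kr_poly j) = (\<Sum>x\<le>N. w x * diff_op (?v i) x * ?v j x)"
    unfolding ip_def sum_distrib_left by (intro sum.cong refl) (simp add: diff_op_kr_poly mult_ac)
  also have "\<dots> = (\<Sum>x\<le>N. w x * ?v i x * diff_op (?v j) x)" by (rule diff_op_symmetric)
  also have "\<dots> = (eigval j - eigval 0) * ip (kr_poly i) (kr_poly j)"
    unfolding ip_def sum_distrib_left by (intro sum.cong refl) (simp add: diff_op_kr_poly mult_ac)
  finally have "(eigval i - eigval j) * ip (kr_poly i) (kr_poly j) = 0" by (simp add: algebra_simps)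
  then show ?thesis using assms eigval_inj by simp
qed

text \<open>
  Every polynomial of degree below \<open>d\<close> is a combination of the first \<open>d\<close> eigenvectors.
\<close>

lemma low_orthogonal:
  "\<forall>m\<ge>d. coeff f m = 0 \<Longrightarrow> d \<le> j \<Longrightarrow> ip f (kr_poly j) = 0"
proof (induction d arbitrary: f)
  case 0
  then have "f = 0" by (simp add: poly_eq_iff)
  then show ?case by (simp add: ip_def)
next
  case (Suc d)
  define g where "g = f - Polynomial.smult (coeff f d) (kr_poly d)"
  have "coeff g m = 0" if "d \<le> m" for m
    using that Suc.prems(1) by (cases "m = d") (auto simp: g_def coeff_kr_poly kr_coeff_diag kr_coeff_zero)
  then have "ip g (kr_poly j) = 0" using Suc by simp
  moreover have "f = g + Polynomial.smult (coeff f d) (kr_poly d)" by (simp add: g_def)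
  ultimately show ?case using kr_poly_orthogonal[of d j] Suc.prems(2)
    by (metis Suc_n_not_le_n add.right_neutral ip_add ip_smult mult_zero_right)
qed

text \<open>
  A polynomial of degree at most \<open>N\<close> cannot vanish at all \<open>N + 1\<close> nodes.
\<close>

lemma kr_poly_norm_pos:
  assumes "j \<le> N"
  shows "0 < ip (kr_poly j) (kr_poly j)"
proof -
  have sq: "w x * poly (kr_poly j) (t ^ x) * poly (kr_poly j) (t ^ x) \<ge> 0" if "x \<le> N" for x
    using w_pos[OF that] by (simp add: mult.assoc)
  have "\<exists>x\<le>N. poly (kr_poly j) (t ^ x) \<noteq> 0"
  proof (rule ccontr)
    assume "\<not> ?thesis"
    then have sub: "(\<lambda>x. t ^ x) ` {..N} \<subseteq> {u. poly (kr_poly j) u = 0}" by auto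
    have nz: "kr_poly j \<noteq> 0" using coeff_kr_poly[of j j] kr_coeff_diag[of j] by auto
    have "inj_on (\<lambda>x. t ^ x) {..N}"
      by (intro inj_onI power_inj_base[OF t_pos t_ne_1])
    then have "Suc N = card ((\<lambda>x. t ^ x) ` {..N})" by (simp add: card_image)
    also have "\<dots> \<le> card {u. poly (kr_poly j) u = 0}" using sub poly_roots_finite[OF nz] by (intro card_mono)
    also have "\<dots> \<le> degree (kr_poly j)" by (rule card_poly_roots_bound[OF nz])
    also have "\<dots> \<le> j" by (intro degree_le) (simp add: coeff_kr_poly kr_coeff_def)
    finally show False using assms by simp
  qed
  then obtain x where x: "x \<le> N" "poly (kr_poly j) (t ^ x) \<noteq> 0" by auto
  then have "0 < (poly (kr_poly j) (t ^ x))\<^sup>2" by simp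
  then have "0 < w x * poly (kr_poly j) (t ^ x) * poly (kr_poly j) (t ^ x)"
    using mult_pos_pos[OF w_pos[OF x(1)]] by (simp add: power2_eq_square mult.assoc)
  then show ?thesis unfolding ip_def using x sq by (intro sum_pos2[of _ x]) auto
qed

definition diag_coeff :: "nat \<Rightarrow> real" where "diag_coeff j = kr_coeff j (j - 1) - kr_coeff (Suc j) j"
text \<open>
  The recurrence coefficients \<open>diag_coeff j\<close> and \<open>offdiag_sq j\<close> are read off from the three leading
  coefficients of the polynomials: with them, \<open>u p\<^sub>j - p\<^sub>j\<^sub>+\<^sub>1 - diag_coeff j p\<^sub>j - offdiag_sq j p\<^sub>j\<^sub>-\<^sub>1\<close> has degree
  below \<open>j - 1\<close>.
\<close>

definition offdiag_sq :: "nat \<Rightarrow> real" where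
  "offdiag_sq j = kr_coeff j (j - 2) - kr_coeff (Suc j) (j - 1) - diag_coeff j * kr_coeff j (j - 1)"

lemma ip_X_far: "j + 1 < i \<Longrightarrow> ip (pCons 0 (kr_poly j)) (kr_poly i) = 0"
  by (rule low_orthogonal[of "j + 2"]) (auto simp: coeff_pCons coeff_kr_poly kr_coeff_zero split: nat.split)

lemma ip_X_succ: "ip (pCons 0 (kr_poly j)) (kr_poly (Suc j)) = ip (kr_poly (Suc j)) (kr_poly (Suc j))"
proof -
  define g where "g = pCons 0 (kr_poly j) - kr_poly (Suc j)"
  have "coeff g m = 0" if m: "Suc j \<le> m" for m
  proof -
    obtain l where "m = Suc l" "j \<le> l" using m by (cases m) auto
    then show ?thesis by (cases "l = j") (auto simp: g_def coeff_kr_poly kr_coeff_diag kr_coeff_zero)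
  qed
  then have "ip g (kr_poly (Suc j)) = 0" by (intro low_orthogonal[of "Suc j"]) auto
  moreover have "pCons 0 (kr_poly j) = g + kr_poly (Suc j)" by (simp add: g_def)
  ultimately show ?thesis by (simp only: ip_add add_0_left)
qed

lemma ip_X_self:
  assumes "1 \<le> j"
  shows "ip (pCons 0 (kr_poly j)) (kr_poly j) = diag_coeff j * ip (kr_poly j) (kr_poly j)"
proof -
  define g where "g = pCons 0 (kr_poly j) - kr_poly (Suc j) - Polynomial.smult (diag_coeff j) (kr_poly j)"
  have "coeff g m = 0" if m: "j \<le> m" for m
  proof -
    obtain l where l: "m = Suc l" "j \<le> Suc l" using m assms by (cases m) auto
    then consider "j = Suc l" | "j = l" | "j < l" by linarith
    then show ?thesis
      by cases (auto simp: l(1) g_def diag_coeff_def coeff_kr_poly kr_coeff_diag kr_coeff_zero)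
  qed
  then have "ip g (kr_poly j) = 0" by (intro low_orthogonal[of j]) auto
  moreover have "pCons 0 (kr_poly j) = g + (kr_poly (Suc j) + Polynomial.smult (diag_coeff j) (kr_poly j))" by (simp add: g_def)
  ultimately show ?thesis using kr_poly_orthogonal[of "Suc j" j] by (simp only: ip_add ip_smult; simp)
qed

text \<open>
  Pairing the three-term relation with the preceding polynomial, and moving the factor \<open>u\<close> to the other
  side.
\<close>

lemma norm_ratio:
  assumes "2 \<le> j"
  shows "ip (kr_poly j) (kr_poly j) = offdiag_sq j * ip (kr_poly (j - 1)) (kr_poly (j - 1))"
proof -
  have "j = Suc (Suc (j - 2))" using assms by simp
  then obtain l where j: "j = Suc (Suc l)" by blast
  define g where "g = pCons 0 (kr_poly j) - kr_poly (Suc j) - Polynomial.smult (diag_coeff j) (kr_poly j) - Polynomial.smult (offdiag_sq j) (kr_poly (j - 1))"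
  have "coeff g m = 0" if m: "j - 1 \<le> m" for m
  proof -
    obtain l' where l': "m = Suc l'" "l \<le> l'" using m j by (cases m) auto
    then consider "l' = l" | "l' = Suc l" | "l' = Suc (Suc l)" | "Suc (Suc l) < l'" by linarith
    then show ?thesis
      by cases (auto simp: j l'(1) g_def diag_coeff_def offdiag_sq_def coeff_kr_poly kr_coeff_diag kr_coeff_zero numeral_2_eq_2)
  qed
  then have "ip g (kr_poly (j - 1)) = 0" by (intro low_orthogonal[of "j - 1"]) auto
  moreover have "pCons 0 (kr_poly j) = g + (kr_poly (Suc j) + (Polynomial.smult (diag_coeff j) (kr_poly j) + Polynomial.smult (offdiag_sq j) (kr_poly (j - 1))))"
    by (simp add: g_def)
  ultimately have "ip (pCons 0 (kr_poly j)) (kr_poly (j - 1)) = offdiag_sq j * ip (kr_poly (j - 1)) (kr_poly (j - 1))"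
    using kr_poly_orthogonal[of "Suc j" "j - 1"] kr_poly_orthogonal[of j "j - 1"] j by (simp only: ip_add ip_smult; simp)
  moreover have "ip (pCons 0 (kr_poly j)) (kr_poly (j - 1)) = ip (kr_poly j) (kr_poly j)"
    using ip_X_succ[of "j - 1"] ip_X[of "kr_poly j" "kr_poly (j - 1)"] ip_commute[of "kr_poly j" "pCons 0 (kr_poly (j - 1))"] j
    by (simp del: mult_pCons_left)
  ultimately show ?thesis by simp
qed

lemma clear_denominators:
  fixes z T c X Y :: real
  assumes "c * (X / (z ^ k * T)) = Y / (z ^ l * T)" "0 < z" "0 < T"
  shows "c * X * z ^ l = z ^ k * Y"
  using assms by (simp add: field_simps)

lemma kr_coeff_prev: "1 \<le> j \<Longrightarrow> kr_coeff j (j - 1) = - t * (t ^ j - 1) * (t ^ N * t ^ j + p) / ((t - 1) * ((t ^ j)\<^sup>2 + p * t))"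
proof -
  assume j: "1 \<le> j"
  define T where "T = t ^ j"
  have T: "0 < T" using t_pos by (simp add: T_def)
  have Tm: "t ^ (j - 1) = T / t" using j t_ne_0 by (simp add: T_def power_diff)
  have den: "0 < T\<^sup>2 + p * t" using T p_pos t_pos by (simp add: add_pos_pos)
  have "kr_coeff j (j - 1) * (eigval j - eigval (j - 1)) = lower_coeff j"
    using kr_coeff_step[of "j - 1" j] j by (simp add: kr_coeff_diag)
  moreover have e: "eigval j - eigval (j - 1) = (t - 1) * (T\<^sup>2 + p * t) / (t ^ 1 * T)"
    unfolding eigval_def Tm T_def[symmetric] using T t_pos by (simp add: field_simps power2_eq_square)
  moreover have "lower_coeff j = - (T - 1) * (t ^ N * T + p) / (t ^ 0 * T)"
    unfolding lower_coeff_def T_def[symmetric] using T by (simp add: field_simps)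
  ultimately have "kr_coeff j (j - 1) * ((t - 1) * (T\<^sup>2 + p * t) / (t ^ 1 * T)) = - (T - 1) * (t ^ N * T + p) / (t ^ 0 * T)"
    by (simp only:)
  from clear_denominators[OF this t_pos T]
  have "kr_coeff j (j - 1) * ((t - 1) * (T\<^sup>2 + p * t)) = - t * (T - 1) * (t ^ N * T + p)"
    by (simp only: power_0 power_one_right mult_1_right mult_minus_left mult_minus_right mult.assoc)
  then have "kr_coeff j (j - 1) = - t * (T - 1) * (t ^ N * T + p) / ((t - 1) * (T\<^sup>2 + p * t))"
    using den t_ne_1 by (intro eq_divide_imp) auto
  then show ?thesis by (simp add: T_def)
qed

lemma kr_coeff_prev2: "2 \<le> j \<Longrightarrow> kr_coeff j (j - 2) = kr_coeff j (j - 1) * (- t * (t ^ j - t) * (t ^ N * t ^ j + p * t)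
     / ((t\<^sup>2 - 1) * ((t ^ j)\<^sup>2 + p * t\<^sup>2)))"
proof -
  assume j: "2 \<le> j"
  define T where "T = t ^ j"
  have T: "0 < T" using t_pos by (simp add: T_def)
  have Tm: "t ^ (j - 1) = T / t" "t ^ (j - 2) = T / t\<^sup>2" using j t_ne_0 by (simp_all add: T_def power_diff)
  have den: "0 < T\<^sup>2 + p * t\<^sup>2" using T p_pos t_pos by (simp add: add_pos_pos)
  have t2: "t\<^sup>2 - 1 \<noteq> 0" using t_pos t_ne_1 by (simp add: power2_eq_1_iff)
  have "Suc (j - 2) = j - 1" using j by simp
  then have "kr_coeff j (j - 2) * (eigval j - eigval (j - 2)) = kr_coeff j (j - 1) * lower_coeff (j - 1)"
    using kr_coeff_step[of "j - 2" j] j by simp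
  moreover have "eigval j - eigval (j - 2) = (t\<^sup>2 - 1) * (T\<^sup>2 + p * t\<^sup>2) / (t ^ 2 * T)"
    unfolding eigval_def Tm T_def[symmetric] using T t_pos by (simp add: field_simps power2_eq_square)
  moreover have "lower_coeff (j - 1) = - (T - t) * (t ^ N * T + p * t) / (t ^ 1 * T)"
    unfolding lower_coeff_def Tm T_def[symmetric] using T t_pos by (simp add: field_simps)
  ultimately have "kr_coeff j (j - 2) * ((t\<^sup>2 - 1) * (T\<^sup>2 + p * t\<^sup>2) / (t ^ 2 * T))
      = kr_coeff j (j - 1) * (- (T - t) * (t ^ N * T + p * t)) / (t ^ 1 * T)"
    by (simp only: times_divide_eq_right)
  from clear_denominators[OF this t_pos T]
  have "t * (kr_coeff j (j - 2) * ((t\<^sup>2 - 1) * (T\<^sup>2 + p * t\<^sup>2))) = t * (kr_coeff j (j - 1) * (- t * (T - t) * (t ^ N * T + p * t)))"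
    by (simp only: power_one_right power2_eq_square mult_minus_left mult_minus_right mult_ac)
  then have "kr_coeff j (j - 2) * ((t\<^sup>2 - 1) * (T\<^sup>2 + p * t\<^sup>2)) = kr_coeff j (j - 1) * (- t * (T - t) * (t ^ N * T + p * t))"
    by (rule mult_left_cancel[OF t_ne_0, THEN iffD1])
  then have "kr_coeff j (j - 2) = kr_coeff j (j - 1) * (- t * (T - t) * (t ^ N * T + p * t)) / ((t\<^sup>2 - 1) * (T\<^sup>2 + p * t\<^sup>2))"
    using den t2 by (intro eq_divide_imp) auto
  then show ?thesis by (simp add: T_def)
qed

end

text \<open>
  The differences that define the recurrence coefficients have denominators \<open>t - 1\<close>, which tends to
  zero. This identity and the next one cancel them; \<open>T\<close> stands for \<open>t\<^sup>j\<close> and \<open>M\<close> for \<open>t\<^sup>N\<close>.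
\<close>

lemma beta_identity:
  fixes T t p M :: real
  assumes "0 < T" "0 < t" "t \<noteq> 1" "0 < p"
  shows "- t * (T - 1) * (M * T + p) / ((t - 1) * (T\<^sup>2 + p * t))
       - - t * (t * T - 1) * (M * (t * T) + p) / ((t - 1) * ((t * T)\<^sup>2 + p * t))
     = 1 - T\<^sup>2 * t * (T - M) * (T + p) / ((T\<^sup>2 + p) * (T\<^sup>2 * t + p))
         + p * t * (T * M + p) * (T - 1) / ((T\<^sup>2 + p * t) * (T\<^sup>2 + p))"
proof -
  define a where "a = T\<^sup>2 + p * t"
  define b where "b = T\<^sup>2 * t + p"
  define c where "c = T\<^sup>2 + p"
  have pos: "0 < a" "0 < b" "0 < c"
    using assms by (auto simp: a_def b_def c_def intro!: add_pos_pos)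
  have e: "(t * T)\<^sup>2 + p * t = t * b" by (simp add: b_def power2_eq_square algebra_simps)
  have "(- t * (T - 1) * (M * T + p) / ((t - 1) * a) - - t * (t * T - 1) * (M * (t * T) + p) / ((t - 1) * (t * b)))
      = ((t * T - 1) * (M * (t * T) + p) * a - t * (T - 1) * (M * T + p) * b) / ((t - 1) * a * b)"
    using pos assms by (simp add: divide_simps; simp add: algebra_simps)
  also have "\<dots> = (a * b * c - T\<^sup>2 * t * (T - M) * (T + p) * a + p * t * (T * M + p) * (T - 1) * b) / (a * b * c)"
  proof -
    have "((t * T - 1) * (M * (t * T) + p) * a - t * (T - 1) * (M * T + p) * b) * c
        = (t - 1) * (a * b * c - T\<^sup>2 * t * (T - M) * (T + p) * a + p * t * (T * M + p) * (T - 1) * b)"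
      unfolding a_def b_def c_def by (simp add: power2_eq_square algebra_simps)
    then show ?thesis using pos assms by (simp add: frac_eq_eq mult_ac)
  qed
  also have "\<dots> = 1 - T\<^sup>2 * t * (T - M) * (T + p) / (c * b) + p * t * (T * M + p) * (T - 1) / (a * c)"
    using pos by (simp add: add_divide_distrib diff_divide_distrib mult_ac)
  finally show ?thesis unfolding e a_def[symmetric] b_def[symmetric] c_def[symmetric] .
qed

lemma alpha_identity:
  fixes T t p M :: real
  assumes "0 < T" "0 < t" "t \<noteq> 1" "0 < p"
  defines "g \<equiv> \<lambda>T. - t * (T - 1) * (M * T + p) / ((t - 1) * (T\<^sup>2 + p * t))"
  defines "d \<equiv> \<lambda>T. g T * (- t * (T - t) * (M * T + p * t) / ((t\<^sup>2 - 1) * (T\<^sup>2 + p * t\<^sup>2)))"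
  shows "d T - d (t * T) - (g T - g (t * T)) * g T
     = - p * t * T\<^sup>2 * (T - M * t) * (T + p * t) * (T * M + p) * (T - 1)
        / ((T\<^sup>2 + p * t\<^sup>2) * (T\<^sup>2 + p * t)\<^sup>2 * (T\<^sup>2 + p))"
proof -
  define a where "a = T\<^sup>2 + p * t"
  define b where "b = T\<^sup>2 * t + p"
  define c where "c = T\<^sup>2 + p"
  define e where "e = T\<^sup>2 + p * t\<^sup>2"
  have pos: "0 < a" "0 < b" "0 < c" "0 < e"
    using assms by (auto simp: a_def b_def c_def e_def intro!: add_pos_pos)
  have t1: "t - 1 \<noteq> 0" "t + 1 \<noteq> 0" "t \<noteq> 0" using assms by auto
  have gT: "g T = - t * (T - 1) * (M * T + p) / ((t - 1) * a)" by (simp add: g_def a_def)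
  have gtT: "g (t * T) = - (t * T - 1) * (M * t * T + p) / ((t - 1) * b)"
  proof -
    have e: "(t * T)\<^sup>2 + p * t = t * b" by (simp add: b_def power2_eq_square algebra_simps)
    have "g (t * T) = (t * (- (t * T - 1) * (M * t * T + p))) / (t * ((t - 1) * b))"
      unfolding g_def e by (simp only: mult_minus_left mult_minus_right mult_ac)
    then show ?thesis using t1 by simp
  qed
  have t2: "t\<^sup>2 - 1 = (t - 1) * (t + 1)" by (simp add: power2_eq_square algebra_simps)
  have dT: "d T = g T * (- t * (T - t) * (M * T + p * t) / ((t - 1) * (t + 1) * e))"
    by (simp add: d_def e_def t2)
  have dtT: "d (t * T) = g (t * T) * (- (T - 1) * t * (M * T + p) / ((t - 1) * (t + 1) * c))"
  proof -
    have 1: "(t * T)\<^sup>2 + p * t\<^sup>2 = t\<^sup>2 * c" by (simp add: c_def power2_eq_square algebra_simps)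
    have 2: "- t * (t * T - t) * (M * (t * T) + p * t) = t\<^sup>2 * (- (T - 1) * t * (M * T + p))"
      by (simp add: power2_eq_square algebra_simps)
    have 3: "(t - 1) * (t + 1) * (t\<^sup>2 * c) = t\<^sup>2 * ((t - 1) * (t + 1) * c)"
      by (simp only: mult_ac)
    have "t\<^sup>2 \<noteq> 0" using t1 by simp
    then show ?thesis
      unfolding d_def t2 1 2 3 by (metis mult_divide_mult_cancel_left)
  qed
  define L where "L = t * (T - 1) * (M * T + p)"
  define G where "G = (t * T - 1) * (M * t * T + p)"
  have lhs: "d T - d (t * T) - (g T - g (t * T)) * g T
      = L * (t * (T - t) * (M * T + p * t) * a * b * c - G * a\<^sup>2 * e
          - (t + 1) * c * e * (L * b - G * a)) / ((t - 1)\<^sup>2 * (t + 1) * a\<^sup>2 * b * c * e)"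
    unfolding dT dtT gT gtT L_def[symmetric] G_def[symmetric]
    using t1 pos unfolding L_def G_def
    by (simp add: divide_simps; simp add: power2_eq_square algebra_simps)
  have key: "(t * (T - t) * (M * T + p * t) * a * b * c - G * a\<^sup>2 * e - (t + 1) * c * e * (L * b - G * a))
      = - p * (t - 1)\<^sup>2 * (t + 1) * T\<^sup>2 * (T - M * t) * (T + p * t) * b"
    unfolding L_def G_def a_def b_def c_def e_def by (simp add: power2_eq_square algebra_simps)
  have "d T - d (t * T) - (g T - g (t * T)) * g T
      = - p * L * T\<^sup>2 * (T - M * t) * (T + p * t) / (e * a\<^sup>2 * c)"
    unfolding lhs key using t1 pos by (simp add: divide_simps)
  then show ?thesis by (simp add: L_def a_def c_def e_def mult_ac)
qed

context q_krawtchouk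
begin

lemma diag_coeff_eq:
  assumes "1 \<le> j"
  shows "diag_coeff j = 1 - (t ^ j)\<^sup>2 * t * (t ^ j - t ^ N) * (t ^ j + p) / (((t ^ j)\<^sup>2 + p) * ((t ^ j)\<^sup>2 * t + p))
         + p * t * (t ^ j * t ^ N + p) * (t ^ j - 1) / (((t ^ j)\<^sup>2 + p * t) * ((t ^ j)\<^sup>2 + p))"
  using beta_identity[of "t ^ j" t p "t ^ N"] kr_coeff_prev[OF assms] kr_coeff_prev[of "Suc j"] t_pos t_ne_1 p_pos
  by (simp add: diag_coeff_def)

lemma offdiag_sq_eq:
  assumes "2 \<le> j"
  shows "offdiag_sq j = - p * t * (t ^ j)\<^sup>2 * (t ^ j - t ^ N * t) * (t ^ j + p * t) * (t ^ j * t ^ N + p) * (t ^ j - 1)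
        / (((t ^ j)\<^sup>2 + p * t\<^sup>2) * ((t ^ j)\<^sup>2 + p * t)\<^sup>2 * ((t ^ j)\<^sup>2 + p))"
proof -
  have "Suc j - 2 = j - 1" by simp
  then show ?thesis
    using alpha_identity[of "t ^ j" t p "t ^ N"] kr_coeff_prev[of j] kr_coeff_prev[of "Suc j"] kr_coeff_prev2[of j] kr_coeff_prev2[of "Suc j"]
      t_pos t_ne_1 p_pos assms
    by (simp add: offdiag_sq_def diag_coeff_def)
qed

end

section \<open>Alternants, holes and the dual Cauchy identity\<close>

text \<open>
  The determinant as a sum over the permutations of \<open>{..<n}\<close>, convenient for reindexing.
\<close>

definition leibniz :: "nat \<Rightarrow> (nat \<Rightarrow> nat \<Rightarrow> real) \<Rightarrow> real" where
  "leibniz n f = (\<Sum>p | p permutes {..<n}. of_int (sign p) * (\<Prod>i<n. f i (p i)))"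

definition vdm :: "nat \<Rightarrow> (nat \<Rightarrow> real) \<Rightarrow> real" where
  "vdm n x = (\<Prod>j<n. \<Prod>i<j. x j - x i)"

lemma det_eq_leibniz: "Determinant.det (Matrix.mat n n (\<lambda>(i, j). f i j)) = leibniz n f"
proof -
  have "Determinant.det (Matrix.mat n n (\<lambda>(i, j). f i j))
      = (\<Sum>p\<in>{p. p permutes {0..<n}}. signof p * (\<Prod>i = 0..<n. Matrix.mat n n (\<lambda>(i, j). f i j) $$ (i, p i)))"
    by (rule det_def') simp
  also have "\<dots> = leibniz n f"
    unfolding leibniz_def atLeast0LessThan
  proof (intro sum.cong refl arg_cong2[where f = "(*)"] prod.cong)
    fix p i assume "p \<in> {p. p permutes {..<n}}" "i \<in> {..<n}"
    then have "p i < n" using permutes_in_image by fastforce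
    then show "Matrix.mat n n (\<lambda>(i, j). f i j) $$ (i, p i) = f i (p i)" using \<open>i \<in> {..<n}\<close> by simp
  qed
  finally show ?thesis .
qed

lemma leibniz_transpose: "leibniz n (\<lambda>i j. f j i) = leibniz n f"
proof -
  have "transpose_mat (Matrix.mat n n (\<lambda>(i, j). f i j)) = Matrix.mat n n (\<lambda>(i, j). f j i)"
    by (rule eq_matI) auto
  then show ?thesis
    using Determinant.det_transpose[of "Matrix.mat n n (\<lambda>(i, j). f i j)" n]
    by (simp add: det_eq_leibniz)
qed

lemma leibniz_cong: "(\<And>i j. i < n \<Longrightarrow> j < n \<Longrightarrow> f i j = g i j) \<Longrightarrow> leibniz n f = leibniz n g"
  unfolding det_eq_leibniz[symmetric] by (intro arg_cong[where f = Determinant.det] eq_matI) auto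

lemma leibniz_scale:
  "leibniz n (\<lambda>i j. r i * c j * f i j) = (\<Prod>i<n. r i) * (\<Prod>j<n. c j) * leibniz n f"
proof -
  have "(\<Prod>i<n. r i * c (p i) * f i (p i)) = (\<Prod>i<n. r i) * (\<Prod>j<n. c j) * (\<Prod>i<n. f i (p i))"
    if "p permutes {..<n}" for p
    using prod.reindex_bij_betw[OF permutes_imp_bij[OF that], of c] by (simp add: prod.distrib)
  then show ?thesis
    unfolding leibniz_def sum_distrib_left by (intro sum.cong refl) (simp add: mult_ac)
qed

lemma leibniz_permute_rows:
  assumes "p permutes {..<n}"
  shows "leibniz n (\<lambda>i j. f (p i) j) = of_int (sign p) * leibniz n f"
proof -
  have p: "p permutes {0..<n}" using assms by (simp add: atLeast0LessThan)
  have "Determinant.det (Matrix.mat n n (\<lambda>(i, j). Matrix.mat n n (\<lambda>(i, j). f i j) $$ (p i, j)))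
      = signof p * Determinant.det (Matrix.mat n n (\<lambda>(i, j). f i j))"
    by (rule det_permute_rows[OF _ p]) simp
  moreover have "Matrix.mat n n (\<lambda>(i, j). Matrix.mat n n (\<lambda>(i, j). f i j) $$ (p i, j)) = Matrix.mat n n (\<lambda>(i, j). f (p i) j)"
  proof (rule eq_matI)
    fix i j assume ij: "i < dim_row (Matrix.mat n n (\<lambda>(i, j). f (p i) j))" "j < dim_col (Matrix.mat n n (\<lambda>(i, j). f (p i) j))"
    then have "p i < n" using assms permutes_in_image by fastforce
    then show "Matrix.mat n n (\<lambda>(i, j). Matrix.mat n n (\<lambda>(i, j). f i j) $$ (p i, j)) $$ (i, j)
      = Matrix.mat n n (\<lambda>(i, j). f (p i) j) $$ (i, j)" using ij by simp
  qed auto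
  ultimately show ?thesis by (simp add: det_eq_leibniz)
qed

lemma leibniz_block:
  assumes z: "\<And>i j. i < n \<Longrightarrow> n \<le> j \<Longrightarrow> j < n + k \<Longrightarrow> f i j = 0"
    and z': "\<And>i j. n \<le> i \<Longrightarrow> i < n + k \<Longrightarrow> j < n \<Longrightarrow> f i j = 0"
  shows "leibniz (n + k) f = leibniz n f * leibniz k (\<lambda>i j. f (n + i) (n + j))"
proof -
  let ?A = "Matrix.mat n n (\<lambda>(i, j). f i j)" and ?D = "Matrix.mat k k (\<lambda>(i, j). f (n + i) (n + j))"
  have "Matrix.mat (n + k) (n + k) (\<lambda>(i, j). f i j) = four_block_mat ?A (0\<^sub>m n k) (0\<^sub>m k n) ?D"
  proof (rule eq_matI)
    fix i j assume "i < dim_row (four_block_mat ?A (0\<^sub>m n k) (0\<^sub>m k n) ?D)" "j < dim_col (four_block_mat ?A (0\<^sub>m n k) (0\<^sub>m k n) ?D)"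
    then have "i < n + k" "j < n + k" by auto
    then show "Matrix.mat (n + k) (n + k) (\<lambda>(i, j). f i j) $$ (i, j) = four_block_mat ?A (0\<^sub>m n k) (0\<^sub>m k n) ?D $$ (i, j)"
      using z z' by (cases "i < n"; cases "j < n") auto
  qed auto
  then have "leibniz (n + k) f = Determinant.det (four_block_mat ?A (0\<^sub>m n k) (0\<^sub>m k n) ?D)"
    by (simp add: det_eq_leibniz[symmetric])
  also have "\<dots> = Determinant.det ?A * Determinant.det ?D"
    by (rule det_four_block_mat_lower_left_zero) auto
  finally show ?thesis by (simp add: det_eq_leibniz)
qed

text \<open>
  Passing from the monomials to the monic polynomials multiplies by a unitriangular matrix.
\<close>

lemma leibniz_monic:
  fixes g :: "nat \<Rightarrow> real poly"
  assumes monic: "\<And>j. j < n \<Longrightarrow> coeff (g j) j = 1" and deg: "\<And>j m. j < m \<Longrightarrow> coeff (g j) m = 0"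
  shows "leibniz n (\<lambda>i j. poly (g j) (x i)) = leibniz n (\<lambda>i j. x i ^ j)"
proof -
  let ?X = "Matrix.mat n n (\<lambda>(i, j). x i ^ j)" and ?C = "Matrix.mat n n (\<lambda>(m, j). coeff (g j) m)"
  have "Matrix.mat n n (\<lambda>(i, j). poly (g j) (x i)) = ?X * ?C"
  proof (rule eq_matI)
    fix i j assume "i < dim_row (?X * ?C)" "j < dim_col (?X * ?C)"
    then have ij: "i < n" "j < n" by auto
    have "degree (g j) \<le> j" using deg by (intro degree_le) auto
    then have "poly (g j) (x i) = (\<Sum>m\<le>j. coeff (g j) m * x i ^ m)"
      unfolding poly_altdef by (intro sum.mono_neutral_left) (auto intro: coeff_eq_0)
    also have "\<dots> = (\<Sum>m<n. x i ^ m * coeff (g j) m)"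
      using ij deg by (intro sum.mono_neutral_cong_left) (auto simp: mult.commute)
    finally show "Matrix.mat n n (\<lambda>(i, j). poly (g j) (x i)) $$ (i, j) = (?X * ?C) $$ (i, j)"
      using ij by (simp add: scalar_prod_def atLeast0LessThan)
  qed auto
  moreover have "Determinant.det ?C = 1"
  proof -
    have "upper_triangular ?C" using deg by (auto simp: upper_triangular_def)
    then have "Determinant.det ?C = prod_list (diag_mat ?C)"
      by (rule det_upper_triangular[of _ n]) simp
    also have "\<dots> = (\<Prod>j<n. ?C $$ (j, j))"
      by (simp add: prod_list_diag_prod atLeast0LessThan)
    also have "\<dots> = 1" using monic by (intro prod.neutral) auto
    finally show ?thesis .
  qed
  moreover have "Determinant.det (?X * ?C) = Determinant.det ?X * Determinant.det ?C"
    by (rule det_mult) auto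
  ultimately have "Determinant.det (Matrix.mat n n (\<lambda>(i, j). poly (g j) (x i))) = Determinant.det ?X"
    by (simp only: mult_1_right)
  then show ?thesis by (simp only: det_eq_leibniz)
qed

text \<open>
  For the monic polynomials with roots \<open>x 0, \<dots>, x (j - 1)\<close> the matrix of values is triangular.
\<close>

lemma leibniz_vandermonde: "leibniz n (\<lambda>i j. x i ^ j) = vdm n x"
proof -
  define g where "g j = (\<Prod>i<j. [:- x i, 1:])" for j
  have "degree (g j) = j \<and> lead_coeff (g j) = 1" for j
  proof -
    have "degree (g j) = (\<Sum>i<j. degree [:- x i, 1:])"
      unfolding g_def by (rule degree_prod_eq_sum_degree) auto
    moreover have "lead_coeff (g j) = (\<Prod>i<j. lead_coeff [:- x i, 1:])"
      unfolding g_def by (rule lead_coeff_prod)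
    ultimately show ?thesis by simp
  qed
  then have dg: "degree (g j) = j" "coeff (g j) j = 1" for j by metis+
  have "leibniz n (\<lambda>i j. x i ^ j) = leibniz n (\<lambda>i j. poly (g j) (x i))"
    by (rule leibniz_monic[symmetric]) (use dg in \<open>auto intro: coeff_eq_0\<close>)
  also have "\<dots> = Determinant.det (Matrix.mat n n (\<lambda>(i, j). poly (g j) (x i)))"
    by (rule det_eq_leibniz[symmetric])
  also have "\<dots> = prod_list (diag_mat (Matrix.mat n n (\<lambda>(i, j). poly (g j) (x i))))"
    by (rule det_lower_triangular[of n]) (auto simp: g_def poly_prod intro!: prod_zero)
  also have "\<dots> = (\<Prod>j<n. poly (g j) (x j))"
    by (simp add: prod_list_diag_prod atLeast0LessThan)
  also have "\<dots> = vdm n x"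
    by (simp add: vdm_def g_def poly_prod)
  finally show ?thesis .
qed

text \<open>
  At a geometric progression the roles of base and exponent can be exchanged.
\<close>

lemma alternant_eq_vdm: "alternant n e (\<lambda>i. q ^ i) = vdm n (\<lambda>j. q ^ e j)"
proof -
  have "alternant n e (\<lambda>i. q ^ i) = leibniz n (\<lambda>i j. (q ^ i) ^ e j)"
    unfolding alternant_def by (rule det_eq_leibniz)
  also have "\<dots> = leibniz n (\<lambda>i j. (q ^ e j) ^ i)"
    by (simp add: power_mult[symmetric] mult.commute)
  also have "\<dots> = leibniz n (\<lambda>i j. (q ^ e i) ^ j)"
    by (rule leibniz_transpose)
  finally show ?thesis by (simp add: leibniz_vandermonde)
qed

lemma vdm_permute:
  assumes "p permutes {..<n}"
  shows "vdm n (\<lambda>i. x (p i)) = of_int (sign p) * vdm n x"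
  using leibniz_permute_rows[OF assms, of "\<lambda>i j. x i ^ j"] by (simp add: leibniz_vandermonde)

text \<open>
  In this form the square depends only on the set of points, so that products over particles can be
  compared with products over all sites.
\<close>

lemma vdm_sq: "(vdm n x)\<^sup>2 = (\<Prod>i<n. \<Prod>j\<in>{..<n} - {i}. \<bar>x i - x j\<bar>)"
proof (induction n)
  case (Suc n)
  have "(\<Prod>i<Suc n. \<Prod>j\<in>{..<Suc n} - {i}. \<bar>x i - x j\<bar>)
      = (\<Prod>i<n. \<Prod>j\<in>{..<Suc n} - {i}. \<bar>x i - x j\<bar>) * (\<Prod>j\<in>{..<Suc n} - {n}. \<bar>x n - x j\<bar>)"
    by simp
  also have "{..<Suc n} - {n} = {..<n}" by auto
  also have "(\<Prod>i<n. \<Prod>j\<in>{..<Suc n} - {i}. \<bar>x i - x j\<bar>) = (\<Prod>i<n. \<bar>x i - x n\<bar> * (\<Prod>j\<in>{..<n} - {i}. \<bar>x i - x j\<bar>))"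
  proof (rule prod.cong[OF refl])
    fix i assume "i \<in> {..<n}"
    then have "{..<Suc n} - {i} = insert n ({..<n} - {i})" by auto
    then show "(\<Prod>j\<in>{..<Suc n} - {i}. \<bar>x i - x j\<bar>) = \<bar>x i - x n\<bar> * (\<Prod>j\<in>{..<n} - {i}. \<bar>x i - x j\<bar>)" by simp
  qed
  also have "\<dots> = (\<Prod>i<n. \<bar>x n - x i\<bar>) * (vdm n x)\<^sup>2"
    by (simp add: prod.distrib Suc.IH abs_minus_commute)
  also have "\<dots> * (\<Prod>j<n. \<bar>x n - x j\<bar>) = (vdm n x)\<^sup>2 * \<bar>\<Prod>i<n. x n - x i\<bar>\<^sup>2"
    by (simp add: abs_prod power2_eq_square mult_ac)
  also have "\<dots> = (vdm (Suc n) x)\<^sup>2"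
    by (simp add: vdm_def power_mult_distrib)
  finally show ?case by simp
qed (simp add: vdm_def)

definition decreasing_on :: "nat \<Rightarrow> (nat \<Rightarrow> nat) \<Rightarrow> bool" where
  "decreasing_on n y \<longleftrightarrow> (\<forall>i j. i < j \<longrightarrow> j < n \<longrightarrow> y j < y i)"

lemma decreasing_on_inj: "decreasing_on n y \<Longrightarrow> inj_on y {..<n}"
  unfolding decreasing_on_def inj_on_def by (metis lessThan_iff nat_neq_iff)

lemma decreasing_on_gap:
  assumes "decreasing_on n y" "i \<le> j" "j < n"
  shows "y j + (j - i) \<le> y i"
  using assms(2,3)
proof (induction j rule: dec_induct)
  case (step j)
  have "y (Suc j) < y j" using assms(1) step.prems by (simp add: decreasing_on_def)
  then show ?case using step by simp
qed simp

lemma decreasing_on_eq_sorted: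
  assumes y: "decreasing_on n y" and i: "i < n"
  shows "y i = sorted_list_of_set (y ` {..<n}) ! (n - 1 - i)"
proof -
  let ?L = "map y (rev [0..<n])"
  have "sorted_wrt (<) ?L"
    using y by (auto simp: sorted_wrt_iff_nth_less decreasing_on_def rev_nth)
  then have "sorted ?L" "distinct ?L" by (auto simp: strict_sorted_iff)
  moreover have "set ?L = y ` {..<n}" by (auto simp: atLeast0LessThan)
  ultimately have "sorted_list_of_set (y ` {..<n}) = ?L"
    by (metis sorted_list_of_set.idem_if_sorted_distinct)
  then show ?thesis using i by (simp add: rev_nth)
qed

lemma decreasing_on_exists:
  assumes "finite A" "card A = n"
  obtains y where "decreasing_on n y" "y ` {..<n} = (A :: nat set)"
proof
  define L where "L = sorted_list_of_set A"
  let ?y = "\<lambda>i. L ! (n - 1 - i)"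
  have L: "sorted_wrt (<) L" "set L = A" "length L = n" using assms by (auto simp: L_def strict_sorted_iff)
  show "decreasing_on n ?y"
    using L by (auto simp: decreasing_on_def sorted_wrt_iff_nth_less)
  have "?y ` {..<n} = (\<lambda>i. L ! i) ` ((\<lambda>i. n - 1 - i) ` {..<n})" by (simp add: image_image)
  also have "(\<lambda>i. n - 1 - i) ` {..<n} = {..<n}"
  proof
    show "{..<n} \<subseteq> (\<lambda>i. n - 1 - i) ` {..<n}"
    proof
      fix i assume "i \<in> {..<n}"
      then show "i \<in> (\<lambda>i. n - 1 - i) ` {..<n}" by (intro image_eqI[of _ _ "n - 1 - i"]) auto
    qed
  qed auto
  also have "(\<lambda>i. L ! i) ` {..<n} = A" using L by (auto simp: set_conv_nth)
  finally show "?y ` {..<n} = A" .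
qed

text \<open>
  The integers \<open>a\<^sub>i\<close> of the particle process; as rows are numbered from \<open>0\<close>, the shift is \<open>n - 1 - i\<close>.
\<close>

definition site :: "nat \<Rightarrow> (nat \<Rightarrow> nat) \<Rightarrow> nat \<Rightarrow> nat" where
  "site n \<mu> i = \<mu> i + (n - 1 - i)"

text \<open>
  The corresponding integers for the conjugate of the complementary diagram, which are the sites left
  empty by the particles.
\<close>

definition hole :: "nat \<Rightarrow> nat \<Rightarrow> (nat \<Rightarrow> nat) \<Rightarrow> nat \<Rightarrow> nat" where
  "hole n k \<mu> j = conjugate_diagram (complement_diagram n k \<mu>) j + (k - 1 - j)"

lemma site_decreasing: "\<mu> \<in> diagrams n k \<Longrightarrow> decreasing_on n (site n \<mu>)"
proof -
  assume "\<mu> \<in> diagrams n k"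
  then have "\<mu> j \<le> \<mu> i" if "i \<le> j" for i j using that by (auto simp: diagrams_def antimono_def)
  note mono = this
  show ?thesis
    unfolding decreasing_on_def site_def
  proof (intro allI impI)
    fix i j assume "i < j" "j < n"
    then have "\<mu> j \<le> \<mu> i" "n - 1 - j < n - 1 - i" using mono by auto
    then show "\<mu> j + (n - 1 - j) < \<mu> i + (n - 1 - i)" by (rule add_le_less_mono)
  qed
qed

lemma site_less: "\<mu> \<in> diagrams n k \<Longrightarrow> i < n \<Longrightarrow> site n \<mu> i < n + k"
proof -
  assume "\<mu> \<in> diagrams n k" "i < n"
  then have "\<mu> i \<le> k" by (simp add: diagrams_def)
  then show ?thesis using \<open>i < n\<close> unfolding site_def by linarith
qed

lemma site_image_inj:
  assumes \<mu>: "\<mu> \<in> diagrams n k" and \<nu>: "\<nu> \<in> diagrams n k" and im: "site n \<mu> ` {..<n} = site n \<nu> ` {..<n}"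
  shows "\<mu> = \<nu>"
proof
  fix i
  show "\<mu> i = \<nu> i"
  proof (cases "i < n")
    case True
    then have "site n \<mu> i = site n \<nu> i"
      using decreasing_on_eq_sorted[OF site_decreasing[OF \<mu>] True] decreasing_on_eq_sorted[OF site_decreasing[OF \<nu>] True] im by simp
    then show ?thesis by (simp add: site_def)
  next
    case False
    then show ?thesis using \<mu> \<nu> by (auto simp: diagrams_def)
  qed
qed

lemma site_image_exists:
  assumes A: "A \<subseteq> {..<n + k}" "card A = n"
  obtains \<mu> where "\<mu> \<in> diagrams n k" "site n \<mu> ` {..<n} = A"
proof -
  have "finite A" using A(1) by (rule finite_subset) simp
  then obtain y where y: "decreasing_on n y" "y ` {..<n} = A" using A(2) by (rule decreasing_on_exists)
  define \<mu> where "\<mu> i = (if i < n then y i - (n - 1 - i) else 0)" for i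
  have lo: "n - 1 - i \<le> y i" if "i < n" for i
  proof -
    have "y (n - 1) + (n - 1 - i) \<le> y i" using that by (intro decreasing_on_gap[OF y(1)]) auto
    then show ?thesis by linarith
  qed
  have hi: "y i \<le> k + (n - 1 - i)" if i: "i < n" for i
  proof -
    have "y i + (i - 0) \<le> y 0" using i by (intro decreasing_on_gap[OF y(1)]) auto
    moreover have "y 0 \<in> A" using y(2) i by auto
    then have "y 0 < n + k" using A by auto
    ultimately show ?thesis using i by simp
  qed
  have site: "site n \<mu> i = y i" if "i < n" for i
    using lo[OF that] that by (simp add: site_def \<mu>_def)
  have "\<mu> \<in> diagrams n k"
    unfolding diagrams_def
  proof (intro CollectI conjI allI impI)
    show "antimono \<mu>"
    proof (rule antimonoI)
      fix i j :: nat assume ij: "i \<le> j"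
      show "\<mu> j \<le> \<mu> i"
      proof (cases "j < n")
        case True
        then have "y j + (j - i) \<le> y i" using ij by (intro decreasing_on_gap[OF y(1)])
        then show ?thesis using True ij lo[of j] by (simp add: \<mu>_def)
      qed (simp add: \<mu>_def)
    qed
    show "\<mu> i \<le> k" for i using hi[of i] by (auto simp: \<mu>_def)
  qed (simp add: \<mu>_def)
  moreover have "site n \<mu> ` {..<n} = A" using site y(2) by (simp cong: image_cong_simp)
  ultimately show ?thesis by (rule that)
qed

lemma finite_diagrams: "finite (diagrams n k)"
proof (rule inj_on_finite)
  show "inj_on (\<lambda>\<mu>. site n \<mu> ` {..<n}) (diagrams n k)"
    using site_image_inj by (intro inj_onI)
  show "(\<lambda>\<mu>. site n \<mu> ` {..<n}) ` diagrams n k \<subseteq> Pow {..<n + k}"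
    using site_less by auto
qed simp

text \<open>
  An injective tuple of sites is a decreasing one, that is a diagram, followed by a permutation.
\<close>

lemma bij_betw_diagram_tuples:
  "bij_betw (\<lambda>(\<mu>, p). restrict (site n \<mu> \<circ> p) {..<n}) (diagrams n k \<times> {p. p permutes {..<n}})
      {x \<in> {..<n} \<rightarrow>\<^sub>E {..<n + k}. inj_on x {..<n}}"
  (is "bij_betw ?h (?D \<times> ?S) ?T")
proof (rule bij_betwI')
  fix a b assume a: "a \<in> ?D \<times> ?S" and b: "b \<in> ?D \<times> ?S"
  obtain \<mu> p where ap: "a = (\<mu>, p)" "\<mu> \<in> ?D" "p permutes {..<n}" using a by auto
  obtain \<nu> s where bp: "b = (\<nu>, s)" "\<nu> \<in> ?D" "s permutes {..<n}" using b by auto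
  show "?h a = ?h b \<longleftrightarrow> a = b"
  proof
    assume eq: "?h a = ?h b"
    then have pt: "site n \<mu> (p i) = site n \<nu> (s i)" if "i < n" for i
    proof -
      have "?h a i = ?h b i" by (simp only: eq)
      then show ?thesis using that by (simp add: ap bp)
    qed
    have "site n \<mu> ` {..<n} = (\<lambda>i. site n \<mu> (p i)) ` {..<n}"
      using permutes_image[OF ap(3)] by (metis image_image)
    also have "\<dots> = (\<lambda>i. site n \<nu> (s i)) ` {..<n}" using pt by (intro image_cong) auto
    also have "\<dots> = site n \<nu> ` {..<n}"
      using permutes_image[OF bp(3)] by (metis image_image)
    finally have \<mu>\<nu>: "\<mu> = \<nu>" by (rule site_image_inj[OF ap(2) bp(2)])
    have "p i = s i" for i
    proof (cases "i < n")
      case True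
      then have "p i < n" "s i < n" using permutes_in_image[OF ap(3), of i] permutes_in_image[OF bp(3), of i] by auto
      then show ?thesis
        using pt[OF True] decreasing_on_inj[OF site_decreasing[OF ap(2)]] \<mu>\<nu> by (auto simp: inj_on_def)
    next
      case False
      then show ?thesis using permutes_not_in[OF ap(3), of i] permutes_not_in[OF bp(3), of i] by simp
    qed
    then show "a = b" using \<mu>\<nu> ap bp by auto
  qed simp
next
  fix a assume "a \<in> ?D \<times> ?S"
  then obtain \<mu> p where ap: "a = (\<mu>, p)" "\<mu> \<in> ?D" "p permutes {..<n}" by auto
  have pl: "p i < n" if "i < n" for i using permutes_in_image[OF ap(3), of i] that by simp
  have "inj_on (site n \<mu> \<circ> p) {..<n}"
    using decreasing_on_inj[OF site_decreasing[OF ap(2)]] permutes_inj_on[OF ap(3), of "{..<n}"] permutes_image[OF ap(3)]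
    by (intro comp_inj_on) auto
  then have "inj_on (?h a) {..<n}" by (simp add: ap inj_on_restrict_eq)
  moreover have "?h a \<in> {..<n} \<rightarrow>\<^sub>E {..<n + k}"
    using site_less[OF ap(2)] pl by (auto simp: ap)
  ultimately show "?h a \<in> ?T" by blast
next
  fix x assume "x \<in> ?T"
  then have x: "x \<in> {..<n} \<rightarrow>\<^sub>E {..<n + k}" "inj_on x {..<n}" by auto
  have "x ` {..<n} \<subseteq> {..<n + k}" "card (x ` {..<n}) = n" using x by (auto simp: card_image)
  then obtain \<mu> where \<mu>: "\<mu> \<in> ?D" "site n \<mu> ` {..<n} = x ` {..<n}" by (rule site_image_exists)
  let ?y = "site n \<mu>"
  have injy: "inj_on ?y {..<n}" by (rule decreasing_on_inj[OF site_decreasing[OF \<mu>(1)]])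
  define p where "p i = (if i < n then inv_into {..<n} ?y (x i) else i)" for i
  have py: "?y (p i) = x i" "p i < n" if "i < n" for i
  proof -
    have "x i \<in> ?y ` {..<n}" using \<mu>(2) that by auto
    then show "?y (p i) = x i" "p i < n"
      using that f_inv_into_f[of "x i" ?y "{..<n}"] inv_into_into[of "x i" ?y "{..<n}"] by (auto simp: p_def)
  qed
  have "p permutes {..<n}"
  proof (rule bij_imp_permutes)
    have "inj_on p {..<n}" using py x(2) unfolding inj_on_def by (metis lessThan_iff)
    moreover have "p ` {..<n} \<subseteq> {..<n}" using py by auto
    ultimately show "bij_betw p {..<n} {..<n}"
      by (simp add: bij_betw_def endo_inj_surj)
  qed (simp add: p_def)
  moreover have "x = ?h (\<mu>, p)"
    using x(1) py(1) by (auto simp: fun_eq_iff PiE_def extensional_def)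
  ultimately show "\<exists>a\<in>?D \<times> ?S. x = ?h a" using \<mu>(1) by blast
qed


lemma hole_eq:
  assumes "\<mu> \<in> diagrams n k" "j < k"
  shows "hole n k \<mu> j = card {i. i < n \<and> \<mu> i + j < k} + (k - 1 - j)"
proof -
  have "{i. j < complement_diagram n k \<mu> i} = (\<lambda>i. n - 1 - i) ` {i. i < n \<and> \<mu> i + j < k}"
  proof (intro equalityI subsetI)
    fix i assume "i \<in> {i. j < complement_diagram n k \<mu> i}"
    then have "i < n" "j < k - \<mu> (n - 1 - i)" by (auto simp: complement_diagram_def split: if_splits)
    then show "i \<in> (\<lambda>i. n - 1 - i) ` {i. i < n \<and> \<mu> i + j < k}"
      by (intro image_eqI[of _ _ "n - 1 - i"]) auto
  next
    fix i assume "i \<in> (\<lambda>i. n - 1 - i) ` {i. i < n \<and> \<mu> i + j < k}"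
    then obtain l where l: "i = n - 1 - l" "l < n" "\<mu> l + j < k" by auto
    then have "n - 1 - i = l" "i < n" by auto
    then show "i \<in> {i. j < complement_diagram n k \<mu> i}" using l by (auto simp: complement_diagram_def)
  qed
  moreover have "inj_on (\<lambda>i. n - 1 - i) {i. i < n \<and> \<mu> i + j < k}"
    by (auto simp: inj_on_def)
  ultimately show ?thesis by (simp add: hole_def conjugate_diagram_def card_image)
qed

text \<open>
  The rows shorter than \<open>k - j\<close> are the last ones, because row lengths decrease, and the hole lies above
  exactly their particles. In particular particles and holes are distinct, and the number of particles
  above a hole is known.
\<close>

lemma site_vs_hole:
  assumes \<mu>: "\<mu> \<in> diagrams n k" and j: "j < k" and i: "i < n"
  shows "if \<mu> i + j < k then site n \<mu> i < hole n k \<mu> j else hole n k \<mu> j < site n \<mu> i"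
proof -
  let ?S = "{i. i < n \<and> \<mu> i + j < k}"
  have mono: "\<mu> b \<le> \<mu> a" if "a \<le> b" for a b using that \<mu> by (auto simp: diagrams_def antimono_def)
  show ?thesis
  proof (cases "\<mu> i + j < k")
    case True
    have "{i..<n} \<subseteq> ?S"
    proof
      fix l assume "l \<in> {i..<n}"
      then show "l \<in> ?S" using mono[of i l] True by auto
    qed
    then have "n - i \<le> card ?S" using card_mono[of ?S "{i..<n}"] by simp
    then show ?thesis using True i j by (simp add: hole_eq[OF \<mu> j] site_def)
  next
    case False
    have "?S \<subseteq> {Suc i..<n}"
    proof
      fix l assume l: "l \<in> ?S"
      then have "\<not> l \<le> i" using mono[of l i] False by auto
      then show "l \<in> {Suc i..<n}" using l by auto
    qed
    then have "card ?S \<le> n - Suc i" using card_mono[of "{Suc i..<n}" ?S] by simp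
    then show ?thesis using False i j by (simp add: hole_eq[OF \<mu> j] site_def)
  qed
qed

lemma hole_decreasing:
  assumes "\<mu> \<in> diagrams n k"
  shows "decreasing_on k (hole n k \<mu>)"
  unfolding decreasing_on_def
proof (intro allI impI)
  fix i j assume ij: "i < j" "j < k"
  have "card {l. l < n \<and> \<mu> l + j < k} \<le> card {l. l < n \<and> \<mu> l + i < k}"
    using ij by (intro card_mono) auto
  then show "hole n k \<mu> j < hole n k \<mu> i"
    using ij by (simp add: hole_eq[OF assms])
qed

lemma hole_less:
  assumes "\<mu> \<in> diagrams n k" "j < k"
  shows "hole n k \<mu> j < n + k"
proof -
  have "card {i. i < n \<and> \<mu> i + j < k} \<le> card {..<n}" by (intro card_mono) auto
  then show ?thesis using assms by (simp add: hole_eq[OF assms])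
qed

lemma site_hole_disjoint:
  assumes "\<mu> \<in> diagrams n k"
  shows "site n \<mu> ` {..<n} \<inter> hole n k \<mu> ` {..<k} = {}"
proof -
  have "site n \<mu> i \<noteq> hole n k \<mu> j" if "i < n" "j < k" for i j
    using site_vs_hole[OF assms that(2,1)] by (auto split: if_splits)
  then show ?thesis by auto
qed

lemma site_hole_union:
  assumes "\<mu> \<in> diagrams n k"
  shows "site n \<mu> ` {..<n} \<union> hole n k \<mu> ` {..<k} = {..<n + k}"
proof (rule card_subset_eq)
  show "site n \<mu> ` {..<n} \<union> hole n k \<mu> ` {..<k} \<subseteq> {..<n + k}"
    using site_less[OF assms] hole_less[OF assms] by auto
  show "card (site n \<mu> ` {..<n} \<union> hole n k \<mu> ` {..<k}) = card {..<n + k}"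
    using site_hole_disjoint[OF assms] decreasing_on_inj[OF site_decreasing[OF assms]] decreasing_on_inj[OF hole_decreasing[OF assms]]
    by (simp add: card_Un_disjoint card_image)
qed simp

text \<open>
  The reordering of the columns that makes the Laplace expansion block diagonal.
\<close>

definition site_perm :: "nat \<Rightarrow> nat \<Rightarrow> (nat \<Rightarrow> nat) \<Rightarrow> nat \<Rightarrow> nat" where
  "site_perm n k \<mu> x = (if x < n then site n \<mu> x else if x < n + k then hole n k \<mu> (x - n) else x)"

lemma lessThan_add_eq: "{..<n + k} = {..<n} \<union> (\<lambda>j. n + j) ` {..<k :: nat}"
proof (intro equalityI subsetI)
  fix x assume "x \<in> {..<n + k}"
  then show "x \<in> {..<n} \<union> (\<lambda>j. n + j) ` {..<k}"
    by (cases "x < n") (auto intro: image_eqI[of _ _ "x - n"])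
qed auto

lemma site_perm_permutes:
  assumes "\<mu> \<in> diagrams n k"
  shows "site_perm n k \<mu> permutes {..<n + k}"
proof (rule bij_imp_permutes)
  have split: "{..<n + k} = {..<n} \<union> (\<lambda>j. n + j) ` {..<k}"
    by (rule lessThan_add_eq)
  have "site_perm n k \<mu> ` {..<n + k} = site_perm n k \<mu> ` {..<n} \<union> site_perm n k \<mu> ` ((\<lambda>j. n + j) ` {..<k})"
    unfolding split by (rule image_Un)
  also have "site_perm n k \<mu> ` {..<n} = site n \<mu> ` {..<n}"
    by (intro image_cong) (auto simp: site_perm_def)
  also have "site_perm n k \<mu> ` ((\<lambda>j. n + j) ` {..<k}) = hole n k \<mu> ` {..<k}"
    unfolding image_image by (intro image_cong) (auto simp: site_perm_def)
  also have "site n \<mu> ` {..<n} \<union> hole n k \<mu> ` {..<k} = {..<n + k}" by (rule site_hole_union[OF assms])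
  finally have im: "site_perm n k \<mu> ` {..<n + k} = {..<n + k}" .
  then show "bij_betw (site_perm n k \<mu>) {..<n + k} {..<n + k}"
    by (simp add: bij_betw_def finite_surj_inj)
qed (simp add: site_perm_def)

lemma vdm_append:
  "vdm (n + k) x = vdm n x * (\<Prod>j<k. \<Prod>i<n. x (n + j) - x i) * vdm k (\<lambda>j. x (n + j))"
proof (induction k)
  case (Suc k)
  have split: "(\<Prod>i<n + k. x (n + k) - x i) = (\<Prod>i<n. x (n + k) - x i) * (\<Prod>i<k. x (n + k) - x (n + i))"
  proof -
    have "{..<n + k} = {..<n} \<union> (\<lambda>i. n + i) ` {..<k}"
      by (rule lessThan_add_eq)
    then have "(\<Prod>i<n + k. x (n + k) - x i) = (\<Prod>i\<in>{..<n} \<union> (\<lambda>i. n + i) ` {..<k}. x (n + k) - x i)" by simp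
    also have "\<dots> = (\<Prod>i<n. x (n + k) - x i) * (\<Prod>i\<in>(\<lambda>i. n + i) ` {..<k}. x (n + k) - x i)"
      by (rule prod.union_disjoint) auto
    also have "(\<Prod>i\<in>(\<lambda>i. n + i) ` {..<k}. x (n + k) - x i) = (\<Prod>i<k. x (n + k) - x (n + i))"
      by (subst prod.reindex) auto
    finally show ?thesis .
  qed
  have "vdm (n + Suc k) x = vdm (n + k) x * (\<Prod>i<n + k. x (n + k) - x i)"
    by (simp add: vdm_def)
  then show ?case
    unfolding Suc split by (simp add: vdm_def mult_ac)
qed (simp add: vdm_def)

lemma sgn_prod: "sgn (\<Prod>i\<in>I. f i :: real) = (\<Prod>i\<in>I. sgn (f i))"
  by (induction I rule: infinite_finite_induct) (simp_all add: sgn_mult)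

lemma sgn_vdm_decreasing:
  assumes "decreasing_on n y"
  shows "sgn (vdm n (\<lambda>i. real (y i))) = (\<Prod>j<n. \<Prod>i<j. - 1)"
  unfolding vdm_def sgn_prod using assms
  by (intro prod.cong refl) (auto simp: decreasing_on_def)

text \<open>
  The sign of a permutation is the sign of the Vandermonde product of its values. Particles and holes are
  listed in decreasing order, and the number of particles above the hole at \<open>z\<close> has the parity of \<open>z\<close> up
  to a shift that does not depend on \<open>\<mu>\<close>; so the product with the signs \<open>(-1)\<^sup>z\<close> does not depend on \<open>\<mu>\<close>.
\<close>

lemma sign_site_perm:
  assumes \<mu>: "\<mu> \<in> diagrams n k"
  shows "real_of_int (sign (site_perm n k \<mu>)) * (\<Prod>j<k. (- 1) ^ hole n k \<mu> j)
     = (\<Prod>j<n. \<Prod>i<j. - 1) * (\<Prod>j<k. \<Prod>i<j. - 1) * (\<Prod>j<k. (- 1) ^ (n + (k - 1 - j)))"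
proof -
  let ?r = "site_perm n k \<mu>" and ?y = "site n \<mu>" and ?z = "hole n k \<mu>"
  have "vdm (n + k) (\<lambda>x. real (?r x)) = of_int (sign ?r) * vdm (n + k) real"
    by (rule vdm_permute[OF site_perm_permutes[OF \<mu>]])
  moreover have "0 < vdm (n + k) real" unfolding vdm_def by (intro prod_pos) auto
  moreover have "sgn (real_of_int (sign ?r)) = of_int (sign ?r)"
    by (cases ?r rule: sign_cases) auto
  ultimately have 1: "of_int (sign ?r) = sgn (vdm (n + k) (\<lambda>x. real (?r x)))"
    by (simp add: sgn_mult)
  have "vdm n (\<lambda>x. real (?r x)) = vdm n (\<lambda>x. real (?y x))"
    unfolding vdm_def by (intro prod.cong refl) (auto simp: site_perm_def)
  moreover have "vdm k (\<lambda>j. real (?r (n + j))) = vdm k (\<lambda>j. real (?z j))"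
    unfolding vdm_def by (intro prod.cong refl) (auto simp: site_perm_def)
  moreover have "(\<Prod>j<k. \<Prod>i<n. real (?r (n + j)) - real (?r i)) = (\<Prod>j<k. \<Prod>i<n. real (?z j) - real (?y i))"
    by (intro prod.cong refl) (auto simp: site_perm_def)
  ultimately have 2: "of_int (sign ?r) = (\<Prod>j<n. \<Prod>i<j. - 1) * (\<Prod>j<k. \<Prod>i<n. sgn (real (?z j) - real (?y i))) * (\<Prod>j<k. \<Prod>i<j. - 1)"
    unfolding 1 vdm_append
    by (simp only: sgn_mult sgn_prod sgn_vdm_decreasing[OF site_decreasing[OF \<mu>]] sgn_vdm_decreasing[OF hole_decreasing[OF \<mu>]])
  have cross: "(\<Prod>i<n. sgn (real (?z j) - real (?y i))) * (- 1) ^ ?z j = (- 1) ^ (n + (k - 1 - j))" if j: "j < k" for j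
  proof -
    let ?S = "{i. i < n \<and> \<mu> i + j < k}"
    have "(\<Prod>i<n. sgn (real (?z j) - real (?y i))) = (\<Prod>i<n. if i \<in> ?S then 1 else - 1)"
    proof (intro prod.cong refl)
      fix i assume "i \<in> {..<n}"
      then show "sgn (real (?z j) - real (?y i)) = (if i \<in> ?S then 1 else - 1)"
        using site_vs_hole[OF \<mu> j, of i] by (auto split: if_splits)
    qed
    also have "\<dots> = (\<Prod>i\<in>{..<n} - ?S. - 1)"
      by (rule prod.mono_neutral_cong_right) auto
    also have "\<dots> = (- 1) ^ (n - card ?S)"
      by (simp add: card_Diff_subset[of ?S "{..<n}"] subset_eq)
    finally have "(\<Prod>i<n. sgn (real (?z j) - real (?y i))) * (- 1) ^ ?z j = (- 1) ^ (n - card ?S + (card ?S + (k - 1 - j)))"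
      by (simp only: hole_eq[OF \<mu> j] power_add)
    moreover have "card ?S \<le> n" using card_mono[of "{..<n}" ?S] by auto
    ultimately show ?thesis by simp
  qed
  have "(\<Prod>j<k. \<Prod>i<n. sgn (real (?z j) - real (?y i))) * (\<Prod>j<k. (- 1) ^ ?z j) = (\<Prod>j<k. (- 1) ^ (n + (k - 1 - j)))"
    unfolding prod.distrib[symmetric] by (intro prod.cong refl) (simp add: cross)
  then show ?thesis unfolding 2 by (simp add: mult_ac)
qed

text \<open>
  Laplace expansion along the first \<open>n\<close> rows. A permutation maps \<open>{..<n}\<close> onto the particle set of exactly
  one diagram; the permutations belonging to \<open>\<mu>\<close> make up the determinant of the matrix with all other
  entries set to zero, which is block diagonal after reordering the columns.
\<close>

lemma leibniz_expand_rows: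
  "leibniz (n + k) f = (\<Sum>\<mu>\<in>diagrams n k. of_int (sign (site_perm n k \<mu>))
      * leibniz n (\<lambda>i j. f i (site n \<mu> j)) * leibniz k (\<lambda>i j. f (n + i) (hole n k \<mu> j)))"
proof -
  let ?N = "n + k" and ?A = "\<lambda>\<mu>. site n \<mu> ` {..<n}"
  \<comment> \<open>The matrix with the entries that are not compatible with the particle set of \<open>\<mu>\<close> set to zero.\<close>
  define g where "g \<mu> i x = (if i < n \<longleftrightarrow> x \<in> ?A \<mu> then f i x else 0)" for \<mu> i x
  have "leibniz ?N f = (\<Sum>p | p permutes {..<?N}. \<Sum>\<mu>\<in>diagrams n k. of_int (sign p) * (\<Prod>i<?N. g \<mu> i (p i)))"
    unfolding leibniz_def
  proof (intro sum.cong refl)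
    fix p assume "p \<in> {p. p permutes {..<?N}}"
    then have p: "p permutes {..<?N}" by simp
    have injp: "inj p" by (rule permutes_inj[OF p])
    have "p ` {..<n} \<subseteq> p ` {..<?N}" by auto
    then have "p ` {..<n} \<subseteq> {..<?N}" by (simp only: permutes_image[OF p])
    moreover have "card (p ` {..<n}) = n" using injp by (simp add: card_image inj_on_subset)
    ultimately obtain \<nu> where \<nu>: "\<nu> \<in> diagrams n k" "?A \<nu> = p ` {..<n}" by (rule site_image_exists)
    have g: "(\<Prod>i<?N. g \<mu> i (p i)) = (if \<mu> = \<nu> then \<Prod>i<?N. f i (p i) else 0)" if \<mu>: "\<mu> \<in> diagrams n k" for \<mu>
    proof (cases "\<mu> = \<nu>")
      case True
      have "p i \<in> p ` {..<n} \<longleftrightarrow> i < n" for i using injp by (simp add: inj_image_mem_iff)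
      then show ?thesis using True \<nu>(2) by (simp add: g_def)
    next
      case False
      have "\<exists>i<?N. \<not> (i < n \<longleftrightarrow> p i \<in> ?A \<mu>)"
      proof (rule ccontr)
        assume "\<not> ?thesis"
        then have "i < n \<longleftrightarrow> p i \<in> ?A \<mu>" if "i < n + k" for i using that by blast
        then have "p i \<in> ?A \<mu>" if "i < n" for i using that by (meson trans_less_add1)
        then have "p ` {..<n} \<subseteq> ?A \<mu>" by blast
        moreover have "card (?A \<mu>) = n" using decreasing_on_inj[OF site_decreasing[OF \<mu>]] by (simp add: card_image)
        ultimately have "p ` {..<n} = ?A \<mu>" using \<open>card (p ` {..<n}) = n\<close> by (intro card_subset_eq) auto
        then show False using site_image_inj[OF \<mu> \<nu>(1)] \<nu>(2) False by simp
      qed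
      then obtain i where i: "i < ?N" "\<not> (i < n \<longleftrightarrow> p i \<in> ?A \<mu>)" by blast
      then have "g \<mu> i (p i) = 0" by (simp only: g_def if_False)
      with i(1) show ?thesis using False by (auto intro!: prod_zero)
    qed
    have "(\<Sum>\<mu>\<in>diagrams n k. of_int (sign p) * (\<Prod>i<?N. g \<mu> i (p i)))
        = (\<Sum>\<mu>\<in>diagrams n k. if \<mu> = \<nu> then of_int (sign p) * (\<Prod>i<?N. f i (p i)) else 0)"
      by (intro sum.cong refl) (simp add: g)
    then show "of_int (sign p) * (\<Prod>i<?N. f i (p i)) = (\<Sum>\<mu>\<in>diagrams n k. of_int (sign p) * (\<Prod>i<?N. g \<mu> i (p i)))"
      using \<nu>(1) finite_diagrams by simp
  qed
  also have "\<dots> = (\<Sum>\<mu>\<in>diagrams n k. leibniz ?N (g \<mu>))"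
    unfolding leibniz_def by (rule sum.swap)
  also have "\<dots> = (\<Sum>\<mu>\<in>diagrams n k. of_int (sign (site_perm n k \<mu>))
      * leibniz n (\<lambda>i j. f i (site n \<mu> j)) * leibniz k (\<lambda>i j. f (n + i) (hole n k \<mu> j)))"
  proof (intro sum.cong refl)
    fix \<mu> assume \<mu>: "\<mu> \<in> diagrams n k"
    let ?r = "site_perm n k \<mu>"
    have site_in: "site n \<mu> j \<in> ?A \<mu>" if "j < n" for j using that by simp
    have hole_notin: "hole n k \<mu> j \<notin> ?A \<mu>" if "j < k" for j
      using site_hole_disjoint[OF \<mu>] that by blast
    have "leibniz ?N (\<lambda>j i. g \<mu> i (?r j)) = of_int (sign ?r) * leibniz ?N (\<lambda>j i. g \<mu> i j)"
      by (rule leibniz_permute_rows[OF site_perm_permutes[OF \<mu>]])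
    then have "leibniz ?N (\<lambda>i j. g \<mu> i (?r j)) = of_int (sign ?r) * leibniz ?N (g \<mu>)"
      by (simp only: leibniz_transpose[of ?N "\<lambda>i j. g \<mu> i (?r j)"] leibniz_transpose[of ?N "g \<mu>"])
    then have "leibniz ?N (g \<mu>) = of_int (sign ?r) * leibniz ?N (\<lambda>i j. g \<mu> i (?r j))"
      by (cases ?r rule: sign_cases) auto
    also have "leibniz ?N (\<lambda>i j. g \<mu> i (?r j)) = leibniz n (\<lambda>i j. g \<mu> i (?r j)) * leibniz k (\<lambda>i j. g \<mu> (n + i) (?r (n + j)))"
      using site_in hole_notin by (intro leibniz_block) (simp_all add: g_def site_perm_def)
    also have "leibniz n (\<lambda>i j. g \<mu> i (?r j)) = leibniz n (\<lambda>i j. f i (site n \<mu> j))"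
      by (intro leibniz_cong) (auto simp: g_def site_perm_def)
    also have "leibniz k (\<lambda>i j. g \<mu> (n + i) (?r (n + j))) = leibniz k (\<lambda>i j. f (n + i) (hole n k \<mu> j))"
      using hole_notin by (intro leibniz_cong) (simp_all add: g_def site_perm_def)
    finally show "leibniz ?N (g \<mu>) = of_int (sign ?r) * leibniz n (\<lambda>i j. f i (site n \<mu> j)) * leibniz k (\<lambda>i j. f (n + i) (hole n k \<mu> j))"
      by (simp add: mult.assoc)
  qed
  finally show ?thesis .
qed

lemma abs_leibniz_reverse_rows: "\<bar>leibniz n (\<lambda>i j. f (n - 1 - i) j)\<bar> = \<bar>leibniz n f\<bar>"
proof -
  define p where "p i = (if i < n then n - 1 - i else i)" for i
  have "p permutes {..<n}"
  proof (rule bij_imp_permutes)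
    have "inj_on p {..<n}" by (auto simp: inj_on_def p_def)
    moreover have "p ` {..<n} \<subseteq> {..<n}" by (auto simp: p_def)
    ultimately show "bij_betw p {..<n} {..<n}" by (simp add: bij_betw_def endo_inj_surj)
  qed (simp add: p_def)
  then have "leibniz n (\<lambda>i j. f (p i) j) = of_int (sign p) * leibniz n f" by (rule leibniz_permute_rows)
  moreover have "leibniz n (\<lambda>i j. f (p i) j) = leibniz n (\<lambda>i j. f (n - 1 - i) j)"
    by (intro leibniz_cong) (simp add: p_def)
  moreover have "\<bar>real_of_int (sign p)\<bar> = 1" by (cases p rule: sign_cases) auto
  ultimately show ?thesis by (simp add: abs_mult)
qed

lemma abs_vdm_reverse: "\<bar>vdm n (\<lambda>i. x (n - 1 - i))\<bar> = \<bar>vdm n x\<bar>"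
  using abs_leibniz_reverse_rows[of n "\<lambda>i j. x i ^ j"] by (simp only: leibniz_vandermonde)

text \<open>
  Clearing denominators reverses the order of the columns.
\<close>

lemma abs_vdm_inverse:
  assumes "\<And>i. i < n \<Longrightarrow> x i \<noteq> 0"
  shows "\<bar>vdm n (\<lambda>i. 1 / x i)\<bar> * (\<Prod>i<n. \<bar>x i\<bar> ^ (n - 1)) = \<bar>vdm n x\<bar>"
proof -
  have "(\<Prod>i<n. x i ^ (n - 1)) * vdm n (\<lambda>i. 1 / x i) = leibniz n (\<lambda>i j. x i ^ (n - 1) * 1 * (1 / x i) ^ j)"
    using leibniz_scale[of n "\<lambda>i. x i ^ (n - 1)" "\<lambda>_. 1" "\<lambda>i j. (1 / x i) ^ j"]
    by (simp add: leibniz_vandermonde)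
  also have "\<dots> = leibniz n (\<lambda>i j. x i ^ (n - 1 - j))"
    using assms by (intro leibniz_cong) (simp add: power_diff power_one_over)
  finally have e: "(\<Prod>i<n. x i ^ (n - 1)) * vdm n (\<lambda>i. 1 / x i) = leibniz n (\<lambda>i j. x i ^ (n - 1 - j))" .
  have "\<bar>vdm n (\<lambda>i. 1 / x i)\<bar> * (\<Prod>i<n. \<bar>x i\<bar> ^ (n - 1)) = \<bar>leibniz n (\<lambda>i j. x i ^ (n - 1 - j))\<bar>"
    unfolding e[symmetric] by (simp add: abs_mult abs_prod power_abs)
  also have "\<dots> = \<bar>leibniz n (\<lambda>i j. x j ^ (n - 1 - i))\<bar>"
    by (simp only: leibniz_transpose[of n "\<lambda>i j. x j ^ (n - 1 - i)"])
  also have "\<dots> = \<bar>leibniz n (\<lambda>i j. x j ^ i)\<bar>"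
    by (rule abs_leibniz_reverse_rows)
  also have "\<dots> = \<bar>vdm n x\<bar>"
    by (simp only: leibniz_transpose[of n "\<lambda>i j. x i ^ j"] leibniz_vandermonde)
  finally show ?thesis .
qed

text \<open>
  Over all sites the Vandermonde product splits into particles, holes and mixed pairs. The differences of
  a particle from all other sites contain the mixed pairs once and the pairs of particles twice.
\<close>

lemma abs_vdm_complement:
  assumes \<mu>: "\<mu> \<in> diagrams n k"
  shows "\<bar>vdm k (\<lambda>j. u (hole n k \<mu> j))\<bar> * (\<Prod>i<n. \<Prod>x\<in>{..<n + k} - {site n \<mu> i}. \<bar>u (site n \<mu> i) - u x\<bar>)
     = \<bar>vdm n (\<lambda>i. u (site n \<mu> i))\<bar> * \<bar>vdm (n + k) u\<bar>"
proof -
  let ?y = "site n \<mu>" and ?z = "hole n k \<mu>" and ?r = "site_perm n k \<mu>"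
  let ?X = "\<Prod>j<k. \<Prod>i<n. \<bar>u (?z j) - u (?y i)\<bar>"
  have injy: "inj_on ?y {..<n}" by (rule decreasing_on_inj[OF site_decreasing[OF \<mu>]])
  have injz: "inj_on ?z {..<k}" by (rule decreasing_on_inj[OF hole_decreasing[OF \<mu>]])
  have "\<bar>real_of_int (sign ?r)\<bar> = 1" by (cases ?r rule: sign_cases) auto
  then have "\<bar>vdm (n + k) u\<bar> = \<bar>vdm (n + k) (\<lambda>i. u (?r i))\<bar>"
    by (simp add: vdm_permute[OF site_perm_permutes[OF \<mu>], of u] abs_mult)
  also have "\<dots> = \<bar>vdm n (\<lambda>i. u (?r i))\<bar> * (\<Prod>j<k. \<Prod>i<n. \<bar>u (?r (n + j)) - u (?r i)\<bar>) * \<bar>vdm k (\<lambda>j. u (?r (n + j)))\<bar>"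
    by (simp add: vdm_append abs_mult abs_prod)
  also have "vdm n (\<lambda>i. u (?r i)) = vdm n (\<lambda>i. u (?y i))"
    unfolding vdm_def by (intro prod.cong refl) (auto simp: site_perm_def)
  also have "vdm k (\<lambda>j. u (?r (n + j))) = vdm k (\<lambda>j. u (?z j))"
    unfolding vdm_def by (intro prod.cong refl) (auto simp: site_perm_def)
  also have "(\<Prod>j<k. \<Prod>i<n. \<bar>u (?r (n + j)) - u (?r i)\<bar>) = ?X"
    by (intro prod.cong refl) (auto simp: site_perm_def)
  finally have 1: "\<bar>vdm (n + k) u\<bar> = \<bar>vdm n (\<lambda>i. u (?y i))\<bar> * ?X * \<bar>vdm k (\<lambda>j. u (?z j))\<bar>" .
  have "(\<Prod>x\<in>{..<n + k} - {?y i}. \<bar>u (?y i) - u x\<bar>)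
      = (\<Prod>l\<in>{..<n} - {i}. \<bar>u (?y i) - u (?y l)\<bar>) * (\<Prod>j<k. \<bar>u (?y i) - u (?z j)\<bar>)" if i: "i < n" for i
  proof -
    have "{..<n + k} - {?y i} = ?y ` ({..<n} - {i}) \<union> ?z ` {..<k}"
      using site_hole_union[OF \<mu>] site_hole_disjoint[OF \<mu>] injy i
      by (auto simp: inj_on_image_set_diff[OF injy] )
    moreover have "?y ` ({..<n} - {i}) \<inter> ?z ` {..<k} = {}" using site_hole_disjoint[OF \<mu>] by blast
    ultimately have "(\<Prod>x\<in>{..<n + k} - {?y i}. \<bar>u (?y i) - u x\<bar>)
        = (\<Prod>x\<in>?y ` ({..<n} - {i}). \<bar>u (?y i) - u x\<bar>) * (\<Prod>x\<in>?z ` {..<k}. \<bar>u (?y i) - u x\<bar>)"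
      by (simp add: prod.union_disjoint)
    moreover have "inj_on ?y ({..<n} - {i})" using injy by (rule inj_on_subset) auto
    ultimately show ?thesis using injz by (simp add: prod.reindex)
  qed
  then have "(\<Prod>i<n. \<Prod>x\<in>{..<n + k} - {?y i}. \<bar>u (?y i) - u x\<bar>)
      = (\<Prod>i<n. \<Prod>l\<in>{..<n} - {i}. \<bar>u (?y i) - u (?y l)\<bar>) * (\<Prod>i<n. \<Prod>j<k. \<bar>u (?y i) - u (?z j)\<bar>)"
    by (simp add: prod.distrib)
  also have "(\<Prod>i<n. \<Prod>j<k. \<bar>u (?y i) - u (?z j)\<bar>) = ?X"
    by (subst prod.swap) (simp add: abs_minus_commute)
  also have "(\<Prod>i<n. \<Prod>l\<in>{..<n} - {i}. \<bar>u (?y i) - u (?y l)\<bar>) = (vdm n (\<lambda>i. u (?y i)))\<^sup>2"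
    by (rule vdm_sq[symmetric])
  finally have "(\<Prod>i<n. \<Prod>x\<in>{..<n + k} - {?y i}. \<bar>u (?y i) - u x\<bar>) = \<bar>vdm n (\<lambda>i. u (?y i))\<bar>\<^sup>2 * ?X"
    by simp
  then show ?thesis unfolding 1 by (simp only: power2_eq_square mult_ac)
qed

text \<open>
  Expand the Vandermonde determinant of the points \<open>q\<^sup>i\<close> and \<open>- r\<^sup>j\<close> along the rows of the former. The
  signs of the holes' alternants and of the reordering cancel up to a common sign.
\<close>

lemma abs_dual_cauchy:
  assumes "0 < q" "0 < r"
  shows "\<bar>\<Sum>\<mu>\<in>diagrams n k. vdm n (\<lambda>i. q ^ site n \<mu> i) * vdm k (\<lambda>j. r ^ hole n k \<mu> j)\<bar>
     = \<bar>vdm n (\<lambda>i. q ^ (n - 1 - i))\<bar> * \<bar>vdm k (\<lambda>j. r ^ (k - 1 - j))\<bar> * (\<Prod>i<n. \<Prod>j<k. q ^ i + r ^ j)"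
proof -
  define \<nu> where "\<nu> i = (if i < n then q ^ i else - (r ^ (i - n)))" for i
  define S :: real where "S = (\<Prod>j<n. \<Prod>i<j. - 1) * (\<Prod>j<k. \<Prod>i<j. - 1) * (\<Prod>j<k. (- 1) ^ (n + (k - 1 - j)))"
  have absS: "\<bar>S\<bar> = 1" by (simp add: S_def abs_mult abs_prod)
  have "vdm (n + k) \<nu> = leibniz (n + k) (\<lambda>i j. \<nu> i ^ j)" by (simp add: leibniz_vandermonde)
  also have "\<dots> = (\<Sum>\<mu>\<in>diagrams n k. of_int (sign (site_perm n k \<mu>))
      * leibniz n (\<lambda>i j. \<nu> i ^ site n \<mu> j) * leibniz k (\<lambda>i j. \<nu> (n + i) ^ hole n k \<mu> j))"
    by (rule leibniz_expand_rows)
  also have "\<dots> = (\<Sum>\<mu>\<in>diagrams n k. S * (vdm n (\<lambda>i. q ^ site n \<mu> i) * vdm k (\<lambda>j. r ^ hole n k \<mu> j)))"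
  proof (intro sum.cong refl)
    fix \<mu> assume \<mu>: "\<mu> \<in> diagrams n k"
    have "leibniz n (\<lambda>i j. \<nu> i ^ site n \<mu> j) = leibniz n (\<lambda>i j. (q ^ site n \<mu> j) ^ i)"
      by (intro leibniz_cong) (simp add: \<nu>_def power_mult[symmetric] mult.commute)
    then have 1: "leibniz n (\<lambda>i j. \<nu> i ^ site n \<mu> j) = vdm n (\<lambda>i. q ^ site n \<mu> i)"
      by (simp only: leibniz_transpose[of n "\<lambda>i j. (q ^ site n \<mu> i) ^ j"] leibniz_vandermonde)
    have "leibniz k (\<lambda>i j. \<nu> (n + i) ^ hole n k \<mu> j) = leibniz k (\<lambda>i j. 1 * (- 1) ^ hole n k \<mu> j * (r ^ hole n k \<mu> j) ^ i)"
      by (intro leibniz_cong) (simp add: \<nu>_def power_mult[symmetric] mult.commute power_minus[of "r ^ _"])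
    also have "\<dots> = (\<Prod>j<k. (- 1) ^ hole n k \<mu> j) * leibniz k (\<lambda>i j. (r ^ hole n k \<mu> j) ^ i)"
      by (subst leibniz_scale) simp
    also have "\<dots> = (\<Prod>j<k. (- 1) ^ hole n k \<mu> j) * vdm k (\<lambda>j. r ^ hole n k \<mu> j)"
      by (simp only: leibniz_transpose[of k "\<lambda>i j. (r ^ hole n k \<mu> i) ^ j"] leibniz_vandermonde)
    finally have 2: "leibniz k (\<lambda>i j. \<nu> (n + i) ^ hole n k \<mu> j) = (\<Prod>j<k. (- 1) ^ hole n k \<mu> j) * vdm k (\<lambda>j. r ^ hole n k \<mu> j)" .
    show "of_int (sign (site_perm n k \<mu>)) * leibniz n (\<lambda>i j. \<nu> i ^ site n \<mu> j) * leibniz k (\<lambda>i j. \<nu> (n + i) ^ hole n k \<mu> j)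
        = S * (vdm n (\<lambda>i. q ^ site n \<mu> i) * vdm k (\<lambda>j. r ^ hole n k \<mu> j))"
      unfolding 1 2 S_def sign_site_perm[OF \<mu>, symmetric] by (simp only: mult_ac)
  qed
  also have "\<dots> = S * (\<Sum>\<mu>\<in>diagrams n k. vdm n (\<lambda>i. q ^ site n \<mu> i) * vdm k (\<lambda>j. r ^ hole n k \<mu> j))"
    by (rule sum_distrib_left[symmetric])
  finally have "\<bar>\<Sum>\<mu>\<in>diagrams n k. vdm n (\<lambda>i. q ^ site n \<mu> i) * vdm k (\<lambda>j. r ^ hole n k \<mu> j)\<bar> = \<bar>vdm (n + k) \<nu>\<bar>"
    using absS by (simp add: abs_mult)
  also have "\<dots> = \<bar>vdm n \<nu>\<bar> * (\<Prod>j<k. \<Prod>i<n. \<bar>\<nu> (n + j) - \<nu> i\<bar>) * \<bar>vdm k (\<lambda>j. \<nu> (n + j))\<bar>"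
    by (simp add: vdm_append abs_mult abs_prod)
  also have "\<bar>vdm n \<nu>\<bar> = \<bar>vdm n (\<lambda>i. q ^ (n - 1 - i))\<bar>"
  proof -
    have "vdm n \<nu> = vdm n (\<lambda>i. q ^ i)" unfolding vdm_def by (intro prod.cong refl) (auto simp: \<nu>_def)
    then show ?thesis using abs_vdm_reverse[of n "\<lambda>i. q ^ i"] by simp
  qed
  also have "\<bar>vdm k (\<lambda>j. \<nu> (n + j))\<bar> = \<bar>vdm k (\<lambda>j. r ^ (k - 1 - j))\<bar>"
  proof -
    have "\<bar>vdm k (\<lambda>j. \<nu> (n + j))\<bar> = \<bar>vdm k (\<lambda>j. r ^ j)\<bar>"
      unfolding vdm_def abs_prod by (intro prod.cong refl) (auto simp: \<nu>_def abs_minus_commute)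
    then show ?thesis using abs_vdm_reverse[of k "\<lambda>i. r ^ i"] by simp
  qed
  also have "(\<Prod>j<k. \<Prod>i<n. \<bar>\<nu> (n + j) - \<nu> i\<bar>) = (\<Prod>j<k. \<Prod>i<n. q ^ i + r ^ j)"
  proof (intro prod.cong refl)
    fix j i assume "j \<in> {..<k}" "i \<in> {..<n}"
    moreover have "0 < q ^ i" "0 < r ^ j" using assms by auto
    ultimately show "\<bar>\<nu> (n + j) - \<nu> i\<bar> = q ^ i + r ^ j" by (simp add: \<nu>_def)
  qed
  also have "\<dots> = (\<Prod>i<n. \<Prod>j<k. q ^ i + r ^ j)" by (rule prod.swap)
  finally show ?thesis by (simp add: mult_ac)
qed

text \<open>
  For \<open>q < 1\<close> all factors of both products are positive, for \<open>q > 1\<close> all are negative.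
\<close>

lemma vdm_power_ratio_pos:
  assumes q: "0 < (q::real)" "q \<noteq> 1" and e: "decreasing_on n e" "decreasing_on n e'"
  shows "0 < vdm n (\<lambda>i. q ^ e i) / vdm n (\<lambda>i. q ^ e' i)"
  unfolding vdm_def prod_dividef[symmetric]
proof (intro prod_pos)
  fix j i assume ji: "j \<in> {..<n}" "i \<in> {..<j}"
  have lt: "e j < e i" "e' j < e' i" using e ji by (auto simp: decreasing_on_def)
  show "0 < (q ^ e j - q ^ e i) / (q ^ e' j - q ^ e' i)"
  proof (cases "q < 1")
    case True
    then have "q ^ e i < q ^ e j" "q ^ e' i < q ^ e' j"
      using q lt by (auto intro: power_strict_decreasing)
    then show ?thesis by simp
  next
    case False
    then have "1 < q" using q by simp
    then have "q ^ e j < q ^ e i" "q ^ e' j < q ^ e' i"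
      using lt by (auto intro: power_strict_increasing)
    then show ?thesis by (simp add: divide_neg_neg)
  qed
qed

lemma staircase_decreasing: "decreasing_on n (\<lambda>i. n - 1 - i)"
  by (auto simp: decreasing_on_def)

lemma skew_howe_weight_eq:
  "skew_howe_weight n k q r \<mu> =
     (vdm n (\<lambda>i. q ^ site n \<mu> i) / vdm n (\<lambda>i. q ^ (n - 1 - i)))
     * (vdm k (\<lambda>j. r ^ hole n k \<mu> j) / vdm k (\<lambda>j. r ^ (k - 1 - j))) / (\<Prod>i<n. \<Prod>j<k. q ^ i + r ^ j)"
  by (simp add: skew_howe_weight_def schur_def alternant_eq_vdm site_def hole_def)

lemma skew_howe_weight_pos:
  assumes "0 < q" "q \<noteq> 1" "0 < r" "r \<noteq> 1" "\<mu> \<in> diagrams n k"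
  shows "0 < skew_howe_weight n k q r \<mu>"
  unfolding skew_howe_weight_eq using assms
  by (intro divide_pos_pos mult_pos_pos vdm_power_ratio_pos prod_pos site_decreasing hole_decreasing staircase_decreasing)
     (auto intro!: add_pos_pos prod_pos)

text \<open>
  The dual Cauchy identity up to sign; the sign is settled by positivity of the weights.
\<close>

lemma sum_skew_howe_weight:
  assumes q: "0 < q" "q \<noteq> 1" and r: "0 < r" "r \<noteq> 1"
  shows "(\<Sum>\<mu>\<in>diagrams n k. skew_howe_weight n k q r \<mu>) = 1"
proof -
  let ?a = "vdm n (\<lambda>i. q ^ (n - 1 - i))" and ?b = "vdm k (\<lambda>j. r ^ (k - 1 - j))" and ?c = "\<Prod>i<n. \<Prod>j<k. q ^ i + r ^ j"
  have c: "0 < ?c" using q r by (intro prod_pos) (auto intro!: add_pos_pos)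
  have a: "?a \<noteq> 0" using vdm_power_ratio_pos[OF q staircase_decreasing staircase_decreasing, of n] by auto
  have b: "?b \<noteq> 0" using vdm_power_ratio_pos[OF r staircase_decreasing staircase_decreasing, of k] by auto
  have "(\<Sum>\<mu>\<in>diagrams n k. skew_howe_weight n k q r \<mu>)
     = (\<Sum>\<mu>\<in>diagrams n k. vdm n (\<lambda>i. q ^ site n \<mu> i) * vdm k (\<lambda>j. r ^ hole n k \<mu> j)) / (?a * ?b * ?c)"
    by (simp add: skew_howe_weight_eq sum_divide_distrib)
  then have "\<bar>\<Sum>\<mu>\<in>diagrams n k. skew_howe_weight n k q r \<mu>\<bar> = \<bar>?a\<bar> * \<bar>?b\<bar> * ?c / (\<bar>?a\<bar> * \<bar>?b\<bar> * ?c)"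
    by (simp only: abs_divide abs_mult abs_dual_cauchy[OF q(1) r(1)] abs_of_pos[OF c])
  also have "\<dots> = 1"
    using a b c by (intro divide_self) (metis abs_eq_0 less_irrefl mult_eq_0_iff)
  finally have "\<bar>\<Sum>\<mu>\<in>diagrams n k. skew_howe_weight n k q r \<mu>\<bar> = 1" .
  moreover have "0 \<le> (\<Sum>\<mu>\<in>diagrams n k. skew_howe_weight n k q r \<mu>)"
    using skew_howe_weight_pos[OF q r] by (intro sum_nonneg) (simp add: less_imp_le)
  ultimately show ?thesis by simp
qed

section \<open>Gaussian limits from moments\<close>

lemma gauss_moment_odd: "gauss_moment v (Suc (2 * j)) = 0"
  by (induction j) simp_all

lemma gauss_moment_even: "gauss_moment v (2 * j) / fact (2 * j) = (v / 2) ^ j / fact j"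
proof (induction j)
  case (Suc j)
  have "gauss_moment v (2 * Suc j) / fact (2 * Suc j)
      = real (Suc (2 * j)) * v * gauss_moment v (2 * j) / (real (Suc (Suc (2 * j))) * (real (Suc (2 * j)) * fact (2 * j)))"
    by (simp add: fact_Suc del: of_nat_Suc)
  also have "\<dots> = v / real (Suc (Suc (2 * j))) * (gauss_moment v (2 * j) / fact (2 * j))"
    by (simp del: of_nat_Suc)
  also have "\<dots> = v / (2 * real (Suc j)) * ((v / 2) ^ j / fact j)"
    by (simp only: Suc) simp
  also have "\<dots> = (v / 2) ^ Suc j / fact (Suc j)"
    by (simp add: fact_Suc del: of_nat_Suc)
  finally show ?case .
qed simp

lemma gauss_moment_series:
  "(\<Sum>m\<le>2 * j. (\<i> * complex_of_real t) ^ m / fact m * complex_of_real (gauss_moment v m))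
     = complex_of_real (\<Sum>i\<le>j. (- (v * t\<^sup>2 / 2)) ^ i / fact i)"
proof (induction j)
  case (Suc j)
  have "(\<i> * complex_of_real t) ^ (2 * Suc j) = complex_of_real ((- (t\<^sup>2)) ^ Suc j)"
    by (simp only: power_mult) (simp add: power_mult_distrib)
  then have "(\<i> * complex_of_real t) ^ (2 * Suc j) / fact (2 * Suc j) * complex_of_real (gauss_moment v (2 * Suc j))
     = complex_of_real ((- (t\<^sup>2)) ^ Suc j / fact (2 * Suc j) * gauss_moment v (2 * Suc j))"
    by (simp only: of_real_mult of_real_divide of_real_fact)
  also have "(- (t\<^sup>2)) ^ Suc j / fact (2 * Suc j) * gauss_moment v (2 * Suc j)
     = (- (t\<^sup>2)) ^ Suc j * (gauss_moment v (2 * Suc j) / fact (2 * Suc j))"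
    by (simp only: times_divide_eq_left times_divide_eq_right)
  also have "complex_of_real \<dots> = complex_of_real ((- (v * t\<^sup>2 / 2)) ^ Suc j / fact (Suc j))"
  proof -
    have "(- (t\<^sup>2)) ^ Suc j * (v / 2) ^ Suc j = (- (v * t\<^sup>2 / 2)) ^ Suc j"
      by (simp only: power_mult_distrib[symmetric]) (simp add: mult_ac)
    then show ?thesis by (simp only: gauss_moment_even times_divide_eq_right)
  qed
  finally have e: "(\<i> * complex_of_real t) ^ Suc (Suc (2 * j)) / fact (Suc (Suc (2 * j))) * complex_of_real (gauss_moment v (Suc (Suc (2 * j))))
      = complex_of_real ((- (v * t\<^sup>2 / 2)) ^ Suc j / fact (Suc j))" by simp
  have "2 * Suc j = Suc (Suc (2 * j))" by simp
  then show ?case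
    by (simp only: sum.atMost_Suc Suc e gauss_moment_odd) simp
qed simp

text \<open>
  Taylor expansion of the characteristic function to even order \<open>2 j\<close>: the remainder is controlled by the
  moment of that order, whose limit is, up to the factor \<open>2\<close>, a term of the exponential series and hence
  small for large \<open>j\<close>.
\<close>

theorem char_tendsto_gaussian_if_moments_tendsto:
  fixes M :: "nat \<Rightarrow> 'a measure" and Y :: "nat \<Rightarrow> 'a \<Rightarrow> real"
  assumes prob: "\<And>n. prob_space (M n)" and meas: "\<And>n. Y n \<in> borel_measurable (M n)"
    and int: "\<And>n m. integrable (M n) (\<lambda>\<omega>. Y n \<omega> ^ m)"
    and lim: "\<And>m. (\<lambda>n. integral\<^sup>L (M n) (\<lambda>\<omega>. Y n \<omega> ^ m)) \<longlonglongrightarrow> gauss_moment v m"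
    and v: "0 \<le> v"
  shows "(\<lambda>n. char (distr (M n) borel (Y n)) t) \<longlonglongrightarrow> complex_of_real (exp (- (v * t\<^sup>2 / 2)))"
proof (rule tendstoI)
  fix e :: real assume e: "0 < e"
  define z where "z = v * t\<^sup>2 / 2"
  have z: "0 \<le> z" using v by (simp add: z_def)
  define S where "S j = (\<Sum>i\<le>j. (- z) ^ i / fact i)" for j
  have "(\<lambda>n. (- z) ^ n / fact n) sums exp (- z)"
    using exp_converges[of "- z"] by (simp add: scaleR_conv_of_real divide_inverse mult.commute)
  then have "S \<longlonglongrightarrow> exp (- z)"
    unfolding sums_def_le S_def .
  then have 1: "\<forall>\<^sub>F j in sequentially. dist (S j) (exp (- z)) < e / 4"
    using e by (intro tendstoD) auto
  have "(\<lambda>j. z ^ j / fact j) \<longlonglongrightarrow> 0"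
    using summable_LIMSEQ_zero[OF summable_exp_generic[of z]] by (simp add: divide_inverse mult.commute)
  then have 2: "\<forall>\<^sub>F j in sequentially. dist (z ^ j / fact j) 0 < e / 8"
    using e by (intro tendstoD) auto
  obtain j where j: "dist (S j) (exp (- z)) < e / 4" "z ^ j / fact j < e / 8"
    using eventually_conj[OF 1 2] z unfolding eventually_sequentially
    by (auto simp: dist_real_def)
  define A where "A n = (\<Sum>m\<le>2 * j. (\<i> * complex_of_real t) ^ m / fact m * complex_of_real (integral\<^sup>L (M n) (\<lambda>\<omega>. Y n \<omega> ^ m)))" for n
  define B where "B n = 2 * \<bar>t\<bar> ^ (2 * j) / fact (2 * j) * integral\<^sup>L (M n) (\<lambda>\<omega>. Y n \<omega> ^ (2 * j))" for n
  have approx: "cmod (char (distr (M n) borel (Y n)) t - A n) \<le> B n" for n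
  proof -
    have "cmod (char (distr (M n) borel (Y n)) t - A n) \<le> (2 * \<bar>t\<bar> ^ (2 * j) / fact (2 * j)) * integral\<^sup>L (M n) (\<lambda>\<omega>. \<bar>Y n \<omega>\<bar> ^ (2 * j))"
      unfolding A_def by (rule prob_space.char_approx1'[OF prob int meas refl])
    then show ?thesis by (simp add: B_def power_even_abs)
  qed
  have "A \<longlonglongrightarrow> (\<Sum>m\<le>2 * j. (\<i> * complex_of_real t) ^ m / fact m * complex_of_real (gauss_moment v m))"
    unfolding A_def by (intro tendsto_intros lim)
  then have "A \<longlonglongrightarrow> complex_of_real (S j)"
    by (simp only: gauss_moment_series S_def z_def)
  then have A: "\<forall>\<^sub>F n in sequentially. dist (A n) (complex_of_real (S j)) < e / 4"
    using e by (intro tendstoD) auto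
  have "B \<longlonglongrightarrow> 2 * \<bar>t\<bar> ^ (2 * j) / fact (2 * j) * gauss_moment v (2 * j)"
    unfolding B_def by (intro tendsto_intros lim)
  also have "2 * \<bar>t\<bar> ^ (2 * j) / fact (2 * j) * gauss_moment v (2 * j) = 2 * (z ^ j / fact j)"
  proof -
    have "2 * \<bar>t\<bar> ^ (2 * j) / fact (2 * j) * gauss_moment v (2 * j) = 2 * (t\<^sup>2) ^ j * (gauss_moment v (2 * j) / fact (2 * j))"
      by (simp add: power_even_abs power_mult)
    also have "\<dots> = 2 * ((t\<^sup>2) ^ j * (v / 2) ^ j) / fact j" by (simp only: gauss_moment_even) simp
    also have "(t\<^sup>2) ^ j * (v / 2) ^ j = z ^ j"
      by (simp only: power_mult_distrib[symmetric]) (simp add: z_def mult_ac)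
    finally show ?thesis by simp
  qed
  finally have Blim: "B \<longlonglongrightarrow> 2 * (z ^ j / fact j)" .
  have "2 * (z ^ j / fact j) < e / 4" using j(2) by (simp add: mult.commute)
  from order_tendstoD(2)[OF Blim this] have "\<forall>\<^sub>F n in sequentially. B n < e / 4" .
  with A show "\<forall>\<^sub>F n in sequentially. dist (char (distr (M n) borel (Y n)) t) (complex_of_real (exp (- (v * t\<^sup>2 / 2)))) < e"
  proof eventually_elim
    case (elim n)
    have "dist (complex_of_real (S j)) (complex_of_real (exp (- z))) < e / 4"
      using j by (simp add: dist_norm norm_of_real flip: of_real_diff)
    moreover have "dist (char (distr (M n) borel (Y n)) t) (A n) < e / 4"
      using approx[of n] elim by (simp add: dist_norm)
    ultimately have "dist (char (distr (M n) borel (Y n)) t) (complex_of_real (exp (- z))) < e"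
      using elim(1) e dist_triangle_lt by metric
    then show ?case by (simp add: z_def)
  qed
qed

text \<open>
  The exponential is \<open>1\<close>-Lipschitz on the imaginary axis, and the first absolute moment is bounded by the
  second moment.
\<close>

lemma char_diff_le:
  assumes "prob_space M" and Y: "Y \<in> borel_measurable M" and Z: "Z \<in> borel_measurable M"
    and int: "integrable M (\<lambda>\<omega>. (Y \<omega> - Z \<omega>)\<^sup>2)"
  shows "cmod (char (distr M borel Y) t - char (distr M borel Z) t) \<le> \<bar>t\<bar> * sqrt (integral\<^sup>L M (\<lambda>\<omega>. (Y \<omega> - Z \<omega>)\<^sup>2))"
proof -
  interpret prob_space M by fact
  let ?W = "\<lambda>\<omega>. \<bar>Y \<omega> - Z \<omega>\<bar>"
  have [measurable]: "Y \<in> borel_measurable M" "Z \<in> borel_measurable M" by fact+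
  have W: "integrable M ?W"
    by (rule square_integrable_imp_integrable) (use int in auto)
  have i: "integrable M (\<lambda>\<omega>. iexp (t * Y \<omega>))" "integrable M (\<lambda>\<omega>. iexp (t * Z \<omega>))"
    by (intro integrable_const_bound[of _ 1]; auto)+
  have c: "char (distr M borel X) t = expectation (\<lambda>\<omega>. iexp (t * X \<omega>))"
    if "X \<in> borel_measurable M" for X
    unfolding char_def using that by (subst integral_distr) auto
  have "cmod (char (distr M borel Y) t - char (distr M borel Z) t)
      = cmod (integral\<^sup>L M (\<lambda>\<omega>. iexp (t * Y \<omega>) - iexp (t * Z \<omega>)))"
    by (simp only: c[OF Y] c[OF Z] Bochner_Integration.integral_diff[OF i])
  also have "\<dots> \<le> integral\<^sup>L M (\<lambda>\<omega>. cmod (iexp (t * Y \<omega>) - iexp (t * Z \<omega>)))"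
    by (rule integral_norm_bound)
  also have "\<dots> \<le> integral\<^sup>L M (\<lambda>\<omega>. \<bar>t\<bar> * ?W \<omega>)"
  proof (rule integral_mono)
    fix \<omega>
    have "iexp (t * Y \<omega>) - iexp (t * Z \<omega>) = iexp (t * Z \<omega>) * (iexp (t * (Y \<omega> - Z \<omega>)) - 1)"
      by (simp add: algebra_simps exp_add[symmetric])
    then have "cmod (iexp (t * Y \<omega>) - iexp (t * Z \<omega>)) = cmod (iexp (t * (Y \<omega> - Z \<omega>)) - 1)"
      by (simp add: norm_mult)
    also have "\<dots> \<le> \<bar>t * (Y \<omega> - Z \<omega>)\<bar>"
      using iexp_approx1[of "t * (Y \<omega> - Z \<omega>)" 0] by simp
    finally show "cmod (iexp (t * Y \<omega>) - iexp (t * Z \<omega>)) \<le> \<bar>t\<bar> * ?W \<omega>" by (simp add: abs_mult)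
  qed (use i W in auto)
  also have "\<dots> = \<bar>t\<bar> * expectation ?W" by simp
  also have "expectation ?W \<le> sqrt (expectation (\<lambda>\<omega>. (?W \<omega>)\<^sup>2))"
  proof (rule real_le_rsqrt)
    have "0 \<le> variance ?W" by (rule variance_positive)
    also have "variance ?W = expectation (\<lambda>\<omega>. (?W \<omega>)\<^sup>2) - (expectation ?W)\<^sup>2"
      by (rule variance_eq) (use int W in auto)
    finally show "(expectation ?W)\<^sup>2 \<le> expectation (\<lambda>\<omega>. (?W \<omega>)\<^sup>2)" by simp
  qed
  finally show ?thesis by (simp add: mult_left_mono)
qed

lemma real_distribution_centered_normal:
  assumes "0 \<le> v"
  shows "real_distribution (centered_normal v)"
proof (cases "v = 0")
  case True
  then show ?thesis
    by (auto simp: centered_normal_def real_distribution_def real_distribution_axioms_def intro: prob_space_return)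
next
  case False
  then show ?thesis using assms prob_space_normal_density[of "sqrt v" 0]
    by (auto simp: centered_normal_def real_distribution_def real_distribution_axioms_def)
qed

text \<open>
  A centred normal law is a scaled standard one.
\<close>

lemma char_centered_normal:
  assumes v: "0 \<le> v"
  shows "char (centered_normal v) t = complex_of_real (exp (- (v * t\<^sup>2 / 2)))"
proof (cases "v = 0")
  case True
  then show ?thesis by (simp add: centered_normal_def char_def integral_return)
next
  case False
  define s where "s = sqrt v"
  have s: "0 < s" using v False by (simp add: s_def)
  interpret std: real_distribution std_normal_distribution by (rule real_dist_normal_dist)
  have "distributed std_normal_distribution lborel (\<lambda>x. x) (normal_density 0 1)"
    by (auto simp: distributed_def intro!: distr_id2)
  then have "distributed std_normal_distribution lborel (\<lambda>x. 0 + s * x) (normal_density (0 + s * 0) (\<bar>s\<bar> * 1))"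
    using s by (intro std.normal_density_affine) auto
  then have "distr std_normal_distribution lborel (\<lambda>x. s * x) = density lborel (normal_density 0 s)"
    using s by (simp add: distributed_def)
  then have "centered_normal v = distr std_normal_distribution lborel (\<lambda>x. s * x)"
    using False by (simp add: centered_normal_def s_def)
  then have "char (centered_normal v) t = char std_normal_distribution (t * s)"
    unfolding char_def by (simp add: integral_distr mult.assoc)
  also have "\<dots> = complex_of_real (exp (- (v * t\<^sup>2 / 2)))"
    using v by (simp add: char_std_normal_distribution s_def power_mult_distrib mult.commute)
  finally show ?thesis .
qed

section \<open>The skew Howe measure as an orthogonal polynomial ensemble\<close>

text \<open>
  The absolute derivative, at the node \<open>t\<^sup>x\<close>, of the monic polynomial that vanishes at all nodes.
\<close>

definition node_gap :: "real \<Rightarrow> nat \<Rightarrow> nat \<Rightarrow> real" where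
  "node_gap t M x = (\<Prod>y\<in>{..<M} - {x}. \<bar>t ^ x - t ^ y\<bar>)"

text \<open>
  The one-particle weight of both measures: \<open>E = k\<close> in case (A) and \<open>E = 1\<close> in case (B).
\<close>

definition node_weight :: "real \<Rightarrow> nat \<Rightarrow> nat \<Rightarrow> nat \<Rightarrow> nat \<Rightarrow> real" where
  "node_weight t n M E x = (t ^ x) ^ E / ((t ^ x) ^ n * node_gap t M x)"

lemma node_gap_pos:
  assumes "0 < t" "t \<noteq> 1"
  shows "0 < node_gap t M x"
  unfolding node_gap_def using power_inj_base[OF assms] by (intro prod_pos) auto

lemma node_weight_pos: "0 < t \<Longrightarrow> t \<noteq> 1 \<Longrightarrow> 0 < node_weight t n M E x"
  by (simp add: node_weight_def node_gap_pos)

text \<open>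
  Multiplication by \<open>t\<close> shifts the nodes by one place; only the two extreme nodes have no partner.
\<close>

lemma node_gap_Suc:
  assumes t: "0 < t" and x: "x < N"
  shows "node_gap t (Suc N) (Suc x) * \<bar>t ^ x - t ^ N\<bar> = \<bar>t ^ Suc x - 1\<bar> * t ^ (N - 1) * node_gap t (Suc N) x"
proof -
  let ?R = "\<Prod>y\<in>{..<N} - {x}. \<bar>t ^ x - t ^ y\<bar>"
  have "{..<Suc N} - {x} = insert N ({..<N} - {x})" using x by auto
  then have 1: "node_gap t (Suc N) x = \<bar>t ^ x - t ^ N\<bar> * ?R" by (simp add: node_gap_def)
  have "{..<Suc N} - {Suc x} = insert 0 (Suc ` ({..<N} - {x}))"
  proof (intro equalityI subsetI)
    fix y assume "y \<in> {..<Suc N} - {Suc x}"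
    then show "y \<in> insert 0 (Suc ` ({..<N} - {x}))" by (cases y) auto
  qed auto
  then have "node_gap t (Suc N) (Suc x) = \<bar>t ^ Suc x - 1\<bar> * (\<Prod>y\<in>Suc ` ({..<N} - {x}). \<bar>t ^ Suc x - t ^ y\<bar>)"
    by (simp add: node_gap_def)
  also have "(\<Prod>y\<in>Suc ` ({..<N} - {x}). \<bar>t ^ Suc x - t ^ y\<bar>) = (\<Prod>y\<in>{..<N} - {x}. t * \<bar>t ^ x - t ^ y\<bar>)"
  proof (subst prod.reindex)
    show "prod ((\<lambda>y. \<bar>t ^ Suc x - t ^ y\<bar>) \<circ> Suc) ({..<N} - {x}) = (\<Prod>y\<in>{..<N} - {x}. t * \<bar>t ^ x - t ^ y\<bar>)"
    proof (intro prod.cong refl)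
      fix y
      have "t ^ Suc x - t ^ Suc y = t * (t ^ x - t ^ y)" by (simp add: algebra_simps)
      then show "((\<lambda>y. \<bar>t ^ Suc x - t ^ y\<bar>) \<circ> Suc) y = t * \<bar>t ^ x - t ^ y\<bar>"
        using t by (simp add: abs_mult)
    qed
  qed auto
  also have "\<dots> = t ^ (N - 1) * ?R"
    using x by (simp add: prod.distrib)
  finally show ?thesis unfolding 1 by simp
qed

lemma balance_identity:
  fixes u a t b A B' tE tn G0 G1 p :: real
  assumes pos: "0 < u" "0 < t" "0 < B'" "0 < tn" "0 < G0" "0 < G1"
    and p: "p * tE = tn * (t * b)" and G: "G1 * (u * (a - 1)) = (t * u - 1) * b * G0"
  shows "A / (B' * G0) * (1 - a) = tE * A / (tn * B' * G1) * (- p * (1 - 1 / (t * u)))"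
proof -
  have "tE * A / (tn * B' * G1) * (- p * (1 - 1 / (t * u))) = - (p * tE) * A * (t * u - 1) / (tn * B' * G1 * (t * u))"
    using pos by (simp add: field_simps)
  also have "\<dots> = - (tn * t) * (b * A * (t * u - 1)) / ((tn * t) * (B' * G1 * u))"
    unfolding p by (simp add: mult_ac)
  also have "\<dots> = - (b * A * (t * u - 1)) / (B' * G1 * u)"
    using pos by simp
  also have "\<dots> = - (A * (a - 1)) / (B' * G0)"
  proof -
    have "b * A * (t * u - 1) * (B' * G0) = A * B' * ((t * u - 1) * b * G0)" by (simp add: mult_ac)
    also have "\<dots> = A * B' * (G1 * (u * (a - 1)))" by (simp only: G)
    finally have "- (b * A * (t * u - 1)) * (B' * G0) = - (A * (a - 1)) * (B' * G1 * u)" by (simp add: mult_ac)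
    then show ?thesis using pos by (simp add: frac_eq_eq)
  qed
  finally show ?thesis by (simp add: algebra_simps)
qed

text \<open>
  The condition on \<open>p\<close> is what identifies the parameter of the \<open>q\<close>-Krawtchouk weight.
\<close>

lemma node_weight_balance:
  assumes t: "0 < t" "t \<noteq> 1" and p: "p * t ^ E = t ^ (n + N)" and x: "x < N"
  shows "node_weight t n (Suc N) E x * (1 - t ^ (N - x)) = node_weight t n (Suc N) E (Suc x) * (- p * (1 - 1 / t ^ Suc x))"
proof -
  define u where "u = t ^ x"
  define a where "a = t ^ (N - x)"
  define s :: real where "s = (if 1 < t then 1 else - 1)"
  have s: "s \<noteq> 0" by (simp add: s_def)
  have tN: "t ^ N = u * a" using x by (simp add: u_def a_def power_add[symmetric])
  have u: "0 < u" using t by (simp add: u_def)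
  have abs1: "\<bar>u - u * a\<bar> = s * (u * (a - 1))"
  proof (cases "1 < t")
    case True
    then have "1 < a" using x by (simp add: a_def)
    then have "0 < u * (a - 1)" using u by simp
    then show ?thesis using True by (simp add: s_def algebra_simps)
  next
    case False
    then have "a < 1" using x t by (simp add: a_def power_less_one_iff)
    then have "u * (a - 1) < 0" using u by (simp add: mult_pos_neg)
    then show ?thesis using False by (simp add: s_def algebra_simps)
  qed
  have abs2: "\<bar>t ^ Suc x - 1\<bar> = s * (t * u - 1)"
  proof (cases "1 < t")
    case True
    then have "1 < t ^ Suc x" by (intro one_less_power) auto
    then show ?thesis using True by (simp add: s_def u_def)
  next
    case False
    then have "t ^ Suc x < 1" using t by (intro power_Suc_less_one) auto
    then show ?thesis using False by (simp add: s_def u_def)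
  qed
  have "s * (node_gap t (Suc N) (Suc x) * (u * (a - 1))) = s * ((t * u - 1) * t ^ (N - 1) * node_gap t (Suc N) x)"
    using node_gap_Suc[OF t(1) x] unfolding tN abs2 u_def[symmetric] abs1 by (simp only: mult_ac)
  then have G: "node_gap t (Suc N) (Suc x) * (u * (a - 1)) = (t * u - 1) * t ^ (N - 1) * node_gap t (Suc N) x"
    using s by simp
  have "t ^ N = t * t ^ (N - 1)" using x by (cases N) auto
  then have p': "p * t ^ E = t ^ n * (t * t ^ (N - 1))" using p by (simp add: power_add)
  have "u ^ E / (u ^ n * node_gap t (Suc N) x) * (1 - a)
      = t ^ E * u ^ E / (t ^ n * u ^ n * node_gap t (Suc N) (Suc x)) * (- p * (1 - 1 / (t * u)))"
    by (rule balance_identity[OF u t(1) _ _ _ _ p' G]) (use u t node_gap_pos[OF t] in auto)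
  then show ?thesis
    by (simp add: node_weight_def u_def[symmetric] a_def[symmetric] power_mult_distrib)
qed

text \<open>
  Both Schur polynomials are brought to the nodes \<open>t\<^sup>x\<close>. The factors that appear when inverting the points
  \<open>q\<^sup>x\<close> are one-particle factors; for the holes they are a constant divided by the same factors of the
  particles.
\<close>

lemma weight_eq_vdm:
  assumes n: "1 \<le> n" "1 \<le> k" and t: "0 < t" "t \<noteq> 1" and q: "q = 1 / t"
    and r: "(r = q \<and> E = k) \<or> (r = t \<and> E = 1)"
  obtains \<kappa> where "\<And>\<mu>. \<mu> \<in> diagrams n k \<Longrightarrow>
    skew_howe_weight n k q r \<mu> = \<kappa> * ((vdm n (\<lambda>i. t ^ site n \<mu> i))\<^sup>2 * (\<Prod>i<n. node_weight t n (n + k) E (site n \<mu> i)))"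
proof -
  have q': "0 < q" "q \<noteq> 1" and r': "0 < r" "r \<noteq> 1" using t q r by auto
  define c0 where "c0 = 1 / (\<bar>vdm n (\<lambda>i. q ^ (n - 1 - i))\<bar> * \<bar>vdm k (\<lambda>j. r ^ (k - 1 - j))\<bar> * (\<Prod>i<n. \<Prod>j<k. q ^ i + r ^ j))"
  define C where "C = \<bar>vdm (n + k) (\<lambda>x. t ^ x)\<bar>"
  define D where "D = (\<Prod>x<n + k. (t ^ x) ^ (k - 1))"
  have D: "0 < D" unfolding D_def using t by (intro prod_pos) auto
  have main: "\<exists>\<kappa>. \<forall>\<mu>\<in>diagrams n k. \<bar>vdm k (\<lambda>j. r ^ hole n k \<mu> j)\<bar>
      = \<kappa> * (\<bar>vdm n (\<lambda>i. t ^ site n \<mu> i)\<bar> / (\<Prod>i<n. node_gap t (n + k) (site n \<mu> i)) * (\<Prod>i<n. (t ^ site n \<mu> i) ^ (E - 1)))"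
  proof -
    have base: "\<bar>vdm k (\<lambda>j. t ^ hole n k \<mu> j)\<bar> = C * (\<bar>vdm n (\<lambda>i. t ^ site n \<mu> i)\<bar> / (\<Prod>i<n. node_gap t (n + k) (site n \<mu> i)))"
      if \<mu>: "\<mu> \<in> diagrams n k" for \<mu>
    proof -
      have "0 < (\<Prod>i<n. node_gap t (n + k) (site n \<mu> i))" by (intro prod_pos) (simp add: node_gap_pos[OF t])
      then have nz: "(\<Prod>i<n. node_gap t (n + k) (site n \<mu> i)) \<noteq> 0" by (rule less_imp_neq[symmetric])
      have "\<bar>vdm k (\<lambda>j. t ^ hole n k \<mu> j)\<bar> * (\<Prod>i<n. node_gap t (n + k) (site n \<mu> i)) = \<bar>vdm n (\<lambda>i. t ^ site n \<mu> i)\<bar> * C"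
        unfolding node_gap_def C_def by (rule abs_vdm_complement[OF \<mu>])
      from eq_divide_imp[OF nz this] show ?thesis by (simp only: times_divide_eq_right mult.commute)
    qed
    from r show ?thesis
    proof
      assume "r = t \<and> E = 1"
      then show ?thesis using base by (intro exI[of _ C]) simp
    next
      assume rE: "r = q \<and> E = k"
      show ?thesis
      proof (intro exI[of _ "C / D"] ballI)
        fix \<mu> assume \<mu>: "\<mu> \<in> diagrams n k"
        let ?y = "site n \<mu>" and ?z = "hole n k \<mu>"
        have "\<bar>vdm k (\<lambda>j. 1 / t ^ ?z j)\<bar> * (\<Prod>j<k. \<bar>t ^ ?z j\<bar> ^ (k - 1)) = \<bar>vdm k (\<lambda>j. t ^ ?z j)\<bar>"
          by (rule abs_vdm_inverse) (use t in auto)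
        then have 1: "\<bar>vdm k (\<lambda>j. r ^ ?z j)\<bar> * (\<Prod>j<k. (t ^ ?z j) ^ (k - 1)) = \<bar>vdm k (\<lambda>j. t ^ ?z j)\<bar>"
          using rE q t by (simp add: power_one_over)
        have 2: "(\<Prod>i<n. (t ^ ?y i) ^ (k - 1)) * (\<Prod>j<k. (t ^ ?z j) ^ (k - 1)) = D"
        proof -
          have "D = (\<Prod>x\<in>?y ` {..<n} \<union> ?z ` {..<k}. (t ^ x) ^ (k - 1))"
            unfolding D_def site_hole_union[OF \<mu>] ..
          also have "\<dots> = (\<Prod>x\<in>?y ` {..<n}. (t ^ x) ^ (k - 1)) * (\<Prod>x\<in>?z ` {..<k}. (t ^ x) ^ (k - 1))"
            using site_hole_disjoint[OF \<mu>] by (intro prod.union_disjoint) auto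
          finally show ?thesis
            using decreasing_on_inj[OF site_decreasing[OF \<mu>]] decreasing_on_inj[OF hole_decreasing[OF \<mu>]]
            by (simp add: prod.reindex)
        qed
        have Z: "0 < (\<Prod>j<k. (t ^ ?z j) ^ (k - 1))" using t by (intro prod_pos) auto
        have "\<bar>vdm k (\<lambda>j. r ^ ?z j)\<bar> * D = \<bar>vdm k (\<lambda>j. t ^ ?z j)\<bar> * (\<Prod>i<n. (t ^ ?y i) ^ (k - 1))"
          unfolding 2[symmetric] 1[symmetric] by (simp only: mult_ac)
        then have "\<bar>vdm k (\<lambda>j. r ^ ?z j)\<bar> = \<bar>vdm k (\<lambda>j. t ^ ?z j)\<bar> * (\<Prod>i<n. (t ^ ?y i) ^ (k - 1)) / D"
          using D by (simp add: field_simps)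
        then show "\<bar>vdm k (\<lambda>j. r ^ ?z j)\<bar> = C / D * (\<bar>vdm n (\<lambda>i. t ^ ?y i)\<bar> / (\<Prod>i<n. node_gap t (n + k) (?y i)) * (\<Prod>i<n. (t ^ ?y i) ^ (E - 1)))"
          using rE by (simp add: base[OF \<mu>] mult_ac)
      qed
    qed
  qed
  then obtain \<kappa> where \<kappa>: "\<And>\<mu>. \<mu> \<in> diagrams n k \<Longrightarrow> \<bar>vdm k (\<lambda>j. r ^ hole n k \<mu> j)\<bar>
      = \<kappa> * (\<bar>vdm n (\<lambda>i. t ^ site n \<mu> i)\<bar> / (\<Prod>i<n. node_gap t (n + k) (site n \<mu> i)) * (\<Prod>i<n. (t ^ site n \<mu> i) ^ (E - 1)))"
    by blast
  show thesis
  proof (rule that[of "c0 * \<kappa>"])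
    fix \<mu> assume \<mu>: "\<mu> \<in> diagrams n k"
    let ?y = "site n \<mu>"
    let ?v = "\<bar>vdm n (\<lambda>i. t ^ ?y i)\<bar>"
    have E: "1 \<le> E" using r n by auto
    have Y: "0 < (\<Prod>i<n. (t ^ ?y i) ^ (n - 1))" using t by (intro prod_pos) auto
    have "\<bar>vdm n (\<lambda>i. 1 / t ^ ?y i)\<bar> * (\<Prod>i<n. \<bar>t ^ ?y i\<bar> ^ (n - 1)) = ?v"
      by (rule abs_vdm_inverse) (use t in auto)
    then have "\<bar>vdm n (\<lambda>i. q ^ ?y i)\<bar> * (\<Prod>i<n. (t ^ ?y i) ^ (n - 1)) = ?v"
      using q t by (simp add: power_one_over)
    then have 1: "\<bar>vdm n (\<lambda>i. q ^ ?y i)\<bar> = ?v / (\<Prod>i<n. (t ^ ?y i) ^ (n - 1))"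
      by (rule eq_divide_imp[OF less_imp_neq[OF Y, symmetric]])
    have w: "node_weight t n (n + k) E x = (t ^ x) ^ (E - 1) / ((t ^ x) ^ (n - 1) * node_gap t (n + k) x)" for x
    proof -
      have "(t ^ x) ^ E = t ^ x * (t ^ x) ^ (E - 1)" "(t ^ x) ^ n = t ^ x * (t ^ x) ^ (n - 1)"
        using E n by (simp_all add: power_eq_if)
      then show ?thesis using t by (simp add: node_weight_def)
    qed
    have W: "(\<Prod>i<n. node_weight t n (n + k) E (?y i)) = (\<Prod>i<n. (t ^ ?y i) ^ (E - 1)) / ((\<Prod>i<n. (t ^ ?y i) ^ (n - 1)) * (\<Prod>i<n. node_gap t (n + k) (?y i)))"
      unfolding w by (simp only: prod_dividef prod.distrib)
    have "skew_howe_weight n k q r \<mu> = \<bar>skew_howe_weight n k q r \<mu>\<bar>"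
      using skew_howe_weight_pos[OF q' r' \<mu>] by simp
    also have "\<dots> = c0 * (\<bar>vdm n (\<lambda>i. q ^ ?y i)\<bar> * \<bar>vdm k (\<lambda>j. r ^ hole n k \<mu> j)\<bar>)"
    proof -
      have "0 < (\<Prod>i<n. \<Prod>j<k. q ^ i + r ^ j)" using q' r' by (intro prod_pos) (auto intro!: add_pos_pos)
      then show ?thesis by (simp add: skew_howe_weight_eq c0_def abs_mult)
    qed
    also have "\<dots> = c0 * \<kappa> * (?v * ?v * ((\<Prod>i<n. (t ^ ?y i) ^ (E - 1)) / ((\<Prod>i<n. (t ^ ?y i) ^ (n - 1)) * (\<Prod>i<n. node_gap t (n + k) (?y i)))))"
      unfolding 1 \<kappa>[OF \<mu>] by (simp only: times_divide_eq_left times_divide_eq_right divide_divide_eq_left mult_ac)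
    also have "?v * ?v = (vdm n (\<lambda>i. t ^ ?y i))\<^sup>2" by (simp add: power2_eq_square)
    finally show "skew_howe_weight n k q r \<mu> = c0 * \<kappa> * ((vdm n (\<lambda>i. t ^ ?y i))\<^sup>2 * (\<Prod>i<n. node_weight t n (n + k) E (?y i)))"
      unfolding W .
  qed
qed

context q_krawtchouk
begin

text \<open>
  Functions that are orthonormal for the counting measure: the square root of the weight is part of
  them.
\<close>

definition ortho_fun :: "nat \<Rightarrow> nat \<Rightarrow> real" where
  "ortho_fun j x = (if j \<le> N \<and> x \<le> N then sqrt (w x) * poly (kr_poly j) (t ^ x) / sqrt (ip (kr_poly j) (kr_poly j)) else 0)"

lemma sum_ortho_fun:
  assumes "i \<le> N" "j \<le> N"
  shows "(\<Sum>x<Suc N. g x * ortho_fun i x * ortho_fun j x)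
     = (\<Sum>x\<le>N. w x * g x * poly (kr_poly i) (t ^ x) * poly (kr_poly j) (t ^ x)) / (sqrt (ip (kr_poly i) (kr_poly i)) * sqrt (ip (kr_poly j) (kr_poly j)))"
  unfolding sum_divide_distrib lessThan_Suc_atMost
proof (intro sum.cong refl)
  fix x assume "x \<in> {..N}"
  then have "sqrt (w x) * sqrt (w x) = w x" "x \<le> N" using w_pos[of x] by auto
  then show "g x * ortho_fun i x * ortho_fun j x = w x * g x * poly (kr_poly i) (t ^ x) * poly (kr_poly j) (t ^ x)
      / (sqrt (ip (kr_poly i) (kr_poly i)) * sqrt (ip (kr_poly j) (kr_poly j)))"
    using assms by (simp add: ortho_fun_def mult_ac)
qed

lemma orthonormal_ortho_fun:
  assumes "n \<le> Suc N"
  shows "orthonormal_system (Suc N) n ortho_fun"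
proof
  fix i j assume ij: "i < Suc N" "j < Suc N"
  have "(\<Sum>x<Suc N. ortho_fun i x * ortho_fun j x) = ip (kr_poly i) (kr_poly j) / (sqrt (ip (kr_poly i) (kr_poly i)) * sqrt (ip (kr_poly j) (kr_poly j)))"
    using sum_ortho_fun[of i j "\<lambda>_. 1"] ij by (simp add: ip_def)
  also have "\<dots> = (if i = j then 1 else 0)"
    using kr_poly_norm_pos[of j] kr_poly_orthogonal[of i j] ij by simp
  finally show "(\<Sum>x<Suc N. ortho_fun i x * ortho_fun j x) = (if i = j then 1 else 0)" .
qed (use assms in \<open>auto simp: ortho_fun_def\<close>)

lemma mult_mat_ortho_fun:
  assumes os: "orthonormal_system (Suc N) n ortho_fun" and ij: "i \<le> N" "j \<le> N"
  shows "orthonormal_system.mult_mat (Suc N) ortho_fun (\<lambda>x. t ^ x) i j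
     = ip (pCons 0 (kr_poly i)) (kr_poly j) / (sqrt (ip (kr_poly i) (kr_poly i)) * sqrt (ip (kr_poly j) (kr_poly j)))"
  unfolding orthonormal_system.mult_mat_def[OF os] sum_ortho_fun[OF ij] by (simp add: ip_def mult_ac)

lemma mult_mat_ortho_fun_zero:
  assumes os: "orthonormal_system (Suc N) n ortho_fun" and ij: "N < i \<or> N < j"
  shows "orthonormal_system.mult_mat (Suc N) ortho_fun g i j = 0"
  unfolding orthonormal_system.mult_mat_def[OF os] using ij by (auto simp: ortho_fun_def)

lemma banded_ortho_fun:
  assumes os: "orthonormal_system (Suc N) n ortho_fun"
  shows "banded 1 (orthonormal_system.mult_mat (Suc N) ortho_fun (\<lambda>x. t ^ x))"
  unfolding banded_def
proof (intro allI impI, rule ccontr)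
  fix i j
  assume nz: "orthonormal_system.mult_mat (Suc N) ortho_fun (\<lambda>x. t ^ x) i j \<noteq> 0" and far: "\<not> (i \<le> j + 1 \<and> j \<le> i + 1)"
  have ij: "i \<le> N" "j \<le> N" using nz mult_mat_ortho_fun_zero[OF os] by (meson not_le)+
  have "ip (pCons 0 (kr_poly i)) (kr_poly j) = 0"
  proof (cases "i + 1 < j")
    case True
    then show ?thesis by (rule ip_X_far)
  next
    case False
    then have "ip (pCons 0 (kr_poly j)) (kr_poly i) = 0" using far by (intro ip_X_far) auto
    then show ?thesis using ip_X[of "kr_poly i" "kr_poly j"] ip_commute by simp
  qed
  then show False using nz by (simp add: mult_mat_ortho_fun[OF os ij])
qed

lemma mult_mat_ortho_fun_diag:
  assumes os: "orthonormal_system (Suc N) n ortho_fun" and j: "1 \<le> j" "j \<le> N"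
  shows "orthonormal_system.mult_mat (Suc N) ortho_fun (\<lambda>x. t ^ x) j j = diag_coeff j"
  using kr_poly_norm_pos[OF j(2)] by (simp add: mult_mat_ortho_fun[OF os j(2) j(2)] ip_X_self[OF j(1)])

lemma mult_mat_ortho_fun_offdiag:
  assumes os: "orthonormal_system (Suc N) n ortho_fun" and j: "2 \<le> j" "j \<le> N"
  shows "orthonormal_system.mult_mat (Suc N) ortho_fun (\<lambda>x. t ^ x) (j - 1) j = sqrt (offdiag_sq j)"
    and "orthonormal_system.mult_mat (Suc N) ortho_fun (\<lambda>x. t ^ x) j (j - 1) = sqrt (offdiag_sq j)"
proof -
  let ?h = "\<lambda>j. ip (kr_poly j) (kr_poly j)"
  have h: "0 < ?h j" "0 < ?h (j - 1)" using kr_poly_norm_pos[of j] kr_poly_norm_pos[of "j - 1"] j by auto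
  have X: "ip (pCons 0 (kr_poly (j - 1))) (kr_poly j) = ?h j" using ip_X_succ[of "j - 1"] j by simp
  then have X': "ip (pCons 0 (kr_poly j)) (kr_poly (j - 1)) = ?h j"
    using ip_X[of "kr_poly j" "kr_poly (j - 1)"] ip_commute[of "kr_poly j" "pCons 0 (kr_poly (j - 1))"] by simp
  have "offdiag_sq j = ?h j / ?h (j - 1)" using norm_ratio[OF j(1)] h by (simp add: field_simps)
  then have "sqrt (offdiag_sq j) = sqrt (?h j) / sqrt (?h (j - 1))" by (simp add: real_sqrt_divide)
  also have "\<dots> = ?h j / (sqrt (?h j) * sqrt (?h (j - 1)))"
  proof -
    have "?h j = sqrt (?h j) * sqrt (?h j)" using h by simp
    then show ?thesis using h by (metis (no_types) less_irrefl mult_divide_mult_cancel_left_if real_sqrt_gt_0_iff)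
  qed
  finally have s: "sqrt (offdiag_sq j) = ?h j / (sqrt (?h j) * sqrt (?h (j - 1)))" .
  have le: "j - 1 \<le> N" using j by simp
  show "orthonormal_system.mult_mat (Suc N) ortho_fun (\<lambda>x. t ^ x) (j - 1) j = sqrt (offdiag_sq j)"
    unfolding mult_mat_ortho_fun[OF os le j(2)] X s by (simp only: mult.commute)
  show "orthonormal_system.mult_mat (Suc N) ortho_fun (\<lambda>x. t ^ x) j (j - 1) = sqrt (offdiag_sq j)"
    unfolding mult_mat_ortho_fun[OF os j(2) le] X' s ..
qed

text \<open>
  By \<open>leibniz_monic\<close> only the leading terms of the polynomials matter.
\<close>

lemma slater_ortho_fun_sq:
  assumes n: "n \<le> Suc N" and y: "\<And>i. i < n \<Longrightarrow> y i \<le> N"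
  shows "(orthonormal_system.slater n ortho_fun y)\<^sup>2
     = (\<Prod>j<n. 1 / ip (kr_poly j) (kr_poly j)) * ((vdm n (\<lambda>i. t ^ y i))\<^sup>2 * (\<Prod>i<n. w (y i)))"
proof -
  have os: "orthonormal_system (Suc N) n ortho_fun" by (rule orthonormal_ortho_fun[OF n])
  have "orthonormal_system.slater n ortho_fun y = leibniz n (\<lambda>i j. ortho_fun j (y i))"
    by (simp add: orthonormal_system.slater_def[OF os] leibniz_def)
  also have "\<dots> = leibniz n (\<lambda>i j. sqrt (w (y i)) * (1 / sqrt (ip (kr_poly j) (kr_poly j))) * poly (kr_poly j) (t ^ y i))"
    using n y by (intro leibniz_cong) (simp add: ortho_fun_def)
  also have "\<dots> = (\<Prod>i<n. sqrt (w (y i))) * (\<Prod>j<n. 1 / sqrt (ip (kr_poly j) (kr_poly j))) * leibniz n (\<lambda>i j. poly (kr_poly j) (t ^ y i))"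
    by (rule leibniz_scale)
  also have "leibniz n (\<lambda>i j. poly (kr_poly j) (t ^ y i)) = vdm n (\<lambda>i. t ^ y i)"
    unfolding leibniz_vandermonde[symmetric] by (rule leibniz_monic) (simp_all add: coeff_kr_poly kr_coeff_diag kr_coeff_zero)
  finally have "(orthonormal_system.slater n ortho_fun y)\<^sup>2
      = (\<Prod>i<n. sqrt (w (y i)))\<^sup>2 * (\<Prod>j<n. 1 / sqrt (ip (kr_poly j) (kr_poly j)))\<^sup>2 * (vdm n (\<lambda>i. t ^ y i))\<^sup>2"
    by (simp only: power_mult_distrib)
  moreover have "(\<Prod>i<n. sqrt (w (y i)))\<^sup>2 = (\<Prod>i<n. w (y i))"
    unfolding prod_power_distrib using w_pos y by (intro prod.cong refl) (simp add: less_imp_le)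
  moreover have "(\<Prod>j<n. 1 / sqrt (ip (kr_poly j) (kr_poly j)))\<^sup>2 = (\<Prod>j<n. 1 / ip (kr_poly j) (kr_poly j))"
    unfolding prod_power_distrib using kr_poly_norm_pos n by (intro prod.cong refl) (simp add: power_divide less_imp_le)
  ultimately show ?thesis by (simp only: mult_ac)
qed

end

definition kr_beta :: "real \<Rightarrow> real \<Rightarrow> real \<Rightarrow> real \<Rightarrow> real" where
  "kr_beta t p K T = 1 - T\<^sup>2 * t * (T - K) * (T + p) / ((T\<^sup>2 + p) * (T\<^sup>2 * t + p))
         + p * t * (T * K + p) * (T - 1) / ((T\<^sup>2 + p * t) * (T\<^sup>2 + p))"

definition kr_alpha :: "real \<Rightarrow> real \<Rightarrow> real \<Rightarrow> real \<Rightarrow> real" where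
  "kr_alpha t p K T = - p * t * T\<^sup>2 * (T - K * t) * (T + p * t) * (T * K + p) * (T - 1)
        / ((T\<^sup>2 + p * t\<^sup>2) * (T\<^sup>2 + p * t)\<^sup>2 * (T\<^sup>2 + p))"

text \<open>
  The two sides of the second conjunct are proportional, as both are one-particle products times a squared
  Vandermonde product, and both sum to one; so the constant is one.
\<close>

lemma ensemble_exists:
  assumes n: "1 \<le> n" "1 \<le> k" and t: "0 < t" "t \<noteq> 1" and q: "q = 1 / t"
    and r: "(r = q \<and> E = k) \<or> (r = t \<and> E = 1)"
  defines "p \<equiv> t ^ (2 * n + k - 1 - E)" and "K \<equiv> t ^ (n + k - 1)"
  shows "\<exists>P. orthonormal_system (n + k) n P
     \<and> (\<forall>\<mu>\<in>diagrams n k. skew_howe_weight n k q r \<mu> = (orthonormal_system.slater n P (site n \<mu>))\<^sup>2)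
     \<and> banded 1 (orthonormal_system.mult_mat (n + k) P (\<lambda>x. t ^ x))
     \<and> (\<forall>j. 1 \<le> j \<longrightarrow> j < n + k \<longrightarrow> orthonormal_system.mult_mat (n + k) P (\<lambda>x. t ^ x) j j = kr_beta t p K (t ^ j))
     \<and> (\<forall>j. 2 \<le> j \<longrightarrow> j < n + k \<longrightarrow> orthonormal_system.mult_mat (n + k) P (\<lambda>x. t ^ x) (j - 1) j = sqrt (kr_alpha t p K (t ^ j))
            \<and> orthonormal_system.mult_mat (n + k) P (\<lambda>x. t ^ x) j (j - 1) = sqrt (kr_alpha t p K (t ^ j)))"
proof -
  define N where "N = n + k - 1"
  have SN: "Suc N = n + k" using n by (simp add: N_def)
  have q': "0 < q" "q \<noteq> 1" and r': "0 < r" "r \<noteq> 1" using t q r by auto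
  have "p * t ^ E = t ^ (n + N)"
    unfolding p_def power_add[symmetric] using r n by (intro arg_cong[where f = "\<lambda>m. t ^ m"]) (auto simp: N_def)
  then interpret q_krawtchouk t p N "node_weight t n (n + k) E"
    using t node_weight_balance[of t p E n N] by unfold_locales (auto simp: p_def node_weight_pos SN)
  have os: "orthonormal_system (Suc N) n ortho_fun" using SN by (intro orthonormal_ortho_fun) simp
  have os': "orthonormal_system (n + k) n ortho_fun" using os SN by simp
  obtain \<kappa> where \<kappa>: "\<And>\<mu>. \<mu> \<in> diagrams n k \<Longrightarrow>
    skew_howe_weight n k q r \<mu> = \<kappa> * ((vdm n (\<lambda>i. t ^ site n \<mu> i))\<^sup>2 * (\<Prod>i<n. node_weight t n (n + k) E (site n \<mu> i)))"
    using weight_eq_vdm[OF n t q r] by blast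
  let ?S = "\<lambda>\<mu>. (orthonormal_system.slater n ortho_fun (site n \<mu>))\<^sup>2"
  define h where "h = (\<Prod>j<n. 1 / ip (kr_poly j) (kr_poly j))"
  have h: "0 < h" unfolding h_def using SN kr_poly_norm_pos by (intro prod_pos) (auto simp: N_def)
  have weight_slater: "skew_howe_weight n k q r \<mu> = \<kappa> / h * ?S \<mu>" if \<mu>: "\<mu> \<in> diagrams n k" for \<mu>
  proof -
    have "?S \<mu> = h * ((vdm n (\<lambda>i. t ^ site n \<mu> i))\<^sup>2 * (\<Prod>i<n. node_weight t n (n + k) E (site n \<mu> i)))"
      unfolding h_def using site_less[OF \<mu>] SN by (intro slater_ortho_fun_sq) (auto simp flip: less_Suc_eq_le)
    then show ?thesis using h by (simp add: \<kappa>[OF \<mu>])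
  qed
  have "(\<Sum>\<mu>\<in>diagrams n k. ?S \<mu>) = orthonormal_system.pairing (n + k) n ortho_fun (\<lambda>_. 1) id"
    using orthonormal_system.pairing_id_eq_sum[OF os' bij_betw_diagram_tuples, where \<Psi> = "\<lambda>_. 1" and \<Psi>' = "\<lambda>_. 1"] by simp
  also have "\<dots> = 1"
    using orthonormal_system.vacuum_pairing[OF os'] by (simp add: vacuum_def)
  finally have one: "(\<Sum>\<mu>\<in>diagrams n k. ?S \<mu>) = 1" .
  have "(\<Sum>\<mu>\<in>diagrams n k. skew_howe_weight n k q r \<mu>) = \<kappa> / h * (\<Sum>\<mu>\<in>diagrams n k. ?S \<mu>)"
    unfolding sum_distrib_left by (intro sum.cong refl weight_slater)
  then have "(\<Sum>\<mu>\<in>diagrams n k. skew_howe_weight n k q r \<mu>) = \<kappa> / h"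
    unfolding one by simp
  then have "\<kappa> / h = 1" using sum_skew_howe_weight[OF q' r'] by simp
  then have weight: "skew_howe_weight n k q r \<mu> = ?S \<mu>" if "\<mu> \<in> diagrams n k" for \<mu>
    using weight_slater[OF that] by simp
  have K: "K = t ^ N" by (simp add: K_def N_def)
  show ?thesis
  proof (intro exI[of _ ortho_fun] conjI ballI allI impI)
    show "banded 1 (orthonormal_system.mult_mat (n + k) ortho_fun (\<lambda>x. t ^ x))"
      using banded_ortho_fun[OF os] SN by simp
    show "orthonormal_system.mult_mat (n + k) ortho_fun (\<lambda>x. t ^ x) j j = kr_beta t p K (t ^ j)"
      if "1 \<le> j" "j < n + k" for j
      using mult_mat_ortho_fun_diag[OF os that(1)] that SN diag_coeff_eq[OF that(1)] by (simp add: kr_beta_def K)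
    show "orthonormal_system.mult_mat (n + k) ortho_fun (\<lambda>x. t ^ x) (j - 1) j = sqrt (kr_alpha t p K (t ^ j))"
      "orthonormal_system.mult_mat (n + k) ortho_fun (\<lambda>x. t ^ x) j (j - 1) = sqrt (kr_alpha t p K (t ^ j))"
      if "2 \<le> j" "j < n + k" for j
      using mult_mat_ortho_fun_offdiag[OF os that(1)] that SN offdiag_sq_eq[OF that(1)] by (simp_all add: kr_alpha_def K)
  qed (use os' weight in auto)
qed

text \<open>
  The powers \<open>t\<^sup>e\<close> with exponents proportional to \<open>n\<close> have limits; all parameters of the recurrence
  coefficients are of this form.
\<close>

lemma exp_power_tendsto:
  assumes "(\<lambda>n. real (e n) / real n) \<longlonglongrightarrow> s"
  shows "(\<lambda>n. exp (\<gamma> / real n) ^ e n) \<longlonglongrightarrow> exp (\<gamma> * s)"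
proof -
  have "exp (\<gamma> / real n) ^ e n = exp (\<gamma> * (real (e n) / real n))" for n
    by (simp add: exp_of_nat_mult[symmetric] mult.commute)
  moreover have "(\<lambda>n. exp (\<gamma> * (real (e n) / real n))) \<longlonglongrightarrow> exp (\<gamma> * s)"
    by (intro tendsto_intros assms)
  ultimately show ?thesis by (simp only:)
qed

lemma kr_beta_tendsto:
  assumes "t \<longlonglongrightarrow> t'" "p \<longlonglongrightarrow> p'" "K \<longlonglongrightarrow> K'" "T \<longlonglongrightarrow> T'" "0 < t'" "0 < p'" "0 < T'"
  shows "(\<lambda>n. kr_beta (t n) (p n) (K n) (T n)) \<longlonglongrightarrow> kr_beta t' p' K' T'"
proof -
  have "0 < T'\<^sup>2 + p'" "0 < T'\<^sup>2 * t' + p'" "0 < T'\<^sup>2 + p' * t'" using assms by (auto intro!: add_pos_pos)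
  then show ?thesis unfolding kr_beta_def by (intro tendsto_intros assms(1-4)) auto
qed

lemma kr_alpha_tendsto:
  assumes "t \<longlonglongrightarrow> t'" "p \<longlonglongrightarrow> p'" "K \<longlonglongrightarrow> K'" "T \<longlonglongrightarrow> T'" "0 < t'" "0 < p'" "0 < T'"
  shows "(\<lambda>n. kr_alpha (t n) (p n) (K n) (T n)) \<longlonglongrightarrow> kr_alpha t' p' K' T'"
proof -
  have "0 < T'\<^sup>2 + p'" "0 < T'\<^sup>2 + p' * t'\<^sup>2" "0 < T'\<^sup>2 + p' * t'" using assms by (auto intro!: add_pos_pos)
  then show ?thesis unfolding kr_alpha_def by (intro tendsto_intros assms(1-4)) auto
qed

text \<open>
  With \<open>Q = exp \<gamma>\<close> and \<open>C = exp (c \<gamma>)\<close>, the limits of \<open>t\<^sup>j\<close> for \<open>j\<close> near \<open>n\<close>, and of \<open>t\<^sup>N\<close> for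
  \<open>N = n + k - 1\<close>, are \<open>Q\<close> and \<open>C Q\<close>; the parameter \<open>p\<close> tends to \<open>Q\<^sup>2\<close> in case (A) and to \<open>Q\<^sup>2 C\<close> in case (B).
\<close>

lemma limit_values_A:
  fixes Q C :: real assumes Q: "0 < Q"
  shows "kr_beta 1 (Q\<^sup>2) (C * Q) Q = (1 + C * Q) / 2"
    and "sqrt (kr_alpha 1 (Q\<^sup>2) (C * Q) Q) = 1 / 4 * sqrt ((Q - 1) * (Q + 1) * (C - 1) * (C + 1))"
proof -
  show "kr_beta 1 (Q\<^sup>2) (C * Q) Q = (1 + C * Q) / 2"
    unfolding kr_beta_def using Q by (simp add: field_simps power2_eq_square)
  have A: "kr_alpha 1 (Q\<^sup>2) (C * Q) Q = ((Q - 1) * (Q + 1) * (C - 1) * (C + 1)) / 16"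
    unfolding kr_alpha_def using Q by (simp add: field_simps power2_eq_square)
  have "sqrt 16 = (4::real)" by (rule real_sqrt_unique) auto
  then show "sqrt (kr_alpha 1 (Q\<^sup>2) (C * Q) Q) = 1 / 4 * sqrt ((Q - 1) * (Q + 1) * (C - 1) * (C + 1))"
    unfolding A real_sqrt_divide by simp
qed

lemma limit_values_B:
  fixes Q C :: real assumes Q: "0 < Q" and C: "0 < C"
  shows "kr_beta 1 (Q\<^sup>2 * C) (C * Q) Q = (3 * (C\<^sup>2 * Q) - C * Q + 3 * C - C\<^sup>2) / (1 + C)\<^sup>2"
    and "sqrt (kr_alpha 1 (Q\<^sup>2 * C) (C * Q) Q) = C / (1 + C)\<^sup>2 * sqrt (2 * (Q - 1) * (C - 1) * (1 + C * Q))"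
proof -
  have C1: "0 < 1 + C" using C by simp
  have den: "Q\<^sup>2 + Q\<^sup>2 * C = Q\<^sup>2 * (1 + C)" by (simp add: algebra_simps)
  have "kr_beta 1 (Q\<^sup>2 * C) (C * Q) Q
      = 1 - (Q\<^sup>2 * Q\<^sup>2) * ((1 - C) * (1 + Q * C)) / ((Q\<^sup>2 * Q\<^sup>2) * (1 + C)\<^sup>2)
          + (Q\<^sup>2 * Q\<^sup>2) * (2 * C\<^sup>2 * (Q - 1)) / ((Q\<^sup>2 * Q\<^sup>2) * (1 + C)\<^sup>2)"
    unfolding kr_beta_def mult_1_right den by (simp add: power2_eq_square algebra_simps)
  also have "\<dots> = 1 - (1 - C) * (1 + Q * C) / (1 + C)\<^sup>2 + 2 * C\<^sup>2 * (Q - 1) / (1 + C)\<^sup>2"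
    using Q by simp
  also have "\<dots> = ((1 + C)\<^sup>2 - (1 - C) * (1 + Q * C) + 2 * C\<^sup>2 * (Q - 1)) / (1 + C)\<^sup>2"
    using C1 by (simp add: add_divide_distrib diff_divide_distrib)
  also have "(1 + C)\<^sup>2 - (1 - C) * (1 + Q * C) + 2 * C\<^sup>2 * (Q - 1) = 3 * (C\<^sup>2 * Q) - C * Q + 3 * C - C\<^sup>2"
    by (simp add: power2_eq_square algebra_simps)
  finally show "kr_beta 1 (Q\<^sup>2 * C) (C * Q) Q = (3 * (C\<^sup>2 * Q) - C * Q + 3 * C - C\<^sup>2) / (1 + C)\<^sup>2" .
  have "kr_alpha 1 (Q\<^sup>2 * C) (C * Q) Q
     = (Q\<^sup>2 * Q\<^sup>2 * Q\<^sup>2 * Q\<^sup>2) * (C\<^sup>2 * (2 * (Q - 1) * (C - 1) * (1 + C * Q))) / ((Q\<^sup>2 * Q\<^sup>2 * Q\<^sup>2 * Q\<^sup>2) * ((1 + C)\<^sup>2)\<^sup>2)"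
    unfolding kr_alpha_def mult_1_right power_one den by (simp add: power2_eq_square algebra_simps)
  also have "\<dots> = (C / (1 + C)\<^sup>2)\<^sup>2 * (2 * (Q - 1) * (C - 1) * (1 + C * Q))"
    using Q by (simp add: power_divide)
  finally have "sqrt (kr_alpha 1 (Q\<^sup>2 * C) (C * Q) Q) = sqrt ((C / (1 + C)\<^sup>2)\<^sup>2) * sqrt (2 * (Q - 1) * (C - 1) * (1 + C * Q))"
    by (simp only: real_sqrt_mult)
  moreover have "sqrt ((C / (1 + C)\<^sup>2)\<^sup>2) = C / (1 + C)\<^sup>2" using C by simp
  ultimately show "sqrt (kr_alpha 1 (Q\<^sup>2 * C) (C * Q) Q) = C / (1 + C)\<^sup>2 * sqrt (2 * (Q - 1) * (C - 1) * (1 + C * Q))"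
    by (simp only:)
qed

text \<open>
  A harmless choice for the finitely many \<open>n\<close> with \<open>n = 0\<close> or \<open>k = 0\<close>.
\<close>

lemma orthonormal_trivial:
  assumes "n \<le> M"
  defines "P \<equiv> \<lambda>j x. if j = x \<and> j < M then 1 else 0"
  shows "orthonormal_system M n P" and "banded 1 (orthonormal_system.mult_mat M P g)"
proof -
  have if_prod: "(if i = x \<and> i < M then 1 else 0) * (if j = x \<and> j < M then 1 else 0)
      = (if x = i then (if i = j \<and> i < M then 1 else 0) else (0::real))" for i j x by auto
  show os: "orthonormal_system M n P"
  proof
    fix i j assume "i < M" "j < M"
    have "(\<Sum>x<M. P i x * P j x) = (\<Sum>x<M. if x = i then (if i = j \<and> i < M then 1 else 0) else 0)"
      unfolding P_def if_prod ..
    then show "(\<Sum>x<M. P i x * P j x) = (if i = j then 1 else 0)" using \<open>i < M\<close> by simp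
  qed (use assms(1) in \<open>auto simp: P_def\<close>)
  have z: "P i x * P j x = 0" if "i \<noteq> j" for i j x using that by (auto simp: P_def)
  have "orthonormal_system.mult_mat M P g i j = 0" if "i \<noteq> j" for i j
    unfolding orthonormal_system.mult_mat_def[OF os]
    by (intro sum.neutral ballI) (simp only: mult.assoc z[OF that] mult_zero_right)
  then show "banded 1 (orthonormal_system.mult_mat M P g)"
    unfolding banded_def by (metis le_add1)
qed

lemma ensemble_sequence:
  fixes c \<gamma> a b :: real and k :: "nat \<Rightarrow> nat" and q r :: "nat \<Rightarrow> real"
  assumes c: "c > 0" and \<gamma>: "\<gamma> \<noteq> 0"
    and ktop: "filterlim k at_top sequentially"
    and kc: "(\<lambda>n. real (k n) / real n) \<longlonglongrightarrow> c"
    and q: "\<And>n. q n = exp (- \<gamma> / real n)"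
    and case_A_or_B:
      "((\<forall>n. r n = q n) \<and>
        a = 1 / 4 * sqrt ((exp \<gamma> - 1) * (exp \<gamma> + 1) * (exp (c * \<gamma>) - 1) * (exp (c * \<gamma>) + 1)) \<and>
        b = (1 + exp (\<gamma> * (c + 1))) / 2)
       \<or>
       ((\<forall>n. r n = inverse (q n)) \<and>
        a = exp (c * \<gamma>) / (1 + exp (c * \<gamma>))\<^sup>2 *
            sqrt (2 * (exp \<gamma> - 1) * (exp (c * \<gamma>) - 1) * (1 + exp (\<gamma> * (c + 1)))) \<and>
        b = (3 * exp (\<gamma> * (2 * c + 1)) - exp (\<gamma> * (c + 1)) + 3 * exp (c * \<gamma>) - exp (2 * c * \<gamma>))
            / (1 + exp (c * \<gamma>))\<^sup>2)"
  obtains P where "\<And>n. orthonormal_system (n + k n) n (P n)"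
    "\<And>n \<mu>. 1 \<le> n \<Longrightarrow> 1 \<le> k n \<Longrightarrow> \<mu> \<in> diagrams n (k n) \<Longrightarrow>
       skew_howe_weight n (k n) (q n) (r n) \<mu> = (orthonormal_system.slater n (P n) (site n \<mu>))\<^sup>2"
    "\<And>n. banded 1 (orthonormal_system.mult_mat (n + k n) (P n) (\<lambda>x. exp (\<gamma> / real n) ^ x))"
    "window_lim (\<lambda>n. orthonormal_system.mult_mat (n + k n) (P n) (\<lambda>x. exp (\<gamma> / real n) ^ x))
       (\<lambda>i j. if i = j then b else if \<bar>i - j\<bar> = 1 then a else 0)"
proof -
  define t where "t n = exp (\<gamma> / real n)" for n
  \<comment> \<open>The exponent of the one-particle weight, through which the two cases enter.\<close>
  define E where "E n = (if (\<forall>n. r n = q n) \<and>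
        a = 1 / 4 * sqrt ((exp \<gamma> - 1) * (exp \<gamma> + 1) * (exp (c * \<gamma>) - 1) * (exp (c * \<gamma>) + 1)) \<and>
        b = (1 + exp (\<gamma> * (c + 1))) / 2 then k n else 1)" for n
  define p where "p n = t n ^ (2 * n + k n - 1 - E n)" for n
  define K where "K n = t n ^ (n + k n - 1)" for n
  let ?G = "\<lambda>n P. orthonormal_system.mult_mat (n + k n) P (\<lambda>x. t n ^ x)"
  let ?good = "\<lambda>n. 1 \<le> n \<and> 1 \<le> k n"
  have qt: "q n = 1 / t n" for n by (simp add: q t_def exp_minus inverse_eq_divide)
  have rE: "(r n = q n \<and> E n = k n) \<or> (r n = t n \<and> E n = 1)" for n
    using case_A_or_B unfolding E_def by (auto simp: qt)
  \<comment> \<open>One choice of the orthonormal functions for every \<open>n\<close>, with the recurrence coefficients of the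
    \<open>q\<close>-Krawtchouk polynomials whenever the rectangle is not empty.\<close>
  define Pr where "Pr n P \<longleftrightarrow> orthonormal_system (n + k n) n P \<and> banded 1 (?G n P) \<and> (?good n \<longrightarrow>
       (\<forall>\<mu>\<in>diagrams n (k n). skew_howe_weight n (k n) (q n) (r n) \<mu> = (orthonormal_system.slater n P (site n \<mu>))\<^sup>2)
     \<and> (\<forall>j. 1 \<le> j \<longrightarrow> j < n + k n \<longrightarrow> ?G n P j j = kr_beta (t n) (p n) (K n) (t n ^ j))
     \<and> (\<forall>j. 2 \<le> j \<longrightarrow> j < n + k n \<longrightarrow> ?G n P (j - 1) j = sqrt (kr_alpha (t n) (p n) (K n) (t n ^ j))
            \<and> ?G n P j (j - 1) = sqrt (kr_alpha (t n) (p n) (K n) (t n ^ j))))" for n P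
  have ex: "\<exists>P. Pr n P" for n
  proof (cases "?good n")
    case True
    have t: "0 < t n" "t n \<noteq> 1" using True \<gamma> by (auto simp: t_def)
    show ?thesis
      using ensemble_exists[OF conjunct1[OF True] conjunct2[OF True] t qt rE] unfolding Pr_def p_def K_def by blast
  next
    case False
    then show ?thesis unfolding Pr_def using orthonormal_trivial(1)[of n "n + k n"] orthonormal_trivial(2)[of n "n + k n" "\<lambda>x. t n ^ x"] by (meson le_add1)
  qed
  have "\<forall>n. \<exists>P. Pr n P" using ex by blast
  from choice[OF this] obtain P where PP: "\<And>n. Pr n (P n)" by blast
  have P: "\<And>n. orthonormal_system (n + k n) n (P n)" "\<And>n. banded 1 (?G n (P n))"
    "\<And>n \<mu>. ?good n \<Longrightarrow> \<mu> \<in> diagrams n (k n) \<Longrightarrow>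
       skew_howe_weight n (k n) (q n) (r n) \<mu> = (orthonormal_system.slater n (P n) (site n \<mu>))\<^sup>2"
    "\<And>n j. ?good n \<Longrightarrow> 1 \<le> j \<Longrightarrow> j < n + k n \<Longrightarrow> ?G n (P n) j j = kr_beta (t n) (p n) (K n) (t n ^ j)"
    "\<And>n j. ?good n \<Longrightarrow> 2 \<le> j \<Longrightarrow> j < n + k n \<Longrightarrow> ?G n (P n) (j - 1) j = sqrt (kr_alpha (t n) (p n) (K n) (t n ^ j))"
    "\<And>n j. ?good n \<Longrightarrow> 2 \<le> j \<Longrightarrow> j < n + k n \<Longrightarrow> ?G n (P n) j (j - 1) = sqrt (kr_alpha (t n) (p n) (K n) (t n ^ j))"
    using PP unfolding Pr_def by blast+
  define Q where "Q = exp \<gamma>"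
  define C where "C = exp (c * \<gamma>)"
  have Q: "0 < Q" and C: "0 < C" by (simp_all add: Q_def C_def)
  have inv: "(\<lambda>n. 1 / real n) \<longlonglongrightarrow> 0" by (rule lim_1_over_n)
  have T: "(\<lambda>n. t n ^ nat (int n + i)) \<longlonglongrightarrow> Q" for i
  proof -
    have "\<forall>\<^sub>F n in sequentially. 1 + of_int i * (1 / real n) = real (nat (int n + i)) / real n"
      using eventually_gt_at_top[of "nat \<bar>i\<bar>"] by eventually_elim (auto simp: field_simps)
    moreover have "(\<lambda>n. 1 + of_int i * (1 / real n)) \<longlonglongrightarrow> 1 + of_int i * 0"
      by (intro tendsto_intros inv)
    ultimately have "(\<lambda>n. real (nat (int n + i)) / real n) \<longlonglongrightarrow> 1"
      using Lim_transform_eventually by fastforce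
    from exp_power_tendsto[OF this] show ?thesis by (simp add: t_def Q_def)
  qed
  have t1: "t \<longlonglongrightarrow> 1"
  proof -
    have "(\<lambda>n. exp (\<gamma> * (1 / real n))) \<longlonglongrightarrow> exp (\<gamma> * 0)" by (intro tendsto_intros inv)
    then show ?thesis by (simp add: t_def[abs_def])
  qed
  have Klim: "K \<longlonglongrightarrow> C * Q"
  proof -
    have "\<forall>\<^sub>F n in sequentially. 1 + real (k n) / real n - 1 / real n = real (n + k n - 1) / real n"
      using eventually_gt_at_top[of 0] by eventually_elim (auto simp: field_simps of_nat_diff)
    moreover have "(\<lambda>n. 1 + real (k n) / real n - 1 / real n) \<longlonglongrightarrow> 1 + c - 0"
      by (intro tendsto_intros inv kc)
    ultimately have "(\<lambda>n. real (n + k n - 1) / real n) \<longlonglongrightarrow> 1 + c"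
      using Lim_transform_eventually by fastforce
    from exp_power_tendsto[OF this] show ?thesis
      by (simp add: K_def[abs_def] t_def Q_def C_def exp_add[symmetric] algebra_simps)
  qed
  have good: "\<forall>\<^sub>F n in sequentially. ?good n"
    using ktop eventually_ge_at_top[of 1] by (auto simp: filterlim_at_top intro: eventually_conj)
  obtain p' where p': "0 < p'" "p \<longlonglongrightarrow> p'" "kr_beta 1 p' (C * Q) Q = b" "sqrt (kr_alpha 1 p' (C * Q) Q) = a"
  proof (cases "(\<forall>n. r n = q n) \<and>
        a = 1 / 4 * sqrt ((exp \<gamma> - 1) * (exp \<gamma> + 1) * (exp (c * \<gamma>) - 1) * (exp (c * \<gamma>) + 1)) \<and>
        b = (1 + exp (\<gamma> * (c + 1))) / 2")
    case True
    then have E: "E n = k n" for n by (simp add: E_def)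
    have "\<forall>\<^sub>F n in sequentially. 2 - 1 / real n = real (2 * n + k n - 1 - E n) / real n"
      using eventually_gt_at_top[of 0] by eventually_elim (auto simp: E field_simps of_nat_diff)
    moreover have "(\<lambda>n. 2 - 1 / real n) \<longlonglongrightarrow> 2 - 0" by (intro tendsto_intros inv)
    ultimately have "(\<lambda>n. real (2 * n + k n - 1 - E n) / real n) \<longlonglongrightarrow> 2"
      using Lim_transform_eventually by fastforce
    from exp_power_tendsto[OF this, of \<gamma>] have "p \<longlonglongrightarrow> exp (\<gamma> * 2)" by (simp add: p_def[abs_def] t_def)
    moreover have "exp (\<gamma> * 2) = Q\<^sup>2" by (simp add: Q_def power2_eq_square exp_add[symmetric])
    moreover have "exp (\<gamma> * (c + 1)) = C * Q" by (simp add: Q_def C_def exp_add[symmetric] algebra_simps)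
    ultimately show ?thesis
      using True Q limit_values_A[OF Q, of C] by (intro that[of "Q\<^sup>2"]) (auto simp: Q_def[symmetric] C_def[symmetric])
  next
    case False
    then have E: "E n = 1" for n unfolding E_def by (rule if_not_P)
    have "\<forall>\<^sub>F n in sequentially. 2 + real (k n) / real n - 2 * (1 / real n) = real (2 * n + k n - 1 - E n) / real n"
      using eventually_gt_at_top[of 0] by eventually_elim (auto simp: E field_simps of_nat_diff)
    moreover have "(\<lambda>n. 2 + real (k n) / real n - 2 * (1 / real n)) \<longlonglongrightarrow> 2 + c - 2 * 0" by (intro tendsto_intros inv kc)
    ultimately have "(\<lambda>n. real (2 * n + k n - 1 - E n) / real n) \<longlonglongrightarrow> 2 + c"
      using Lim_transform_eventually by fastforce
    from exp_power_tendsto[OF this, of \<gamma>] have "p \<longlonglongrightarrow> exp (\<gamma> * (2 + c))" by (simp add: p_def[abs_def] t_def)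
    moreover have "exp (\<gamma> * (2 + c)) = Q\<^sup>2 * C" by (simp add: Q_def C_def power2_eq_square exp_add[symmetric] algebra_simps)
    moreover have "exp (\<gamma> * (c + 1)) = C * Q" "exp (\<gamma> * (2 * c + 1)) = C\<^sup>2 * Q" "exp (2 * c * \<gamma>) = C\<^sup>2"
      by (simp_all add: Q_def C_def power2_eq_square exp_add[symmetric] algebra_simps)
    ultimately show ?thesis
      using False case_A_or_B Q C limit_values_B[OF Q C]
      by (intro that[of "Q\<^sup>2 * C"]) (auto simp: Q_def[symmetric] C_def[symmetric])
  qed
  have beta: "(\<lambda>n. kr_beta (t n) (p n) (K n) (t n ^ nat (int n + i))) \<longlonglongrightarrow> b" for i
    using kr_beta_tendsto[OF t1 p'(2) Klim T[of i]] p' Q by simp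
  have alpha: "(\<lambda>n. sqrt (kr_alpha (t n) (p n) (K n) (t n ^ nat (int n + i)))) \<longlonglongrightarrow> a" for i
    using tendsto_real_sqrt[OF kr_alpha_tendsto[OF t1 p'(2) Klim T[of i]]] p' Q by simp
  have "window_lim (\<lambda>n. ?G n (P n)) (\<lambda>i j. if i = j then b else if \<bar>i - j\<bar> = 1 then a else 0)"
    unfolding window_lim_def
  proof (intro allI)
    fix i j :: int
    have "\<forall>\<^sub>F n in sequentially. nat \<bar>i\<bar> + nat \<bar>j\<bar> + 1 \<le> k n"
      using ktop by (simp add: filterlim_at_top)
    then have large: "\<forall>\<^sub>F n in sequentially. ?good n \<and> nat \<bar>i\<bar> + nat \<bar>j\<bar> + 1 \<le> k n \<and> nat \<bar>i\<bar> + nat \<bar>j\<bar> + 2 \<le> n"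
      using good eventually_ge_at_top[of "nat \<bar>i\<bar> + nat \<bar>j\<bar> + 2"] by eventually_elim auto
    consider "i = j" | "j = i + 1" | "i = j + 1" | "i \<noteq> j" "\<bar>i - j\<bar> \<noteq> 1" by linarith
    then show "(\<lambda>n. ?G n (P n) (nat (int n + i)) (nat (int n + j))) \<longlonglongrightarrow> (if i = j then b else if \<bar>i - j\<bar> = 1 then a else 0)"
    proof cases
      case 1
      have "\<forall>\<^sub>F n in sequentially. kr_beta (t n) (p n) (K n) (t n ^ nat (int n + i)) = ?G n (P n) (nat (int n + i)) (nat (int n + j))"
        using large by eventually_elim (use 1 in \<open>auto simp: P(4)\<close>)
      then show ?thesis using beta[of i] 1 Lim_transform_eventually by fastforce
    next
      case 2
      have "\<forall>\<^sub>F n in sequentially. sqrt (kr_alpha (t n) (p n) (K n) (t n ^ nat (int n + j))) = ?G n (P n) (nat (int n + i)) (nat (int n + j))"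
        using large
      proof eventually_elim
        case (elim n)
        have "nat (int n + i) = nat (int n + j) - 1" using 2 by auto
        moreover have "2 \<le> nat (int n + j)" "nat (int n + j) < n + k n" using elim by auto
        ultimately show ?case using P(5)[of n "nat (int n + j)"] elim by simp
      qed
      then show ?thesis using alpha[of j] 2 Lim_transform_eventually by fastforce
    next
      case 3
      have "\<forall>\<^sub>F n in sequentially. sqrt (kr_alpha (t n) (p n) (K n) (t n ^ nat (int n + i))) = ?G n (P n) (nat (int n + i)) (nat (int n + j))"
        using large
      proof eventually_elim
        case (elim n)
        have "nat (int n + j) = nat (int n + i) - 1" using 3 by auto
        moreover have "2 \<le> nat (int n + i)" "nat (int n + i) < n + k n" using elim by auto
        ultimately show ?case using P(6)[of n "nat (int n + i)"] elim by simp
      qed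
      then show ?thesis using alpha[of i] 3 Lim_transform_eventually by fastforce
    next
      case 4
      have "\<forall>\<^sub>F n in sequentially. ?G n (P n) (nat (int n + i)) (nat (int n + j)) = 0"
        using large
      proof eventually_elim
        case (elim n)
        have "\<not> (nat (int n + i) \<le> nat (int n + j) + 1 \<and> nat (int n + j) \<le> nat (int n + i) + 1)"
          using elim 4 by auto
        then show ?case using P(2)[of n] unfolding banded_def by blast
      qed
      then show ?thesis using 4 by (simp add: tendsto_eventually)
    qed
  qed
  then show thesis
    using P(1-3) by (intro that[of P]) (auto simp: t_def)
qed

section \<open>From polynomials to continuously differentiable functions\<close>

lemma tendsto_by_approximation:
  fixes x :: "nat \<Rightarrow> 'a::metric_space"
  assumes y: "\<And>m. y m \<longlonglongrightarrow> Y m" and Y: "Y \<longlonglongrightarrow> Z"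
    and d: "\<And>m. \<forall>\<^sub>F n in sequentially. dist (x n) (y m n) \<le> e m" and e: "e \<longlonglongrightarrow> 0"
  shows "x \<longlonglongrightarrow> Z"
proof (rule tendstoI)
  fix r :: real assume r: "0 < r"
  have "\<forall>\<^sub>F m in sequentially. dist (Y m) Z < r / 3 \<and> e m < r / 3"
    using tendstoD[OF Y, of "r / 3"] order_tendstoD(2)[OF e, of "r / 3"] r by (auto intro: eventually_conj)
  then obtain m where m: "dist (Y m) Z < r / 3" "e m < r / 3"
    by (auto simp: eventually_sequentially)
  have "\<forall>\<^sub>F n in sequentially. dist (y m n) (Y m) < r / 3"
    using r by (intro tendstoD[OF y]) auto
  with d[of m] show "\<forall>\<^sub>F n in sequentially. dist (x n) Z < r"
  proof eventually_elim
    case (elim n)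
    have "dist (x n) Z \<le> dist (x n) (y m n) + (dist (y m n) (Y m) + dist (Y m) Z)"
      using dist_triangle[of "x n" Z "y m n"] dist_triangle[of "y m n" Z "Y m"] by linarith
    then show ?case using elim m by linarith
  qed
qed

lemma L2_set_diff_bounds:
  "L2_set f S \<le> L2_set (\<lambda>l. f l - g l) S + L2_set g S"
  "L2_set g S \<le> L2_set (\<lambda>l. f l - g l) S + L2_set f S"
proof -
  show "L2_set f S \<le> L2_set (\<lambda>l. f l - g l) S + L2_set g S"
    using L2_set_triangle_ineq[of "\<lambda>l. f l - g l" g S] by simp
  have "L2_set (\<lambda>l. g l - f l) S = L2_set (\<lambda>l. f l - g l) S"
    by (simp add: L2_set_def power2_commute)
  then show "L2_set g S \<le> L2_set (\<lambda>l. f l - g l) S + L2_set f S"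
    using L2_set_triangle_ineq[of "\<lambda>l. g l - f l" f S] by simp
qed

text \<open>
  The triangle inequality in the space of square summable sequences, written for partial sums, whose
  boundedness makes the limiting sequence square summable.
\<close>

lemma tendsto_sqrt_infsum:
  fixes x :: "nat \<Rightarrow> real" and X :: "nat \<Rightarrow> nat \<Rightarrow> real"
  assumes diff: "\<And>m L. L2_set (\<lambda>l. X m l - x l) {1..L} \<le> e m"
    and le: "\<And>m L. L2_set (X m) {1..L} \<le> s m" and att: "\<And>m. \<exists>L. L2_set (X m) {1..L} = s m"
    and e: "e \<longlonglongrightarrow> 0"
  shows "s \<longlonglongrightarrow> sqrt (\<Sum>\<^sub>\<infinity>l\<in>{1..}. (x l)\<^sup>2)"
proof -
  let ?V = "\<Sum>\<^sub>\<infinity>l\<in>{1..}. (x l)\<^sup>2"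
  have xL: "L2_set x {1..L} \<le> e m + s m" for m L
    using L2_set_diff_bounds(2)[of x "{1..L}" "X m"] diff[of m L] le[of m L] by linarith
  have fin: "(\<Sum>l\<in>F. (x l)\<^sup>2) \<le> (e m + s m)\<^sup>2" if F: "finite F" "F \<subseteq> {1..}" for F m
  proof -
    obtain L where L: "F \<subseteq> {..L}" using F(1) by (metis finite_nat_iff_bounded_le)
    have "(\<Sum>l\<in>F. (x l)\<^sup>2) \<le> (\<Sum>l\<in>{1..L}. (x l)\<^sup>2)"
      using L F by (intro sum_mono2) auto
    also have "\<dots> = (L2_set x {1..L})\<^sup>2" by (simp add: L2_set_def sum_nonneg)
    also have "\<dots> \<le> (e m + s m)\<^sup>2" by (intro power_mono xL L2_set_nonneg)
    finally show ?thesis .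
  qed
  have summ: "(\<lambda>l. (x l)\<^sup>2) summable_on {1..}"
    using fin[of _ 0] by (intro nonneg_bdd_above_summable_on bdd_aboveI[of _ "(e 0 + s 0)\<^sup>2"]) auto
  have es: "0 \<le> e m + s m" for m using xL[where L = 0 and m = m] by (simp add: L2_set_def)
  have 1: "sqrt ?V \<le> e m + s m" for m
  proof -
    have "?V \<le> (e m + s m)\<^sup>2" by (rule infsum_le_finite_sums[OF summ]) (rule fin)
    then show ?thesis using es[of m] by (simp add: real_le_lsqrt)
  qed
  have 2: "s m \<le> sqrt ?V + e m" for m
  proof -
    obtain L where L: "L2_set (X m) {1..L} = s m" using att by blast
    have "(\<Sum>l\<in>{1..L}. (x l)\<^sup>2) \<le> ?V" by (intro finite_sum_le_infsum summ) auto
    then have "L2_set x {1..L} \<le> sqrt ?V" by (simp add: L2_set_def)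
    then show ?thesis using L2_set_diff_bounds(1)[of "X m" "{1..L}" x] diff[of m L] L by linarith
  qed
  have "(\<lambda>m. s m - sqrt ?V) \<longlonglongrightarrow> 0"
  proof (rule Lim_null_comparison[OF _ e])
    show "\<forall>\<^sub>F m in sequentially. norm (s m - sqrt ?V) \<le> e m"
    proof (intro always_eventually allI)
      fix m show "norm (s m - sqrt ?V) \<le> e m" using 1[of m] 2[of m] by (simp add: abs_le_iff)
    qed
  qed
  then show ?thesis by (simp add: LIM_zero_iff)
qed

text \<open>
  A primitive of a uniform polynomial approximation of the derivative.
\<close>

lemma C1_polynomial_approximation:
  assumes f: "f C1_differentiable_on UNIV" and e: "0 < (e::real)"
  obtains g :: "real poly" where "poly g 0 = f 0"
    "\<And>x y. x \<in> {-R..R} \<Longrightarrow> y \<in> {-R..R} \<Longrightarrow> \<bar>(f x - poly g x) - (f y - poly g y)\<bar> \<le> e * \<bar>x - y\<bar>"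
proof -
  obtain D where D: "\<And>x. (f has_vector_derivative D x) (at x)" and cont: "continuous_on UNIV D"
    using f unfolding C1_differentiable_on_def by blast
  obtain h where h: "real_polynomial_function h" "\<And>x. x \<in> {-R..R} \<Longrightarrow> \<bar>D x - h x\<bar> < e"
    by (rule Stone_Weierstrass_real_polynomial_function[of "{-R..R}" D e])
       (use e continuous_on_subset[OF cont] in auto)
  obtain a n where an: "h = (\<lambda>x. \<Sum>i\<le>n. a i * x ^ i)"
    using h(1) unfolding real_polynomial_function_iff_sum by blast
  define g where "g = [:f 0:] + (\<Sum>i\<le>n. monom (a i / real (Suc i)) (Suc i))"
  have g0: "poly g 0 = f 0" by (simp add: g_def poly_sum poly_monom)
  have gx: "poly g = (\<lambda>x. f 0 + (\<Sum>i\<le>n. a i / real (Suc i) * x ^ Suc i))"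
    by (simp add: g_def fun_eq_iff poly_sum poly_monom del: of_nat_Suc power_Suc)
  have dg: "(poly g has_field_derivative h x) (at x)" for x
  proof -
    have "((\<lambda>x. a i / real (Suc i) * x ^ Suc i) has_field_derivative a i * x ^ i) (at x)" for i
      by (rule DERIV_cong[OF DERIV_cmult[OF DERIV_pow]]) (simp del: of_nat_Suc)
    then have "((\<lambda>x. f 0 + (\<Sum>i\<le>n. a i / real (Suc i) * x ^ Suc i)) has_field_derivative 0 + (\<Sum>i\<le>n. a i * x ^ i)) (at x)"
      by (intro DERIV_add DERIV_const DERIV_sum)
    then show ?thesis unfolding gx an by (simp only: add_0_left)
  qed
  have "\<bar>(f x - poly g x) - (f y - poly g y)\<bar> \<le> e * \<bar>x - y\<bar>" if "x \<in> {-R..R}" "y \<in> {-R..R}" for x y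
  proof -
    have "norm ((f x - poly g x) - (f y - poly g y)) \<le> e * norm (x - y)"
    proof (rule field_differentiable_bound[of "{-R..R}" _ "\<lambda>x. D x - h x"])
      fix z assume z: "z \<in> {-R..R}"
      have "(f has_field_derivative D z) (at z)"
        using D by (simp add: has_real_derivative_iff_has_vector_derivative)
      then have "((\<lambda>x. f x - poly g x) has_field_derivative (D z - h z)) (at z)"
        using dg by (rule DERIV_diff)
      then show "((\<lambda>x. f x - poly g x) has_field_derivative (D z - h z)) (at z within {-R..R})"
        by (rule has_field_derivative_at_within)
      show "norm (D z - h z) \<le> e" using h(2)[OF z] by simp
    qed (use that in auto)
    then show ?thesis by simp
  qed
  with g0 show thesis by (rule that)
qed

lemma cos_coeff_bound:
  assumes cont: "continuous_on UNIV f" and B: "\<And>x. x \<in> {-R..R} \<Longrightarrow> \<bar>f x\<bar> \<le> B" and R: "2 * \<bar>a\<bar> + \<bar>b\<bar> \<le> R"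
  shows "\<bar>cos_coeff a b f d\<bar> \<le> B"
proof -
  have "\<bar>f (2 * a * cos \<theta> + b) * cos (real_of_int d * \<theta>)\<bar> \<le> B" for \<theta>
  proof -
    have "\<bar>2 * a * cos \<theta>\<bar> \<le> 2 * \<bar>a\<bar> * 1"
      unfolding abs_mult by (intro mult_mono) auto
    then have "2 * a * cos \<theta> + b \<in> {-R..R}" using R by (auto simp: abs_le_iff)
    then have 1: "\<bar>f (2 * a * cos \<theta> + b)\<bar> \<le> B" by (rule B)
    moreover have "\<bar>cos (real_of_int d * \<theta>)\<bar> \<le> 1" by simp
    ultimately have "\<bar>f (2 * a * cos \<theta> + b)\<bar> * \<bar>cos (real_of_int d * \<theta>)\<bar> \<le> B * 1"
      by (intro mult_mono) auto
    then show ?thesis by (simp add: abs_mult)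
  qed
  then have "norm (integral {0..2 * pi} (\<lambda>\<theta>. f (2 * a * cos \<theta> + b) * cos (real_of_int d * \<theta>)))
      \<le> integral {0..2 * pi} (\<lambda>_. B)"
    by (intro integral_norm_bound_integral cos_coeff_integrable[OF cont]) auto
  then have "\<bar>integral {0..2 * pi} (\<lambda>\<theta>. f (2 * a * cos \<theta> + b) * cos (real_of_int d * \<theta>))\<bar> \<le> 2 * pi * B" by simp
  then show ?thesis
    unfolding cos_coeff_def abs_divide by (simp add: divide_le_eq mult.commute)
qed


lemma linear_statistic_eq:
  "linear_statistic \<gamma> g n \<mu> = (\<Sum>i<n. g (exp (\<gamma> / real n) ^ site n \<mu> i))"
proof -
  have "exp (\<gamma> * (real m / real n)) = exp (\<gamma> / real n) ^ m" for m
    by (simp add: exp_of_nat_mult[symmetric] mult.commute)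
  then show ?thesis by (simp only: linear_statistic_def particle_def site_def)
qed

lemma integral_skew_howe_measure:
  assumes "\<And>\<mu>. \<mu> \<in> diagrams n k \<Longrightarrow> 0 \<le> skew_howe_weight n k q r \<mu>"
  shows "integral\<^sup>L (skew_howe_measure n k q r) (F :: _ \<Rightarrow> real) = (\<Sum>\<mu>\<in>diagrams n k. skew_howe_weight n k q r \<mu> * F \<mu>)"
  unfolding skew_howe_measure_def
  using lebesgue_integral_point_measure_finite[OF finite_diagrams assms, where g = F] by simp

lemma integrable_skew_howe_measure: "integrable (skew_howe_measure n k q r) (F :: _ \<Rightarrow> real)"
  unfolding skew_howe_measure_def by (rule integrable_point_measure_finite[OF finite_diagrams])

lemma measurable_skew_howe_measure: "F \<in> borel_measurable (skew_howe_measure n k q r)"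
  unfolding skew_howe_measure_def by simp

lemma prob_space_skew_howe_measure:
  assumes "0 < q" "q \<noteq> 1" "0 < r" "r \<noteq> 1"
  shows "prob_space (skew_howe_measure n k q r)"
  unfolding skew_howe_measure_def
  using skew_howe_weight_pos[OF assms] sum_skew_howe_weight[OF assms]
  by (intro prob_space_point_measure finite_diagrams) (auto simp: less_imp_le sum_ennreal)

text \<open>
  The case \<open>m = 1\<close>, applied to the statistic minus \<open>vacuum_trace\<close>, identifies the mean.
\<close>

lemma moments_eq_hop_centered:
  fixes q r \<gamma> :: real and g :: "real \<Rightarrow> real" and n k :: nat and P :: "nat \<Rightarrow> nat \<Rightarrow> real"
  defines "W \<equiv> skew_howe_measure n k q r"
  assumes q: "0 < q" "q \<noteq> 1" and r: "0 < r" "r \<noteq> 1"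
    and os: "orthonormal_system (n + k) n P"
    and weight: "\<And>\<mu>. \<mu> \<in> diagrams n k \<Longrightarrow> skew_howe_weight n k q r \<mu> = (orthonormal_system.slater n P (site n \<mu>))\<^sup>2"
  defines "X \<equiv> linear_statistic \<gamma> g n"
  defines "G \<equiv> orthonormal_system.mult_mat (n + k) P (\<lambda>x. g (exp (\<gamma> / real n) ^ x))"
  shows "integral\<^sup>L W (\<lambda>\<mu>. (X \<mu> - integral\<^sup>L W X) ^ m)
     = (hop_centered (n + k) n G ^^ m) (orthonormal_system.pairing (n + k) n P (\<lambda>_. 1)) id"
proof -
  let ?\<epsilon> = "orthonormal_system.pairing (n + k) n P (\<lambda>_. 1)"
  have pos: "0 \<le> skew_howe_weight n k q r \<mu>" if "\<mu> \<in> diagrams n k" for \<mu>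
    using skew_howe_weight_pos[OF q r that] by simp
  have intW: "integral\<^sup>L W F = (\<Sum>\<mu>\<in>diagrams n k. skew_howe_weight n k q r \<mu> * F \<mu>)" for F
    unfolding W_def by (rule integral_skew_howe_measure[OF pos])
  have main: "integral\<^sup>L W (\<lambda>\<mu>. (X \<mu> - vacuum_trace n G) ^ m) = (hop_centered (n + k) n G ^^ m) ?\<epsilon> id" for m
  proof -
    let ?\<Psi> = "\<lambda>x. ((\<Sum>j<n. g (exp (\<gamma> / real n) ^ x j)) - vacuum_trace n G) ^ m"
    have "orthonormal_system.pairing (n + k) n P ?\<Psi> id
        = (\<Sum>\<mu>\<in>diagrams n k. (X \<mu> - vacuum_trace n G) ^ m * (orthonormal_system.slater n P (site n \<mu>))\<^sup>2)"
    proof (rule orthonormal_system.pairing_id_eq_sum[OF os bij_betw_diagram_tuples])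
      fix \<mu> p assume "p permutes {..<n}"
      then have "(\<Sum>j<n. g (exp (\<gamma> / real n) ^ site n \<mu> (p j))) = (\<Sum>j<n. g (exp (\<gamma> / real n) ^ site n \<mu> j))"
        by (intro sum.reindex_bij_betw[of p _ _ "\<lambda>j. g (exp (\<gamma> / real n) ^ site n \<mu> j)"] permutes_imp_bij)
      then show "?\<Psi> (restrict (site n \<mu> \<circ> p) {..<n}) = (X \<mu> - vacuum_trace n G) ^ m"
        by (simp add: X_def linear_statistic_eq)
    qed
    also have "\<dots> = integral\<^sup>L W (\<lambda>\<mu>. (X \<mu> - vacuum_trace n G) ^ m)"
      unfolding intW
      by (intro sum.cong refl) (simp add: weight)
    finally show ?thesis
      using orthonormal_system.pairing_hop_centered_pow[OF os, of "\<lambda>x. g (exp (\<gamma> / real n) ^ x)" m]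
      unfolding G_def by simp
  qed
  have "integral\<^sup>L W X - vacuum_trace n G = 0"
  proof -
    have funpow_one: "(hop_centered (n + k) n G ^^ 1) ?\<epsilon> = hop_centered (n + k) n G ?\<epsilon>" by simp
    have "integral\<^sup>L W (\<lambda>\<mu>. (X \<mu> - vacuum_trace n G) ^ 1) = 0"
      unfolding main funpow_one
      by (rule hop_centered_vacuum_id[OF orthonormal_system.vacuum_pairing[OF os]]) simp
    moreover have "integral\<^sup>L W (\<lambda>\<mu>. (X \<mu> - vacuum_trace n G) ^ 1) = integral\<^sup>L W X - vacuum_trace n G"
      unfolding intW using sum_skew_howe_weight[OF q r, of n k]
      by (simp add: right_diff_distrib sum_subtractf sum_distrib_right[symmetric])
    ultimately show ?thesis by simp
  qed
  then have "integral\<^sup>L W X = vacuum_trace n G" by simp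
  then show ?thesis using main[of m] by simp
qed

theorem theorem3:
  fixes c \<gamma> a b :: real and k :: "nat \<Rightarrow> nat" and q r :: "nat \<Rightarrow> real" and f :: "real \<Rightarrow> real"
  assumes "c > 0" and "\<gamma> \<noteq> 0"
    and "filterlim k at_top sequentially"
    and "(\<lambda>n. real (k n) / real n) \<longlonglongrightarrow> c"
    and "\<And>n. q n = exp (- \<gamma> / real n)"
    and case_A_or_B:
      "((\<forall>n. r n = q n) \<and>
        a = 1 / 4 * sqrt ((exp \<gamma> - 1) * (exp \<gamma> + 1) * (exp (c * \<gamma>) - 1) * (exp (c * \<gamma>) + 1)) \<and>
        b = (1 + exp (\<gamma> * (c + 1))) / 2)
       \<or>
       ((\<forall>n. r n = inverse (q n)) \<and>
        a = exp (c * \<gamma>) / (1 + exp (c * \<gamma>))\<^sup>2 *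
            sqrt (2 * (exp \<gamma> - 1) * (exp (c * \<gamma>) - 1) * (1 + exp (\<gamma> * (c + 1)))) \<and>
        b = (3 * exp (\<gamma> * (2 * c + 1)) - exp (\<gamma> * (c + 1)) + 3 * exp (c * \<gamma>) - exp (2 * c * \<gamma>))
            / (1 + exp (c * \<gamma>))\<^sup>2)"
    and "f C1_differentiable_on UNIV"
  shows "weak_conv_m
           (\<lambda>n. let M = skew_howe_measure n (k n) (q n) (r n); X = linear_statistic \<gamma> f n
                in distr M borel (\<lambda>\<omega>. X \<omega> - integral\<^sup>L M X))
           (centered_normal (\<Sum>\<^sub>\<infinity>l\<in>{1..}. real l * (cmod (fourier_coeff f a b l))\<^sup>2))"
proof -
  obtain P where os: "\<And>n. orthonormal_system (n + k n) n (P n)"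
    and weight: "\<And>n \<mu>. 1 \<le> n \<Longrightarrow> 1 \<le> k n \<Longrightarrow> \<mu> \<in> diagrams n (k n) \<Longrightarrow>
       skew_howe_weight n (k n) (q n) (r n) \<mu> = (orthonormal_system.slater n (P n) (site n \<mu>))\<^sup>2"
    and band: "\<And>n. banded 1 (orthonormal_system.mult_mat (n + k n) (P n) (\<lambda>x. exp (\<gamma> / real n) ^ x))"
    and wl: "window_lim (\<lambda>n. orthonormal_system.mult_mat (n + k n) (P n) (\<lambda>x. exp (\<gamma> / real n) ^ x))
       (\<lambda>i j. if i = j then b else if \<bar>i - j\<bar> = 1 then a else 0)"
    by (rule ensemble_sequence[OF assms(1-6)]) blast
  define t where "t n = exp (\<gamma> / real n)" for n
  define W where "W n = skew_howe_measure n (k n) (q n) (r n)" for n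
  define Y where "Y g n \<mu> = linear_statistic \<gamma> g n \<mu> - integral\<^sup>L (W n) (linear_statistic \<gamma> g n)" for g n \<mu>
  let ?G = "\<lambda>g n. orthonormal_system.mult_mat (n + k n) (P n) (\<lambda>x. g (t n ^ x))"
  let ?\<epsilon> = "\<lambda>n. orthonormal_system.pairing (n + k n) n (P n) (\<lambda>_. 1)"
  have vac: "vacuum n (?\<epsilon> n)" for n by (rule orthonormal_system.vacuum_pairing[OF os])
  have k': "filterlim (\<lambda>n. n + k n - n) at_top sequentially" using assms(3) by simp
  \<comment> \<open>For \<open>n = 0\<close> all variables coincide and the alternants degenerate, so that the measure need not
    have mass one; everything probabilistic is stated from some \<open>n0\<close> on.\<close>
  obtain n0 where n0: "\<And>n. n0 \<le> n \<Longrightarrow> 1 \<le> n \<and> 1 \<le> k n"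
  proof -
    have "\<forall>\<^sub>F n in sequentially. 1 \<le> n \<and> 1 \<le> k n"
      using assms(3) eventually_ge_at_top[of 1] by (auto simp: filterlim_at_top intro: eventually_conj)
    then show thesis using that by (auto simp: eventually_sequentially)
  qed
  have qr: "0 < q n" "q n \<noteq> 1" "0 < r n" "r n \<noteq> 1" if "n0 \<le> n" for n
  proof -
    show 1: "0 < q n" "q n \<noteq> 1" using assms(2) n0[OF that] by (auto simp: assms(5))
    have "r n = q n \<or> r n = inverse (q n)" using case_A_or_B by blast
    then show "0 < r n" "r n \<noteq> 1" using 1 by auto
  qed
  have prob: "prob_space (W n)" if "n0 \<le> n" for n
    unfolding W_def by (rule prob_space_skew_howe_measure[OF qr[OF that]])
  have meas: "F \<in> borel_measurable (W n)" for F :: "_ \<Rightarrow> real" and n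
    unfolding W_def by (rule measurable_skew_howe_measure)
  have int: "integrable (W n) F" for F :: "_ \<Rightarrow> real" and n
    unfolding W_def by (rule integrable_skew_howe_measure)
  have mom: "integral\<^sup>L (W n) (\<lambda>\<mu>. Y g n \<mu> ^ m) = (hop_centered (n + k n) n (?G g n) ^^ m) (?\<epsilon> n) id" if "n0 \<le> n" for g n m
    unfolding Y_def W_def t_def
    using n0[OF that] by (intro moments_eq_hop_centered[OF qr[OF that] os weight]) auto
  have var: "integral\<^sup>L (W n) (\<lambda>\<mu>. (Y g n \<mu>)\<^sup>2) = (\<Sum>j<n. \<Sum>i\<in>{n..<n + k n}. ?G g n j i * ?G g n i j)" if "n0 \<le> n" for g n
    unfolding mom[OF that] by (rule second_moment[OF vac]) simp
  \<comment> \<open>The multiplication matrix of a polynomial is banded, so its entries beyond the band, and hence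
    the high cosine coefficients, vanish; this makes the limiting variance a finite sum.\<close>
  have poly_lim: "(\<exists>d. \<forall>n. banded d (?G (poly g) n)) \<and> window_lim (?G (poly g)) (\<lambda>i j. cos_coeff a b (poly g) (i - j))" for g
    unfolding t_def by (rule poly_mult_mat_limit[OF os k' band wl])
  then have "\<forall>g. \<exists>d. \<forall>n. banded d (?G (poly g) n)" by blast
  then obtain d where d: "\<And>g n. banded (d g) (?G (poly g) n)" by metis
  define \<sigma> where "\<sigma> g = (\<Sum>l\<in>{1..d g}. real l * (cos_coeff a b (poly g) (int l))\<^sup>2)" for g
  have \<sigma>0: "0 \<le> \<sigma> g" for g unfolding \<sigma>_def by (intro sum_nonneg) auto
  have coeff0: "cos_coeff a b (poly g) (int l) = 0" if "d g < l" for g l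
    using window_lim_banded_zero[OF conjunct2[OF poly_lim[of g]] d[of g], of "int l" 0] that by simp
  have hlim: "(\<lambda>n. (hop_centered (n + k n) n (?G (poly g) n) ^^ m) (?\<epsilon> n) id) \<longlonglongrightarrow> gauss_moment (\<sigma> g) m" for g m
  proof -
    have "\<sigma> g = (\<Sum>l\<in>{1..d g}. real l * (cos_coeff a b (poly g) (int l) * cos_coeff a b (poly g) (- int l)))"
      by (simp add: \<sigma>_def cos_coeff_uminus power2_eq_square)
    then show ?thesis
      using wick_moments[OF vac d[of g] conjunct2[OF poly_lim[of g]] k', where m = m] by simp
  qed
  have moment_lim: "(\<lambda>n. integral\<^sup>L (W (n + n0)) (\<lambda>\<mu>. Y (poly g) (n + n0) \<mu> ^ m)) \<longlonglongrightarrow> gauss_moment (\<sigma> g) m" for g m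
    using LIMSEQ_ignore_initial_segment[OF hlim[where g = g and m = m], of n0] by (simp add: mom)
  have poly_char: "(\<lambda>n. char (distr (W (n + n0)) borel (Y (poly g) (n + n0))) s) \<longlonglongrightarrow> complex_of_real (exp (- (\<sigma> g * s\<^sup>2 / 2)))" for g s
    by (rule char_tendsto_gaussian_if_moments_tendsto[OF prob meas int moment_lim \<sigma>0]) simp
  \<comment> \<open>All nodes eventually lie in a fixed interval that also contains the limiting support; on it the
    kernel formula bounds the variance of any linear statistic by the one of the identity.\<close>
  define R where "R = exp (\<bar>\<gamma>\<bar> * (c + 2)) + (2 * \<bar>a\<bar> + \<bar>b\<bar>)"
  have R0: "0 \<le> R" and Rab: "2 * \<bar>a\<bar> + \<bar>b\<bar> \<le> R" by (simp_all add: R_def add_nonneg_nonneg)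
  have nodes: "\<forall>\<^sub>F n in sequentially. \<forall>x<n + k n. t n ^ x \<in> {-R..R}"
  proof -
    have "\<forall>\<^sub>F n in sequentially. real (k n) / real n < c + 1"
      by (rule order_tendstoD(2)[OF assms(4)]) simp
    then show ?thesis
      using eventually_gt_at_top[of 0]
    proof eventually_elim
      case (elim n)
      show ?case
      proof (intro allI impI)
        fix x assume x: "x < n + k n"
        have "real x / real n \<le> real (n + k n) / real n" using x by (intro divide_right_mono) auto
        also have "\<dots> = 1 + real (k n) / real n" using elim by (simp add: add_divide_distrib)
        also have "\<dots> \<le> c + 2" using elim by simp
        finally have "\<bar>\<gamma>\<bar> * (real x / real n) \<le> \<bar>\<gamma>\<bar> * (c + 2)" by (intro mult_left_mono) auto
        moreover have "\<gamma> * (real x / real n) \<le> \<bar>\<gamma>\<bar> * (real x / real n)" by (intro mult_right_mono) auto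
        moreover have "t n ^ x = exp (\<gamma> * (real x / real n))"
          by (simp add: t_def exp_of_nat_mult[symmetric] mult.commute)
        ultimately have "t n ^ x \<le> exp (\<bar>\<gamma>\<bar> * (c + 2))" by simp
        also have "\<dots> \<le> R" by (simp add: R_def)
        finally have "t n ^ x \<le> R" .
        moreover have "0 \<le> t n ^ x" by (simp add: t_def)
        ultimately show "t n ^ x \<in> {-R..R}" using R0 by auto
      qed
    qed
  qed
  define X1 :: "real poly" where "X1 = [:0, 1:]"
  have X1: "poly X1 x = x" for x by (simp add: X1_def)
  have var_le: "\<forall>\<^sub>F n in sequentially. integral\<^sup>L (W n) (\<lambda>\<mu>. (Y g n \<mu>)\<^sup>2) \<le> L\<^sup>2 * integral\<^sup>L (W n) (\<lambda>\<mu>. (Y (poly X1) n \<mu>)\<^sup>2)"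
    if "\<And>x y. x \<in> {-R..R} \<Longrightarrow> y \<in> {-R..R} \<Longrightarrow> \<bar>g x - g y\<bar> \<le> L * \<bar>x - y\<bar>" for g L
    using nodes eventually_ge_at_top[of n0]
  proof eventually_elim
    case (elim n)
    have "\<bar>g (t n ^ x) - g (t n ^ y)\<bar> \<le> L * \<bar>poly X1 (t n ^ x) - poly X1 (t n ^ y)\<bar>" if "x < n + k n" "y < n + k n" for x y
      using \<open>\<And>x y. x \<in> {-R..R} \<Longrightarrow> y \<in> {-R..R} \<Longrightarrow> \<bar>g x - g y\<bar> \<le> L * \<bar>x - y\<bar>\<close> elim(1) that by (simp add: X1)
    then show ?case
      unfolding var[OF elim(2)] by (rule orthonormal_system.offdiag_mono[OF os])
  qed
  have var_lim: "(\<lambda>n. integral\<^sup>L (W n) (\<lambda>\<mu>. (Y (poly g) n \<mu>)\<^sup>2)) \<longlonglongrightarrow> \<sigma> g" for g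
  proof (rule LIMSEQ_offset[of _ n0])
    show "(\<lambda>n. integral\<^sup>L (W (n + n0)) (\<lambda>\<mu>. (Y (poly g) (n + n0) \<mu>)\<^sup>2)) \<longlonglongrightarrow> \<sigma> g"
      using moment_lim[where g = g and m = 2] by (simp add: numeral_2_eq_2)
  qed
  have \<sigma>_le: "\<sigma> g \<le> L\<^sup>2 * \<sigma> X1"
    if "\<And>x y. x \<in> {-R..R} \<Longrightarrow> y \<in> {-R..R} \<Longrightarrow> \<bar>poly g x - poly g y\<bar> \<le> L * \<bar>x - y\<bar>" for g L
    by (rule tendsto_le[OF _ tendsto_mult_left[OF var_lim] var_lim var_le[OF that]]) auto
  \<comment> \<open>Polynomials whose difference from \<open>f\<close> has Lipschitz constant \<open>e m\<close>. Applied to differences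
    of two of them, the variance bound controls their Fourier data in the limit as well.\<close>
  define e where "e m = 1 / real (Suc m)" for m
  have e0: "0 < e m" for m by (simp add: e_def)
  have elim0: "e \<longlonglongrightarrow> 0" unfolding e_def by (rule LIMSEQ_Suc[OF lim_1_over_n])
  have "\<exists>g. poly g 0 = f 0 \<and> (\<forall>x\<in>{-R..R}. \<forall>y\<in>{-R..R}. \<bar>(f x - poly g x) - (f y - poly g y)\<bar> \<le> e m * \<bar>x - y\<bar>)" for m
    using C1_polynomial_approximation[OF assms(7) e0[of m], of R] by metis
  then obtain h where h0: "\<And>m. poly (h m) 0 = f 0"
    and h: "\<And>m x y. x \<in> {-R..R} \<Longrightarrow> y \<in> {-R..R} \<Longrightarrow> \<bar>(f x - poly (h m) x) - (f y - poly (h m) y)\<bar> \<le> e m * \<bar>x - y\<bar>"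
    by metis
  have contf: "continuous_on UNIV f"
    using assms(7) C1_differentiable_imp_continuous_on by blast
  let ?x = "\<lambda>l. sqrt (real l) * cos_coeff a b f (int l)"
  let ?X = "\<lambda>m l. sqrt (real l) * cos_coeff a b (poly (h m)) (int l)"
  have L2le: "L2_set (\<lambda>l. sqrt (real l) * cos_coeff a b (poly g) (int l)) {1..L} \<le> sqrt (\<sigma> g)" for g L
  proof -
    have "(\<Sum>l\<in>{1..L}. real l * (cos_coeff a b (poly g) (int l))\<^sup>2) \<le> (\<Sum>l\<in>{1..max L (d g)}. real l * (cos_coeff a b (poly g) (int l))\<^sup>2)"
      by (intro sum_mono2) auto
    also have "\<dots> = \<sigma> g"
      unfolding \<sigma>_def by (intro sum.mono_neutral_right) (auto simp: coeff0)
    finally show ?thesis by (simp add: L2_set_def power_mult_distrib)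
  qed
  have L2att: "\<exists>L. L2_set (?X m) {1..L} = sqrt (\<sigma> (h m))" for m
    by (intro exI[of _ "d (h m)"]) (simp add: L2_set_def power_mult_distrib \<sigma>_def)
  have coeff_lim: "(\<lambda>m. cos_coeff a b (poly (h m)) l) \<longlonglongrightarrow> cos_coeff a b f l" for l
  proof -
    have "\<bar>cos_coeff a b f l - cos_coeff a b (poly (h m)) l\<bar> \<le> e m * R" for m
    proof -
      have "\<bar>cos_coeff a b (\<lambda>x. f x - poly (h m) x) l\<bar> \<le> e m * R"
      proof (rule cos_coeff_bound[OF _ _ Rab])
        show "continuous_on UNIV (\<lambda>x. f x - poly (h m) x)" by (intro continuous_intros contf)
        fix x assume x: "x \<in> {-R..R}"
        have "\<bar>f x - poly (h m) x\<bar> \<le> e m * \<bar>x - 0\<bar>" using h[OF x, of 0 m] h0[of m] R0 by simp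
        also have "\<dots> \<le> e m * R" using x e0[of m] by (intro mult_left_mono) auto
        finally show "\<bar>f x - poly (h m) x\<bar> \<le> e m * R" .
      qed
      then show ?thesis by (subst (asm) cos_coeff_diff) (auto intro: contf continuous_intros)
    qed
    then have "\<forall>m. norm (cos_coeff a b (poly (h m)) l - cos_coeff a b f l) \<le> e m * R"
      by (simp add: abs_minus_commute)
    moreover have "(\<lambda>m. e m * R) \<longlonglongrightarrow> 0" using tendsto_mult_right[OF elim0, of R] by simp
    ultimately have "(\<lambda>m. cos_coeff a b (poly (h m)) l - cos_coeff a b f l) \<longlonglongrightarrow> 0"
      by (rule Lim_null_comparison[OF always_eventually])
    then show ?thesis by (simp add: LIM_zero_iff)
  qed
  have L2diff: "L2_set (\<lambda>l. ?X m l - ?x l) {1..L} \<le> e m * sqrt (\<sigma> X1)" for m L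
  proof (rule tendsto_le[OF sequentially_bot])
    show "(\<lambda>m'. (e m + e m') * sqrt (\<sigma> X1)) \<longlonglongrightarrow> e m * sqrt (\<sigma> X1)"
      using tendsto_mult_right[OF tendsto_add[OF tendsto_const elim0], of "e m" "sqrt (\<sigma> X1)"] by simp
    show "(\<lambda>m'. L2_set (\<lambda>l. ?X m l - ?X m' l) {1..L}) \<longlonglongrightarrow> L2_set (\<lambda>l. ?X m l - ?x l) {1..L}"
      unfolding L2_set_def by (intro tendsto_intros coeff_lim)
    show "\<forall>\<^sub>F m' in sequentially. L2_set (\<lambda>l. ?X m l - ?X m' l) {1..L} \<le> (e m + e m') * sqrt (\<sigma> X1)"
    proof (intro always_eventually allI)
      fix m'
      have "cos_coeff a b (poly (h m - h m')) l = cos_coeff a b (poly (h m)) l - cos_coeff a b (poly (h m')) l" for l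
        unfolding cos_coeff_diff[OF continuous_on_poly[OF continuous_on_id] continuous_on_poly[OF continuous_on_id], symmetric]
        by (rule cos_coeff_cong) simp
      then have "L2_set (\<lambda>l. ?X m l - ?X m' l) {1..L} \<le> sqrt (\<sigma> (h m - h m'))"
        using L2le[of "h m - h m'" L] by (simp add: right_diff_distrib)
      also have "\<dots> \<le> sqrt ((e m + e m')\<^sup>2 * \<sigma> X1)"
      proof (intro real_sqrt_le_mono \<sigma>_le)
        fix x y assume xy: "x \<in> {-R..R}" "y \<in> {-R..R}"
        have "poly (h m - h m') x - poly (h m - h m') y
            = ((f x - poly (h m') x) - (f y - poly (h m') y)) - ((f x - poly (h m) x) - (f y - poly (h m) y))" by simp
        also have "\<bar>\<dots>\<bar> \<le> e m' * \<bar>x - y\<bar> + e m * \<bar>x - y\<bar>"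
          using h[OF xy, of m] h[OF xy, of m'] by linarith
        finally show "\<bar>poly (h m - h m') x - poly (h m - h m') y\<bar> \<le> (e m + e m') * \<bar>x - y\<bar>"
          by (simp add: algebra_simps)
      qed
      also have "\<dots> = (e m + e m') * sqrt (\<sigma> X1)"
        using e0[of m] e0[of m'] by (simp add: real_sqrt_mult)
      finally show "L2_set (\<lambda>l. ?X m l - ?X m' l) {1..L} \<le> (e m + e m') * sqrt (\<sigma> X1)" .
    qed
  qed
  define V where "V = (\<Sum>\<^sub>\<infinity>l\<in>{1..}. real l * (cmod (fourier_coeff f a b l))\<^sup>2)"
  have V: "V = (\<Sum>\<^sub>\<infinity>l\<in>{1..}. (?x l)\<^sup>2)"
    unfolding V_def cmod_fourier_coeff[OF contf] by (simp add: power_mult_distrib)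
  have V0: "0 \<le> V" unfolding V by (intro infsum_nonneg) auto
  have "(\<lambda>m. sqrt (\<sigma> (h m))) \<longlonglongrightarrow> sqrt V"
    unfolding V
  proof (rule tendsto_sqrt_infsum[OF L2diff L2le L2att])
    show "(\<lambda>m. e m * sqrt (\<sigma> X1)) \<longlonglongrightarrow> 0" using tendsto_mult_right[OF elim0, of "sqrt (\<sigma> X1)"] by simp
  qed
  then have "(\<lambda>m. (sqrt (\<sigma> (h m)))\<^sup>2) \<longlonglongrightarrow> (sqrt V)\<^sup>2" by (rule tendsto_power)
  then have \<sigma>V: "(\<lambda>m. \<sigma> (h m)) \<longlonglongrightarrow> V" using \<sigma>0 V0 by simp
  \<comment> \<open>Replacing \<open>f\<close> by its \<open>m\<close>-th polynomial costs at most \<open>\<bar>s\<bar> e m\<close> times a bounded standard deviation.\<close>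
  have char_lim: "(\<lambda>n. char (distr (W (n + n0)) borel (Y f (n + n0))) s) \<longlonglongrightarrow> complex_of_real (exp (- (V * s\<^sup>2 / 2)))" for s
  proof (rule tendsto_by_approximation[OF poly_char])
    show "(\<lambda>m. complex_of_real (exp (- (\<sigma> (h m) * s\<^sup>2 / 2)))) \<longlonglongrightarrow> complex_of_real (exp (- (V * s\<^sup>2 / 2)))"
      by (intro tendsto_intros \<sigma>V) auto
    show "(\<lambda>m. \<bar>s\<bar> * (e m * sqrt (\<sigma> X1 + 1))) \<longlonglongrightarrow> 0"
      using tendsto_mult_left[OF tendsto_mult_right[OF elim0, of "sqrt (\<sigma> X1 + 1)"], of "\<bar>s\<bar>"] by simp
    fix m
    have "\<forall>\<^sub>F n in sequentially. integral\<^sup>L (W n) (\<lambda>\<mu>. (Y (poly X1) n \<mu>)\<^sup>2) < \<sigma> X1 + 1"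
      by (rule order_tendstoD(2)[OF var_lim]) simp
    moreover have "\<forall>\<^sub>F n in sequentially. integral\<^sup>L (W n) (\<lambda>\<mu>. (Y (\<lambda>x. f x - poly (h m) x) n \<mu>)\<^sup>2)
        \<le> (e m)\<^sup>2 * integral\<^sup>L (W n) (\<lambda>\<mu>. (Y (poly X1) n \<mu>)\<^sup>2)"
      by (rule var_le) (rule h)
    ultimately have "\<forall>\<^sub>F n in sequentially. n0 \<le> n \<longrightarrow> dist (char (distr (W n) borel (Y f n)) s) (char (distr (W n) borel (Y (poly (h m)) n)) s)
        \<le> \<bar>s\<bar> * (e m * sqrt (\<sigma> X1 + 1))"
    proof eventually_elim
      case (elim n)
      show ?case
      proof
        assume n: "n0 \<le> n"
        have "Y f n \<mu> - Y (poly (h m)) n \<mu> = Y (\<lambda>x. f x - poly (h m) x) n \<mu>" for \<mu>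
        proof -
          have "linear_statistic \<gamma> (\<lambda>x. f x - poly (h m) x) n = (\<lambda>\<mu>. linear_statistic \<gamma> f n \<mu> - linear_statistic \<gamma> (poly (h m)) n \<mu>)"
            by (simp add: linear_statistic_def sum_subtractf fun_eq_iff)
          then show ?thesis
            unfolding Y_def by (simp add: Bochner_Integration.integral_diff[OF int int])
        qed
        then have "cmod (char (distr (W n) borel (Y f n)) s - char (distr (W n) borel (Y (poly (h m)) n)) s)
            \<le> \<bar>s\<bar> * sqrt (integral\<^sup>L (W n) (\<lambda>\<mu>. (Y (\<lambda>x. f x - poly (h m) x) n \<mu>)\<^sup>2))"
          using char_diff_le[where Y = "Y f n" and Z = "Y (poly (h m)) n" and t = s, OF prob[OF n] meas meas int] by simp
        also have "integral\<^sup>L (W n) (\<lambda>\<mu>. (Y (\<lambda>x. f x - poly (h m) x) n \<mu>)\<^sup>2) \<le> (e m)\<^sup>2 * (\<sigma> X1 + 1)"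
          using elim by (smt (verit) mult_left_mono zero_le_power2)
        also have "\<bar>s\<bar> * sqrt ((e m)\<^sup>2 * (\<sigma> X1 + 1)) = \<bar>s\<bar> * (e m * sqrt (\<sigma> X1 + 1))"
          using e0[of m] by (simp add: real_sqrt_mult)
        finally show "dist (char (distr (W n) borel (Y f n)) s) (char (distr (W n) borel (Y (poly (h m)) n)) s) \<le> \<bar>s\<bar> * (e m * sqrt (\<sigma> X1 + 1))"
          by (simp add: dist_norm mult_left_mono)
      qed
    qed
    then show "\<forall>\<^sub>F n in sequentially. dist (char (distr (W (n + n0)) borel (Y f (n + n0))) s) (char (distr (W (n + n0)) borel (Y (poly (h m)) (n + n0))) s)
        \<le> \<bar>s\<bar> * (e m * sqrt (\<sigma> X1 + 1))"
      by (subst (asm) eventually_sequentially_seg[symmetric, of _ n0]) simp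
  qed
  have "weak_conv_m (\<lambda>n. distr (W (n + n0)) borel (Y f (n + n0))) (centered_normal V)"
  proof (rule levy_continuity)
    show "real_distribution (distr (W (n + n0)) borel (Y f (n + n0)))" for n
      by (rule prob_space.real_distribution_distr[OF prob meas]) simp
    show "real_distribution (centered_normal V)" by (rule real_distribution_centered_normal[OF V0])
    show "(\<lambda>n. char (distr (W (n + n0)) borel (Y f (n + n0))) s) \<longlonglongrightarrow> char (centered_normal V) s" for s
      using char_lim[of s] by (simp add: char_centered_normal[OF V0])
  qed
  then have "weak_conv_m (\<lambda>n. distr (W n) borel (Y f n)) (centered_normal V)"
    unfolding weak_conv_m_def weak_conv_def by (auto intro: LIMSEQ_offset[of _ n0])
  moreover have "(\<lambda>n. let M = skew_howe_measure n (k n) (q n) (r n); X = linear_statistic \<gamma> f n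
                in distr M borel (\<lambda>\<omega>. X \<omega> - integral\<^sup>L M X)) = (\<lambda>n. distr (W n) borel (Y f n))"
    unfolding Let_def W_def Y_def ..
  ultimately show ?thesis unfolding V_def by simp
qed

end
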